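(* Let $X$ be a continuous vector field on $\mathbb{S}^1$, let $\omega_X:\mathbb{D}^2\to\mathbb{R}$ be its (pointwise) width function, and let $\mathrm{HL}(X)$ be the associated harmonic Lagrangian vector field on $\mathbb{H}^2$. The following are equivalent: (1) $X$ is little Zygmund. (2) $\lVert\overline{\partial}\,\mathrm{HL}(X)_p\rVert$ tends to zero as $p\in\mathbb{H}^2$ tends to the boundary (at infinity) of $\mathbb{H}^2$. (3) $\omega_X(z)$ tends to zero as $|z|\to1$.
   Context: Minkowski space $\mathbb{R}^{1,2}$ is $\mathbb{R}^3$ with $\langle x,y\rangle_{1,2}=-x_0y_0+x_1y_1+x_2y_2$. The hyperbolic plane is $\mathbb{H}^2=\{x\in\mathbb{R}^{1,2}: \langle x,x\rangle_{1,2}=-1,\ x_0>0\}$ with the induced Riemannian metric $g$, Levi-Civita connection $\nabla$ and complex structure $\mathrm{J}_p(v)=p\boxtimes v$, where $\langle x\boxtimes y,v\rangle_{1,2}=\det(x,y,v)$ for all $v$. $\mathrm{grad}$ and $\Delta$ are the gradient and Laplace-Beltrami operator ($\Delta=\mathrm{tr}\,\mathrm{Hess}$). $\mathbb{D}^2\subset\mathbb{R}^2\cong\mathbb{C}$ is the open unit disk, $\mathbb{S}^1=\partial\mathbb{D}^2$, $\Pi:\mathbb{H}^2\to\mathbb{D}^2$, $\Pi(x_0,x_1,x_2)=(x_1/x_0,x_2/x_0)$; for $u:\mathbb{H}^2\to\mathbb{R}$ set $\overline{u}(\eta)=\sqrt{1-|\eta|^2}\,u(\Pi^{-1}(\eta))$.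 "$p$ tends to the boundary" means $|\Pi(p)|\to1$. The support function $\phi_X:\mathbb{S}^1\to\mathbb{R}$ of $X$ is defined by $X(z)=iz\,\phi_X(z)$. It is known that there is a unique smooth $u_X:\mathbb{H}^2\to\mathbb{R}$ with $\Delta u_X-2u_X=0$ and $\overline{u_X}$ extending continuously to $\overline{\mathbb{D}^2}$ with $\overline{u_X}|_{\mathbb{S}^1}=\phi_X$. Then $\mathrm{HL}(X):=\mathrm{J}\,\mathrm{grad}(u_X)$. $\overline{\partial}V(Y):=\frac12(\nabla_YV+\mathrm{J}\nabla_{\mathrm{J}Y}V)$, and $\lVert\overline{\partial}V_p\rVert$ is the operator norm on $(\mathrm{T}_p\mathbb{H}^2,g)$. For $z\in\overline{\mathbb{D}^2}$, $\phi_X^-(z)=\sup\{a(z)\}$ over affine $a:\mathbb{R}^2\to\mathbb{R}$ with $a|_{\mathbb{S}^1}\le\phi_X$, $\phi_X^+(z)=\inf\{a(z)\}$ over affine $a$ with $\phi_X\le a|_{\mathbb{S}^1}$, and $\omega_X(\eta)=\frac{\phi_X^+(\eta)-\phi_X^-(\eta)}{\sqrt{1-|\eta|^2}}$ for $\eta\in\mathbb{D}^2$. For a quadruple $Q=[a,b,c,d]$ of points of $\mathbb{S}^1$ in counterclockwise order, $\mathrm{cr}(Q)=\frac{(b-a)(d-c)}{(c-b)(d-a)}$, $X[Q]=\frac{X(b)-X(a)}{b-a}-\frac{X(c)-X(b)}{c-b}+\frac{X(d)-X(c)}{d-c}-\frac{X(a)-X(d)}{a-d}$ ($X$ being $\mathbb{C}$-valued),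 and the minimal scale is $S(Q)=\min\{|a-b|,|b-c|,|c-d|,|d-a|\}$. A continuous $X$ is Zygmund if $\sup_{\mathrm{cr}(Q)=1}|X[Q]|<+\infty$. A sequence $(Q_n)$ of quadruples is degenerating if $\mathrm{cr}(Q_n)=1$ for all $n$ and $S(Q_n)\to0$. A Zygmund vector field $X$ is little Zygmund if $\sup\limsup_{n\to\infty}|X[Q_n]|=0$, the supremum being over all degenerating sequences $(Q_n)$. *)

theory Defs
  imports "HOL-Analysis.Analysis"
begin

section \<open>Minkowski space and the hyperbolic plane\<close>

text \<open>The coordinates \<open>x\<^sub>0, x\<^sub>1, x\<^sub>2\<close> are \<open>x $ 1\<close>, \<open>x $ 2\<close>, \<open>x $ 3\<close>.\<close>

definition mink :: "real^3 \<Rightarrow> real^3 \<Rightarrow> real" where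
  "mink x y = - (x$1 * y$1) + x$2 * y$2 + x$3 * y$3"

definition mcross :: "real^3 \<Rightarrow> real^3 \<Rightarrow> real^3" (infixl "\<boxtimes>" 75) where
  "x \<boxtimes> y = (THE w. \<forall>v. mink w v = det (vector [x, y, v] :: real^3^3))"

definition H2 :: "(real^3) set" where
  "H2 = {x. mink x x = -1 \<and> x$1 > 0}"

definition tangent :: "real^3 \<Rightarrow> (real^3) set" where
  "tangent p = {v. mink v p = 0}"

definition gnorm :: "real^3 \<Rightarrow> real" where
  "gnorm v = sqrt (mink v v)"

definition hJ :: "real^3 \<Rightarrow> real^3 \<Rightarrow> real^3" where
  "hJ p v = p \<boxtimes> v"

definition Klein :: "real^3 \<Rightarrow> complex" where
  "Klein x = Complex (x$2 / x$1) (x$3 / x$1)"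

definition boundary_H2 :: "(real^3) filter" where
  "boundary_H2 = inf (filtercomap (\<lambda>p. cmod (Klein p)) (at_left 1)) (principal H2)"


section \<open>Calculus on the hyperbolic plane\<close>

text \<open>A map \<open>f\<close> on \<open>H2\<close> is differentiated through its extension \<open>f \<circ> retract_H2\<close> to the open
  future cone, which is constant along rays. As \<open>retract_H2\<close> is a smooth retraction onto \<open>H2\<close>,
  \<open>f\<close> is smooth on the submanifold \<open>H2\<close> iff this extension is smooth, and \<open>hderiv f p\<close>
  restricted to \<open>tangent p\<close> is the differential of \<open>f\<close> at \<open>p\<close>
  (see \<open>hderiv_eq\<close> below). Values of \<open>f\<close> outside \<open>H2\<close> play no role.\<close>

definition future_cone :: "(real^3) set" where
  "future_cone = {x. mink x x < 0 \<and> x$1 > 0}"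

definition retract_H2 :: "real^3 \<Rightarrow> real^3" where
  "retract_H2 x = x /\<^sub>R sqrt (- mink x x)"

text \<open>\<open>Ck_on k f S\<close>: the map \<open>f\<close> is of class \<open>C\<^sup>k\<close> on the open set \<open>S\<close>.\<close>

primrec Ck_on :: "nat \<Rightarrow> ('a::real_normed_vector \<Rightarrow> 'b::real_normed_vector) \<Rightarrow> 'a set \<Rightarrow> bool" where
  "Ck_on 0 f S \<longleftrightarrow> continuous_on S f"
| "Ck_on (Suc k) f S \<longleftrightarrow> (\<forall>x\<in>S. f differentiable (at x)) \<and>
     (\<forall>v. Ck_on k (\<lambda>x. frechet_derivative f (at x) v) S)"

definition smooth_H2 :: "(real^3 \<Rightarrow> 'b::real_normed_vector) \<Rightarrow> bool" where
  "smooth_H2 f \<longleftrightarrow> (\<forall>k. Ck_on k (f \<circ> retract_H2) future_cone)"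

definition hderiv :: "(real^3 \<Rightarrow> 'b::real_normed_vector) \<Rightarrow> real^3 \<Rightarrow> real^3 \<Rightarrow> 'b" where
  "hderiv f p = frechet_derivative (f \<circ> retract_H2) (at p)"

definition grad :: "(real^3 \<Rightarrow> real) \<Rightarrow> real^3 \<Rightarrow> real^3" where
  "grad u p = (THE v. v \<in> tangent p \<and> (\<forall>w\<in>tangent p. mink v w = hderiv u p w))"

text \<open>\<open>nabla V p Y\<close> is \<open>\<nabla>\<^sub>Y V\<close> at \<open>p\<close>. The Levi-Civita connection of the induced metric is the
  tangential part of the flat derivative of Minkowski space; the orthogonal projection onto
  \<open>tangent p\<close> is \<open>w \<mapsto> w + \<langle>w,p\<rangle> p\<close> because \<open>\<langle>p,p\<rangle> = -1\<close>. Compatibility with the metric and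
  vanishing torsion are \<open>nabla_metric\<close> and \<open>nabla_torsion_free\<close> below.\<close>

definition nabla :: "(real^3 \<Rightarrow> real^3) \<Rightarrow> real^3 \<Rightarrow> real^3 \<Rightarrow> real^3" where
  "nabla V p Y = hderiv V p Y + mink (hderiv V p Y) p *\<^sub>R p"

definition Hess :: "(real^3 \<Rightarrow> real) \<Rightarrow> real^3 \<Rightarrow> real^3 \<Rightarrow> real^3 \<Rightarrow> real" where
  "Hess u p v w = mink (nabla (grad u) p v) w"

definition orthonormal_frame :: "real^3 \<Rightarrow> real^3 \<Rightarrow> real^3 \<Rightarrow> bool" where
  "orthonormal_frame p e f \<longleftrightarrow> e \<in> tangent p \<and> f \<in> tangent p \<and>
     mink e e = 1 \<and> mink f f = 1 \<and> mink e f = 0"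

definition Laplace :: "(real^3 \<Rightarrow> real) \<Rightarrow> real^3 \<Rightarrow> real" where
  "Laplace u p = (THE r. \<forall>e f. orthonormal_frame p e f \<longrightarrow> r = Hess u p e e + Hess u p f f)"

definition dbar :: "(real^3 \<Rightarrow> real^3) \<Rightarrow> real^3 \<Rightarrow> real^3 \<Rightarrow> real^3" where
  "dbar V p Y = (1/2) *\<^sub>R (nabla V p Y + hJ p (nabla V p (hJ p Y)))"

definition tangent_onorm :: "real^3 \<Rightarrow> (real^3 \<Rightarrow> real^3) \<Rightarrow> real" where
  "tangent_onorm p A = Sup {gnorm (A Y) | Y. Y \<in> tangent p \<and> gnorm Y \<le> 1}"


section \<open>Vector fields on the circle and their harmonic Lagrangian extension\<close>

definition continuous_circle_field :: "(complex \<Rightarrow> complex) \<Rightarrow> bool" where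
  "continuous_circle_field X \<longleftrightarrow> continuous_on (sphere 0 1) X \<and> (\<forall>z\<in>sphere 0 1. X z \<bullet> z = 0)"

definition supp_fun :: "(complex \<Rightarrow> complex) \<Rightarrow> complex \<Rightarrow> real" where
  "supp_fun X z = (THE r. X z = \<i> * z * complex_of_real r)"

definition disk_fun :: "(real^3 \<Rightarrow> real) \<Rightarrow> complex \<Rightarrow> real" where
  "disk_fun u \<eta> = sqrt (1 - (cmod \<eta>)\<^sup>2) * u (inv_into H2 Klein \<eta>)"

definition harmonic_extension :: "(complex \<Rightarrow> complex) \<Rightarrow> (real^3 \<Rightarrow> real) \<Rightarrow> bool" where
  "harmonic_extension X u \<longleftrightarrow> smooth_H2 u \<and> (\<forall>p\<in>H2. Laplace u p - 2 * u p = 0) \<and>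
     (\<exists>F. continuous_on (cball 0 1) F \<and> (\<forall>\<eta>\<in>ball 0 1. F \<eta> = disk_fun u \<eta>) \<and>
          (\<forall>z\<in>sphere 0 1. F z = supp_fun X z))"

text \<open>Functions on \<open>H2\<close> are total functions here, so uniqueness only holds among those taking
  the default value outside \<open>H2\<close>, i.e. in \<open>extensional H2\<close>.\<close>

definition u_of :: "(complex \<Rightarrow> complex) \<Rightarrow> real^3 \<Rightarrow> real" where
  "u_of X = (THE u. u \<in> extensional H2 \<and> harmonic_extension X u)"

definition HL :: "(complex \<Rightarrow> complex) \<Rightarrow> real^3 \<Rightarrow> real^3" where
  "HL X p = hJ p (grad (u_of X) p)"


section \<open>The width function\<close>

definition affine_fun :: "(complex \<Rightarrow> real) \<Rightarrow> bool" where
  "affine_fun a \<longleftrightarrow> (\<exists>L c. linear L \<and> a = (\<lambda>z. L z + c))"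

definition phi_minus :: "(complex \<Rightarrow> complex) \<Rightarrow> complex \<Rightarrow> real" where
  "phi_minus X z = Sup {a z | a. affine_fun a \<and> (\<forall>w\<in>sphere 0 1. a w \<le> supp_fun X w)}"

definition phi_plus :: "(complex \<Rightarrow> complex) \<Rightarrow> complex \<Rightarrow> real" where
  "phi_plus X z = Inf {a z | a. affine_fun a \<and> (\<forall>w\<in>sphere 0 1. supp_fun X w \<le> a w)}"

definition width :: "(complex \<Rightarrow> complex) \<Rightarrow> complex \<Rightarrow> real" where
  "width X \<eta> = (phi_plus X \<eta> - phi_minus X \<eta>) / sqrt (1 - (cmod \<eta>)\<^sup>2)"


section \<open>Zygmund and little Zygmund vector fields\<close>

type_synonym quadruple = "complex \<times> complex \<times> complex \<times> complex"

definition ccw_quadruple :: "quadruple \<Rightarrow> bool" where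
  "ccw_quadruple = (\<lambda>(a, b, c, d). \<exists>s t u v. s < t \<and> t < u \<and> u < v \<and> v < s + 2 * pi \<and>
     a = cis s \<and> b = cis t \<and> c = cis u \<and> d = cis v)"

definition cross_ratio :: "quadruple \<Rightarrow> complex" where
  "cross_ratio = (\<lambda>(a, b, c, d). ((b - a) * (d - c)) / ((c - b) * (d - a)))"

definition field_at :: "(complex \<Rightarrow> complex) \<Rightarrow> quadruple \<Rightarrow> complex" where
  "field_at X = (\<lambda>(a, b, c, d). (X b - X a) / (b - a) - (X c - X b) / (c - b)
     + (X d - X c) / (d - c) - (X a - X d) / (a - d))"

definition min_scale :: "quadruple \<Rightarrow> real" where
  "min_scale = (\<lambda>(a, b, c, d). Min {cmod (a - b), cmod (b - c), cmod (c - d), cmod (d - a)})"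

definition zygmund :: "(complex \<Rightarrow> complex) \<Rightarrow> bool" where
  "zygmund X \<longleftrightarrow> continuous_circle_field X \<and>
     bdd_above {cmod (field_at X Q) | Q. ccw_quadruple Q \<and> cross_ratio Q = 1}"

definition degenerating :: "(nat \<Rightarrow> quadruple) \<Rightarrow> bool" where
  "degenerating Q \<longleftrightarrow> (\<forall>n. ccw_quadruple (Q n) \<and> cross_ratio (Q n) = 1) \<and>
     (\<lambda>n. min_scale (Q n)) \<longlonglongrightarrow> 0"

definition little_zygmund :: "(complex \<Rightarrow> complex) \<Rightarrow> bool" where
  "little_zygmund X \<longleftrightarrow> zygmund X \<and>
     (SUP Q\<in>{Q. degenerating Q}. limsup (\<lambda>n. ereal (cmod (field_at X (Q n))))) = 0"



section \<open>Consistency of the definitions\<close>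

lemma bounded_bilinear_mink: "bounded_bilinear mink"
proof -
  have "mink = (\<lambda>x y. x \<bullet> (\<chi> i. if i = 1 then - (y$1) else y$i))"
    by (auto simp: mink_def inner_vec_def sum_3 fun_eq_iff)
  moreover have "bounded_linear (\<lambda>y::real^3. \<chi> i. if i = 1 then - (y$1) else y$i)"
    by (intro linear_conv_bounded_linear[THEN iffD1] linearI) (auto simp: vec_eq_iff)
  note bounded_bilinear.comp[OF bounded_bilinear_inner bounded_linear_ident this]
  ultimately show ?thesis by simp
qed

interpretation mink: bounded_bilinear mink
  by (rule bounded_bilinear_mink)

lemma mink_commute: "mink x y = mink y x"
  by (simp add: mink_def mult.commute)

lemma mink_nondegenerate: "(\<forall>v. mink w v = mink w' v) \<longleftrightarrow> w = w'"
proof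
  assume *: "\<forall>v. mink w v = mink w' v"
  have "w $ i = w' $ i" for i
    using *[rule_format, of "axis i 1"] exhaust_3[of i] by (auto simp: mink_def axis_def)
  then show "w = w'" by (simp add: vec_eq_iff)
qed auto

lemma mink_mcross: "mink (x \<boxtimes> y) v = det (vector [x, y, v] :: real^3^3)"
proof -
  let ?w = "vector [x$3 * y$2 - x$2 * y$3, x$3 * y$1 - x$1 * y$3, x$1 * y$2 - x$2 * y$1] :: real^3"
  have *: "\<forall>v. mink ?w v = det (vector [x, y, v] :: real^3^3)"
    by (simp add: mink_def det_3 algebra_simps)
  then have "x \<boxtimes> y = ?w"
    unfolding mcross_def by (intro the_equality) (auto simp: mink_nondegenerate simp flip: *[rule_format])
  then show ?thesis using * by simp
qed

lemma H2_subset_cone: "H2 \<subseteq> future_cone"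
  by (auto simp: H2_def future_cone_def)

lemma open_future_cone: "open future_cone"
  unfolding future_cone_def mink_def
  by (intro open_Collect_conj open_Collect_less continuous_intros)

lemma retract_H2_in: "x \<in> future_cone \<Longrightarrow> retract_H2 x \<in> H2"
  by (auto simp: future_cone_def retract_H2_def H2_def mink.scaleR_left mink.scaleR_right
      field_simps simp flip: power2_eq_square)

lemma retract_H2_id: "p \<in> H2 \<Longrightarrow> retract_H2 p = p"
  by (simp add: retract_H2_def H2_def)

lemma retract_H2_has_derivative:
  assumes "p \<in> H2"
  shows "(retract_H2 has_derivative (\<lambda>v. v + mink v p *\<^sub>R p)) (at p)"
proof -
  have m: "mink p p = -1" using assms by (simp add: H2_def)
  have "((\<lambda>x. mink x x) has_derivative (\<lambda>v. mink p v + mink v p)) (at p)"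
    by (rule mink.FDERIV[OF has_derivative_ident has_derivative_ident])
  then have d: "((\<lambda>x. mink x x) has_derivative (\<lambda>v. 2 * mink v p)) (at p)"
    by (simp add: mink_commute)
  have "((\<lambda>x. inverse (sqrt (- mink x x))) has_derivative (\<lambda>v. mink v p)) (at p)"
    using m by (auto intro!: derivative_eq_intros d)
  from has_derivative_scaleR[OF this has_derivative_ident] show ?thesis
    unfolding retract_H2_def using m by (simp add: fun_eq_iff add.commute)
qed

lemma hderiv_eq:
  assumes p: "p \<in> H2" and f: "(f has_derivative f') (at p within H2)" and v: "v \<in> tangent p"
  shows "hderiv f p v = f' v"
proof -
  have "(f has_derivative f') (at (retract_H2 p) within retract_H2 ` future_cone)"
    using f p retract_H2_in by (auto intro!: has_derivative_subset[OF f] simp: retract_H2_id)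
  from diff_chain_within[OF has_derivative_at_withinI[OF retract_H2_has_derivative[OF p]] this]
  have "(f \<circ> retract_H2 has_derivative f' \<circ> (\<lambda>v. v + mink v p *\<^sub>R p)) (at p within future_cone)" .
  moreover have "at p within future_cone = at p"
    using p H2_subset_cone open_future_cone by (auto intro: at_within_open)
  ultimately have "hderiv f p = f' \<circ> (\<lambda>v. v + mink v p *\<^sub>R p)"
    unfolding hderiv_def by (intro frechet_derivative_at[symmetric]) (simp only:)
  then show ?thesis using v by (simp add: tangent_def)
qed

lemma hderiv_has_derivative:
  "(f \<circ> retract_H2) differentiable (at p) \<Longrightarrow> ((f \<circ> retract_H2) has_derivative hderiv f p) (at p)"
  unfolding hderiv_def by (simp add: frechet_derivative_works)

lemma nabla_metric:
  assumes p: "p \<in> H2"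
    and V: "(V \<circ> retract_H2) differentiable (at p)" "V p \<in> tangent p"
    and W: "(W \<circ> retract_H2) differentiable (at p)" "W p \<in> tangent p"
  shows "hderiv (\<lambda>q. mink (V q) (W q)) p Y = mink (nabla V p Y) (W p) + mink (V p) (nabla W p Y)"
proof -
  have "((\<lambda>x. mink ((V \<circ> retract_H2) x) ((W \<circ> retract_H2) x)) has_derivative
      (\<lambda>Y. mink ((V \<circ> retract_H2) p) (hderiv W p Y) + mink (hderiv V p Y) ((W \<circ> retract_H2) p))) (at p)"
    by (rule mink.FDERIV[OF hderiv_has_derivative[OF V(1)] hderiv_has_derivative[OF W(1)]])
  then have "((\<lambda>q. mink (V q) (W q)) \<circ> retract_H2 has_derivative
      (\<lambda>Y. mink (V p) (hderiv W p Y) + mink (hderiv V p Y) (W p))) (at p)"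
    by (simp add: o_def retract_H2_id[OF p])
  then have "hderiv (\<lambda>q. mink (V q) (W q)) p =
      (\<lambda>Y. mink (V p) (hderiv W p Y) + mink (hderiv V p Y) (W p))"
    unfolding hderiv_def[of "\<lambda>q. mink (V q) (W q)"] by (rule frechet_derivative_at[symmetric])
  moreover have "mink (V p) p = 0" "mink p (W p) = 0"
    using V(2) W(2) mink_commute[of p "W p"] by (simp_all add: tangent_def)
  ultimately show ?thesis
    by (simp add: nabla_def mink.add_left mink.add_right mink.scaleR_left mink.scaleR_right)
qed

text \<open>The right-hand side is the Lie bracket \<open>[V, W]\<close> at \<open>p\<close>.\<close>

lemma nabla_torsion_free:
  assumes p: "p \<in> H2"
    and V: "(V \<circ> retract_H2) differentiable (at p)" "\<And>q. q \<in> H2 \<Longrightarrow> V q \<in> tangent q"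
    and W: "(W \<circ> retract_H2) differentiable (at p)" "\<And>q. q \<in> H2 \<Longrightarrow> W q \<in> tangent q"
  shows "nabla W p (V p) - nabla V p (W p) = hderiv W p (V p) - hderiv V p (W p)"
proof -
  have *: "mink (hderiv U p Y) p = - mink (U p) Y"
    if U: "(U \<circ> retract_H2) differentiable (at p)" "\<And>q. q \<in> H2 \<Longrightarrow> U q \<in> tangent q"
      and Y: "Y \<in> tangent p" for U Y
  proof -
    have "((\<lambda>x. mink ((U \<circ> retract_H2) x) (retract_H2 x)) has_derivative
      (\<lambda>Y. mink ((U \<circ> retract_H2) p) (Y + mink Y p *\<^sub>R p) + mink (hderiv U p Y) (retract_H2 p))) (at p)"
      by (rule mink.FDERIV[OF hderiv_has_derivative[OF U(1)] retract_H2_has_derivative[OF p]])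
    moreover have "((\<lambda>x. mink ((U \<circ> retract_H2) x) (retract_H2 x)) has_derivative (\<lambda>_. 0)) (at p)"
      by (rule has_derivative_transform_within_open[OF has_derivative_const open_future_cone])
        (use p H2_subset_cone retract_H2_in U(2) in \<open>auto simp: tangent_def\<close>)
    ultimately have "(\<lambda>Y. mink ((U \<circ> retract_H2) p) (Y + mink Y p *\<^sub>R p)
        + mink (hderiv U p Y) (retract_H2 p)) = (\<lambda>_. 0)"
      by (rule has_derivative_unique)
    from fun_cong[OF this, of Y] have "mink (U p) (Y + mink Y p *\<^sub>R p) + mink (hderiv U p Y) p = 0"
      by (simp add: retract_H2_id[OF p])
    then show ?thesis using Y by (simp add: tangent_def)
  qed
  show ?thesis
    using *[OF V W(2)[OF p]] *[OF W V(2)[OF p]] by (simp add: nabla_def mink_commute)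
qed

end

theory Submission
  imports Defs
begin

text \<open>Write \<open>\<phi>\<close> for the support function of \<open>X\<close> and \<open>\<langle>\<cdot>,\<cdot>\<rangle>\<close> for \<open>mink\<close>. Affine functions of
\<open>\<eta>\<close> are exactly the restrictions of linear forms of Minkowski space to the slice \<open>x\<^sub>0 = 1\<close>, so
the whole statement is about the degree one homogeneous extension of \<open>\<phi>\<close> to the light cone,
up to linear forms, and is invariant under isometries of the hyperbolic plane.

The harmonic extension is explicit: \<open>u(p) = 1/(2\<pi>) \<integral> \<phi>(z) / \<langle>p,(1,z)\<rangle>\<^sup>2 dz\<close>
(\<open>u_of_eq\<close>). It is a positive operator in \<open>\<phi>\<close> and reproduces linear forms (\<open>poisson_horo\<close>),
and these two facts already give the boundary values: near a boundary point \<open>\<phi>\<close> is squeezed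
between affine functions (\<open>poisson_boundary\<close>). Uniqueness is a maximum principle for the quotient
of the difference of two solutions by the strict supersolution \<open>p\<^sub>0 + 1\<close> (\<open>harmonic_extension_le\<close>).

Since \<open>J\<close> is parallel, the \<open>\<partial>\<close>-bar derivative of \<open>J grad u\<close> is \<open>J\<close> composed with the tracefree
part of the Hessian of \<open>u\<close>, which is \<open>Hess u - u g\<close> as the trace is \<open>2 u\<close>
(\<open>tangent_onorm_dbar\<close>). Seen from \<open>p\<close>, that is, in the angle \<open>\<alpha>\<close> of the visual circle at \<open>p\<close>, its two
components are the second Fourier coefficients of \<open>\<phi>\<close>, suitably rescaled to a function \<open>\<Phi>\<close> of
\<open>\<alpha>\<close> (\<open>tangent_onorm_poisson\<close>). Let \<open>B(p)\<close> be its norm. Everything follows from this formula.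

\<^item> \<open>B \<le> 6 \<omega>\<close>: second Fourier coefficients do not see linear forms, so a near-optimal affine
  minorant may be subtracted from \<open>\<phi>\<close>; the integral of the nonnegative difference is at most
  the integral of the affine majorant minus the minorant, that is \<open>2\<pi>\<close> times the width
  (\<open>tracefree_le_width\<close>).

\<^item> If \<open>B\<close> vanishes at infinity, so does \<open>\<omega>\<close>: on a chord of the Klein disk the second derivative of
  \<open>\<eta> \<mapsto> \<surd>(1-|\<eta>|\<^sup>2) u\<close> is controlled by \<open>B\<close>. If \<open>B \<le> e\<close> off a compact set, then subtracting
  \<open>e \<surd>(1-|\<eta>|\<^sup>2) + M (1-|\<eta>|\<^sup>2)\<close> with \<open>M\<close> large makes this function convex without changing its
  boundary values, so it lies below the convex envelope \<open>\<phi>\<^sup>-\<close>; likewise for \<open>-\<phi>\<close>. Hence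
  \<open>\<omega> \<le> 2 e + 2 M \<surd>(1-|\<eta>|\<^sup>2)\<close> (\<open>poisson_minus_le_cvx_env\<close>).

\<^item> Little Zygmund implies that \<open>B\<close> vanishes at infinity: for the four points at angles
  \<open>\<alpha> + k \<pi>/2\<close> seen from \<open>p\<close>, the value \<open>X[Q]\<close> is the alternating sum of \<open>\<Phi>\<close>, and the second Fourier
  coefficients of \<open>\<Phi>\<close> are averages of it (\<open>tracefree_le_field_at\<close>). These quadruples are
  harmonic, and degenerate as \<open>p\<close> tends to the boundary (\<open>min_scale_visq\<close>).

\<^item> \<open>|X[Q]| \<le> 2 \<omega>(\<eta>)\<close> for every harmonic quadruple, where \<open>\<eta>\<close> is the intersection of its diagonals:
  \<open>X[Q]\<close> is a multiple of the difference between two averages of \<open>\<phi>\<close>, over the endpoints of the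
  one and of the other diagonal, both with barycentre \<open>\<eta>\<close>. Ptolemy's theorem turns the
  cross ratio condition into the factor \<open>2\<close> and into \<open>1 - |\<eta>|\<^sup>2 \<le> S(Q)\<close>
  (\<open>harmonic_quadruple_estimate\<close>). So if \<open>\<omega>\<close> vanishes at the circle, it is bounded, \<open>X\<close> is Zygmund, and
  \<open>X[Q]\<close> tends to zero along degenerating sequences.\<close>

section \<open>Integrals over the circle\<close>

definition circle_int :: "(complex \<Rightarrow> real) \<Rightarrow> real" where
  "circle_int h = integral {0..2*pi} (\<lambda>s. h (cis s))"

lemma continuous_on_compose_cis:
  "continuous_on (sphere 0 1) h \<Longrightarrow> continuous_on S (\<lambda>s. h (cis (g s)))"
  if "continuous_on S g"
  by (rule continuous_on_compose2[of "sphere 0 1" h]) (auto intro!: continuous_intros that)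

lemma circle_integrable:
  "continuous_on (sphere 0 1) h \<Longrightarrow> (\<lambda>s. h (cis s)) integrable_on {a..b}"
  for h :: "complex \<Rightarrow> real"
  by (intro integrable_continuous_interval continuous_on_compose_cis continuous_intros)

lemma circle_int_add:
  "continuous_on (sphere 0 1) h \<Longrightarrow> continuous_on (sphere 0 1) k \<Longrightarrow>
   circle_int (\<lambda>z. h z + k z) = circle_int h + circle_int k"
  unfolding circle_int_def by (intro integral_add circle_integrable)

lemma circle_int_cmult: "circle_int (\<lambda>z. c * h z) = c * circle_int h"
  unfolding circle_int_def by (rule integral_mult_right)

lemma circle_int_mono:
  "continuous_on (sphere 0 1) h \<Longrightarrow> continuous_on (sphere 0 1) k \<Longrightarrow>
   (\<And>z. cmod z = 1 \<Longrightarrow> h z \<le> k z) \<Longrightarrow> circle_int h \<le> circle_int k"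
  unfolding circle_int_def by (intro integral_le circle_integrable) auto

lemma circle_int_cong: "(\<And>z. cmod z = 1 \<Longrightarrow> h z = k z) \<Longrightarrow> circle_int h = circle_int k"
  unfolding circle_int_def by (intro integral_cong) auto

lemma circle_int_shift:
  assumes h: "continuous_on (sphere 0 1) h"
  shows "integral {b..b + 2*pi} (\<lambda>s. h (cis s)) = circle_int h"
proof -
  have per: "integral {a + 2*pi..b + 2*pi} (\<lambda>s. h (cis s)) = integral {a..b} (\<lambda>s. h (cis s))" for a b
  proof -
    have "integral {a..b} ((\<lambda>s. h (cis s)) \<circ> (\<lambda>x. x + 2*pi)) = integral {a + 2*pi..b + 2*pi} (\<lambda>s. h (cis s))"
      by (rule integral_shift) (intro continuous_on_compose_cis continuous_intros h)
    moreover have "(\<lambda>s. h (cis s)) \<circ> (\<lambda>x. x + 2*pi) = (\<lambda>s. h (cis s))"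
      by (auto simp: fun_eq_iff cis.ctr)
    ultimately show ?thesis by simp
  qed
  define G where "G = (\<lambda>b. integral {b..b + 2*pi} (\<lambda>s. h (cis s)))"
  have step: "G b = G c" if "b \<le> c" "c \<le> b + 2*pi" for b c
  proof -
    have "integral {b..c} (\<lambda>s. h (cis s)) + integral {c..b+2*pi} (\<lambda>s. h (cis s)) = G b"
      unfolding G_def using that by (intro Henstock_Kurzweil_Integration.integral_combine circle_integrable h)
    moreover have "integral {c..b+2*pi} (\<lambda>s. h (cis s)) + integral {b+2*pi..c+2*pi} (\<lambda>s. h (cis s)) = G c"
      unfolding G_def using that by (intro Henstock_Kurzweil_Integration.integral_combine circle_integrable h) auto
    ultimately show ?thesis using per[of b c] by simp
  qed
  have shift: "G (b + 2*pi) = G b" for b by (simp add: step[of b "b + 2*pi"])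
  have nat: "G (b + real n * (2*pi)) = G b" for b n
  proof (induction n)
    case (Suc n)
    have "b + real (Suc n) * (2*pi) = (b + real n * (2*pi)) + 2*pi" by (simp add: algebra_simps)
    then show ?case using shift[of "b + real n * (2*pi)"] Suc by metis
  qed simp
  \<comment> \<open>Whole periods split off; the remaining shift \<open>r\<close> stays within one period.\<close>
  define k where "k = \<lfloor>b / (2*pi)\<rfloor>"
  define r where "r = b - of_int k * (2*pi)"
  have r: "0 \<le> r" "r \<le> 0 + 2*pi"
  proof -
    have "of_int k \<le> b / (2*pi)" "b / (2*pi) < of_int k + 1"
      by (auto simp: k_def)
    then show "0 \<le> r" "r \<le> 0 + 2*pi" by (auto simp: r_def field_simps)
  qed
  have "G b = G r"
  proof (cases "k \<ge> 0")
    case True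
    then have "b = r + real (nat k) * (2*pi)" by (simp add: r_def)
    then show ?thesis using nat by metis
  next
    case False
    then have "r = b + real (nat (-k)) * (2*pi)" by (simp add: r_def)
    then show ?thesis using nat by metis
  qed
  also have "G r = G 0" using step[of 0 r] r by simp
  finally show ?thesis by (simp add: G_def circle_int_def)
qed

section \<open>Horofunctions and their moments\<close>

text \<open>\<open>horo x z\<close> is \<open>- mink x (1,z)\<close>. For \<open>x\<close> in \<open>H2\<close> this is the exponential of the Busemann function
  of the ideal point \<open>z\<close>, and for fixed \<open>x\<close> it is an affine function of \<open>z\<close>; all affine functions
  have this form (\<open>affine_fun_iff\<close>).\<close>

definition horo :: "real^3 \<Rightarrow> complex \<Rightarrow> real" where
  "horo x z = x$1 - x$2 * Re z - x$3 * Im z"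

lemma horo_add: "horo (x + y) z = horo x z + horo y z"
  by (simp add: horo_def algebra_simps)

lemma horo_scaleR: "horo (c *\<^sub>R x) z = c * horo x z"
  by (simp add: horo_def algebra_simps)

lemma horo_inner: "horo x z = x \<bullet> vector [1, - Re z, - Im z]"
  by (simp add: horo_def inner_vec_def sum_3)

lemma continuous_on_horo [continuous_intros]:
  "continuous_on S f \<Longrightarrow> continuous_on S g \<Longrightarrow> continuous_on S (\<lambda>x. horo (f x) (g x))"
  unfolding horo_def by (intro continuous_intros)

lemma horo_pos:
  assumes "x \<in> future_cone" "cmod z = 1"
  shows "horo x z > 0"
proof -
  have m: "(x$2)\<^sup>2 + (x$3)\<^sup>2 < (x$1)\<^sup>2" "x$1 > 0"
    using assms(1) by (auto simp: future_cone_def mink_def power2_eq_square)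
  have z: "(Re z)\<^sup>2 + (Im z)\<^sup>2 = 1" using assms(2) by (simp add: cmod_def)
  have "(x$2 * Re z + x$3 * Im z)\<^sup>2 \<le> ((x$2)\<^sup>2 + (x$3)\<^sup>2) * ((Re z)\<^sup>2 + (Im z)\<^sup>2)"
    using zero_le_power2[of "x$2 * Im z - x$3 * Re z"] by (simp add: power2_eq_square algebra_simps)
  then have "(x$2 * Re z + x$3 * Im z)\<^sup>2 < (x$1)\<^sup>2" using m z by simp
  then have "x$2 * Re z + x$3 * Im z < x$1" using m(2) by (meson less_imp_le power2_less_imp_less)
  then show ?thesis by (simp add: horo_def)
qed

definition moment :: "(complex \<Rightarrow> real) \<Rightarrow> nat \<Rightarrow> real^3 \<Rightarrow> real" where
  "moment f n x = circle_int (\<lambda>z. f z / horo x z ^ n)"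

lemma continuous_on_moment_integrand:
  assumes "continuous_on (sphere 0 1) f" "x \<in> future_cone"
  shows "continuous_on (sphere 0 1) (\<lambda>z. f z / horo x z ^ n)"
  using horo_pos[OF assms(2)] by (intro continuous_intros assms ballI power_not_zero) (metis less_irrefl mem_sphere_0)

lemma moment_add:
  assumes "continuous_on (sphere 0 1) f" "continuous_on (sphere 0 1) g" "x \<in> future_cone"
  shows "moment (\<lambda>z. f z + g z) n x = moment f n x + moment g n x"
  using circle_int_add[OF continuous_on_moment_integrand[OF assms(1,3)] continuous_on_moment_integrand[OF assms(2,3)]]
  by (simp add: moment_def add_divide_distrib)

lemma moment_cmult: "moment (\<lambda>z. c * f z) n x = c * moment f n x"
  unfolding moment_def by (simp flip: circle_int_cmult)

lemma moment_scaleR: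
  "c \<noteq> 0 \<Longrightarrow> moment f n (c *\<^sub>R x) = moment f n x / c ^ n"
proof -
  have "moment f n (c *\<^sub>R x) = circle_int (\<lambda>z. (1 / c ^ n) * (f z / horo x z ^ n))"
    by (simp add: moment_def horo_scaleR power_mult_distrib)
  also have "\<dots> = moment f n x / c ^ n"
    unfolding moment_def circle_int_cmult by simp
  finally show ?thesis .
qed

lemma moment_horo:
  assumes "x \<in> future_cone"
  shows "moment (\<lambda>z. f z * horo x z) (Suc n) x = moment f n x"
  unfolding moment_def using horo_pos[OF assms]
  by (intro circle_int_cong) (force simp: field_simps)

text \<open>Moments are closed under directional derivatives, because \<open>horo\<close> is linear in its first
  argument. This is why the Poisson extension below is smooth.\<close>

lemma moment_has_derivative:
  assumes f: "continuous_on (sphere 0 1) f" and x: "x \<in> future_cone"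
  shows "(moment f n has_derivative (\<lambda>v. - real n * moment (\<lambda>z. f z * horo v z) (Suc n) x)) (at x)"
proof -
  obtain e where e: "e > 0" "ball x e \<subseteq> future_cone"
    using open_future_cone x open_contains_ball by blast
  define c :: "real \<Rightarrow> real^3" where "c s = vector [1, - cos s, - sin s]" for s
  have hc: "horo y (cis s) = y \<bullet> c s" for y s by (simp add: horo_inner c_def)
  have cc: "continuous_on S (\<lambda>p. c (g p))" if "continuous_on S g" for g :: "'a::t2_space \<Rightarrow> real" and S
  proof -
    have "c = (\<lambda>s. axis 1 1 + (- cos s) *\<^sub>R axis 2 1 + (- sin s) *\<^sub>R axis 3 1)"
      by (auto simp: c_def fun_eq_iff vec_eq_iff forall_3 axis_def)
    then show ?thesis using that by (auto intro!: continuous_intros)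
  qed
  have pos: "y \<bullet> c s > 0" if "y \<in> ball x e" for y s
    using horo_pos[of y "cis s"] e that by (auto simp: hc)
  define D where "D = (\<lambda>y s. (- real n * f (cis s) / (y \<bullet> c s) ^ Suc n) *\<^sub>R blinfun_inner_left (c s))"
  have F: "continuous_on S (\<lambda>p. f (cis (g p)))" if "continuous_on S g" for g :: "'a::t2_space \<Rightarrow> real" and S
    by (rule continuous_on_compose2[OF f]) (auto intro!: continuous_intros that)
  have contD: "continuous_on (ball x e \<times> {0..2*pi}) (\<lambda>(y, t). D y t)"
    unfolding D_def split_beta
    by (intro continuous_intros F cc bounded_linear.continuous_on[OF bounded_linear_blinfun_inner_left] ballI power_not_zero)
      (metis mem_Times_iff pos less_irrefl)
  have "((\<lambda>y. integral (cbox 0 (2*pi)) (\<lambda>s. f (cis s) / (y \<bullet> c s) ^ n)) has_derivative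
      integral (cbox 0 (2*pi)) (D x)) (at x within ball x e)"
  proof (rule leibniz_rule)
    fix y s assume y: "y \<in> ball x e"
    show "((\<lambda>y. f (cis s) / (y \<bullet> c s) ^ n) has_derivative D y s) (at y within ball x e)"
    proof -
      define q where "q = y \<bullet> c s"
      have "q > 0" using pos[OF y] by (simp add: q_def)
      then have "((\<lambda>q. f (cis s) / q ^ n) has_real_derivative - real n * f (cis s) / q ^ Suc n) (at q)"
        by (cases n)
          (auto intro!: derivative_eq_intros simp del: power_Suc intro!: DERIV_power_Suc, simp add: field_simps)
      then have "((\<lambda>y. f (cis s) / (y \<bullet> c s) ^ n) has_derivative
          (\<lambda>v. (v \<bullet> c s) * (- real n * f (cis s) / q ^ Suc n))) (at y within ball x e)"
        unfolding q_def by (rule DERIV_compose_FDERIV) (auto intro!: derivative_eq_intros)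
      then show ?thesis
        by (rule has_derivative_eq_rhs)
          (simp add: fun_eq_iff D_def q_def blinfun.scaleR_left blinfun.minus_left inner_commute)
    qed
    show "(\<lambda>s. f (cis s) / (y \<bullet> c s) ^ n) integrable_on cbox 0 (2*pi)"
      unfolding cbox_interval using pos[OF y] 
      by (intro integrable_continuous_interval continuous_intros F cc ballI power_not_zero) (metis less_irrefl)
  next
    show "continuous_on (ball x e \<times> cbox 0 (2 * pi)) (\<lambda>(y, t). D y t)"
      using contD by simp
  qed (use e in auto)
  then have "((\<lambda>y. integral {0..2*pi} (\<lambda>s. f (cis s) / (y \<bullet> c s) ^ n)) has_derivative
      integral {0..2*pi} (D x)) (at x)"
    using e by (simp add: at_within_open[of x "ball x e"])
  moreover have "(\<lambda>y. integral {0..2*pi} (\<lambda>s. f (cis s) / (y \<bullet> c s) ^ n)) = moment f n"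
    by (simp add: fun_eq_iff moment_def circle_int_def hc)
  moreover have "blinfun_apply (integral {0..2*pi} (D x)) v
      = - real n * moment (\<lambda>z. f z * horo v z) (Suc n) x" for v
  proof -
    have "continuous_on {0..2*pi} (\<lambda>s. case (x, s) of (y, t) \<Rightarrow> D y t)"
      by (rule continuous_on_compose2[OF contD]) (use e in \<open>auto intro!: continuous_intros\<close>)
    then have DI: "D x integrable_on {0..2*pi}"
      by (intro integrable_continuous_interval) simp
    have "blinfun_apply (integral {0..2*pi} (D x)) v = integral {0..2*pi} (\<lambda>s. blinfun_apply (D x s) v)"
      using integral_linear[OF DI, of "\<lambda>A. blinfun_apply A v"] by (simp add: o_def blinfun.bounded_linear_left)
    also have "\<dots> = circle_int (\<lambda>z. - real n * (f z * horo v z / horo x z ^ Suc n))"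
      unfolding circle_int_def by (intro integral_cong) (simp add: D_def hc blinfun.scaleR_left blinfun.minus_left inner_commute)
    finally show ?thesis by (simp only: circle_int_cmult moment_def)
  qed
  ultimately show ?thesis by (simp add: has_derivative_eq_rhs fun_eq_iff)
qed

lemma moment2_has_derivative:
  assumes "continuous_on (sphere 0 1) f" "x \<in> future_cone"
  shows "(moment f 2 has_derivative (\<lambda>v. - 2 * moment (\<lambda>z. f z * horo v z) 3 x)) (at x)"
  using moment_has_derivative[OF assms, of 2] by (simp add: numeral_3_eq_3 numeral_2_eq_2)

lemma moment3_has_derivative:
  assumes "continuous_on (sphere 0 1) f" "x \<in> future_cone"
  shows "(moment (\<lambda>z. f z * horo w z) 3 has_derivative
    (\<lambda>v. - 3 * moment (\<lambda>z. f z * horo w z * horo v z) 4 x)) (at x)"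
proof -
  have "continuous_on (sphere 0 1) (\<lambda>z. f z * horo w z)" by (intro continuous_intros assms)
  from moment_has_derivative[OF this assms(2), of 3] show ?thesis by (simp add: eval_nat_numeral)
qed

lemma mink_self_has_derivative: "((\<lambda>x. mink x x) has_derivative (\<lambda>v. 2 * mink x v)) (at x)"
  using mink.FDERIV[OF has_derivative_ident has_derivative_ident, of x UNIV]
  by (simp add: mink_commute[of _ x])

section \<open>The Minkowski cross product\<close>

lemma mcross_components:
  "x \<boxtimes> y = vector [x$3 * y$2 - x$2 * y$3, x$3 * y$1 - x$1 * y$3, x$1 * y$2 - x$2 * y$1]"
  by (subst mink_nondegenerate[symmetric]) (simp add: mink_mcross, simp add: mink_def det_3 algebra_simps)

lemma bounded_bilinear_mcross: "bounded_bilinear (\<boxtimes>)"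
  unfolding bilinear_conv_bounded_bilinear[symmetric] bilinear_def
  by (auto intro!: linearI simp: mcross_components vec_eq_iff forall_3 algebra_simps)

interpretation mcross: bounded_bilinear "(\<boxtimes>)"
  by (rule bounded_bilinear_mcross)

lemma mcross_self: "x \<boxtimes> x = 0"
  by (simp add: mcross_components vec_eq_iff forall_3)

lemma mcross_commute: "x \<boxtimes> y = - (y \<boxtimes> x)"
  by (simp add: mcross_components vec_eq_iff forall_3)

section \<open>The circle seen from a point of the hyperbolic plane\<close>

lemma sin_mult_sin:
  "sin b * sin b = 1 - cos b * cos b" "sin b * (sin b * x) = x - cos b * (cos b * x)" for b x :: real
proof -
  show sc: "sin b * sin b = 1 - cos b * cos b"
    using sin_cos_squared_add[of b] by (simp add: power2_eq_square)
  show "sin b * (sin b * x) = x - cos b * (cos b * x)"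
    by (simp add: left_diff_distrib sc flip: mult.assoc)
qed

text \<open>In polar coordinates \<open>hpt t b\<close> is the point of \<open>H2\<close> at distance \<open>r\<close> from \<open>(1,0,0)\<close> in direction \<open>b\<close>, where
  \<open>t = tanh (r/2)\<close>; this parameter makes all formulas rational.\<close>

definition hpt :: "real \<Rightarrow> real \<Rightarrow> real^3" where
  "hpt t b = vector [(1 + t\<^sup>2) / (1 - t\<^sup>2), 2 * t / (1 - t\<^sup>2) * cos b, 2 * t / (1 - t\<^sup>2) * sin b]"

definition radial :: "real \<Rightarrow> real \<Rightarrow> real^3" where
  "radial t b = vector [2 * t / (1 - t\<^sup>2), (1 + t\<^sup>2) / (1 - t\<^sup>2) * cos b, (1 + t\<^sup>2) / (1 - t\<^sup>2) * sin b]"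

definition angular :: "real \<Rightarrow> real^3" where
  "angular b = vector [0, - sin b, cos b]"

text \<open>\<open>vis t b \<alpha>\<close> is a continuous lift of the argument of the ideal endpoint of the geodesic that
  leaves \<open>hpt t b\<close> at angle \<open>\<alpha>\<close> to the radial direction (\<open>cis_vis\<close>, a Moebius map), and
  \<open>lam\<close> is the reciprocal of its derivative, the Poisson kernel at that endpoint.\<close>

definition vis :: "real \<Rightarrow> real \<Rightarrow> real \<Rightarrow> real" where
  "vis t b \<alpha> = b + \<alpha> - 2 * arctan (t * sin \<alpha> / (1 + t * cos \<alpha>))"

definition lam :: "real \<Rightarrow> real \<Rightarrow> real" where
  "lam t \<alpha> = (1 + 2 * t * cos \<alpha> + t\<^sup>2) / (1 - t\<^sup>2)"

lemma vis_add_2pi: "vis t b (\<alpha> + 2 * pi) = vis t b \<alpha> + 2 * pi"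
  by (simp add: vis_def)

lemma hpt_exists:
  assumes "p \<in> H2"
  obtains t b where "0 \<le> t" "t < 1" "p = hpt t b"
proof -
  define s where "s = cmod (Complex (p$2) (p$3))"
  obtain b where b: "Complex (p$2) (p$3) = rcis s b"
    unfolding s_def by (metis rcis_cmod_Arg)
  then have p23: "p$2 = s * cos b" "p$3 = s * sin b"
    by (simp_all add: complex_eq_iff)
  have s0: "s \<ge> 0" by (simp add: s_def)
  have m: "p$1 > 0" "(p$1)\<^sup>2 = 1 + s\<^sup>2"
    using assms by (auto simp: H2_def mink_def s_def cmod_def power2_eq_square)
  define t where "t = s / (1 + p$1)"
  have t0: "0 \<le> t" using s0 m by (simp add: t_def)
  have "s < 1 + p$1" using m s0 by (smt (verit) power2_le_imp_le power_mono)
  then have t1: "t < 1" using m by (simp add: t_def)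
  have st: "s = t * (1 + p$1)" using m by (simp add: t_def)
  have *: "(1 - t\<^sup>2) * (1 + p$1) = 2"
  proof -
    have "(p$1)\<^sup>2 - 1 = t\<^sup>2 * (1 + p$1)\<^sup>2" using m(2) st by (simp add: power_mult_distrib)
    then have "(1 + p$1) * ((1 - t\<^sup>2) * (1 + p$1) - 2) = 0" by (simp add: power2_eq_square algebra_simps)
    then show ?thesis using m(1) by simp
  qed
  have t2: "1 - t\<^sup>2 > 0" using t0 t1 by (simp add: abs_square_less_1)
  have "1 + p$1 = 2 / (1 - t\<^sup>2)" using * t2 by (simp add: field_simps)
  then have "p$1 = (1 + t\<^sup>2) / (1 - t\<^sup>2)" and "s = 2 * t / (1 - t\<^sup>2)"
    using t2 unfolding st by (simp add: field_simps, simp)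
  then have "p = hpt t b"
    using p23 by (simp add: hpt_def vec_eq_iff forall_3)
  then show ?thesis using that t0 t1 by blast
qed

context
  fixes t :: real
  assumes t: "0 \<le> t" "t < 1"
begin

lemma one_minus_t_pos: "1 - t\<^sup>2 > 0"
  using t by (simp add: abs_square_less_1)

lemma lam_numerator_pos: "1 + 2 * t * cos \<alpha> + t\<^sup>2 > 0"
proof -
  have "1 + 2 * t * cos \<alpha> + t\<^sup>2 \<ge> 1 - 2 * t + t\<^sup>2"
    using t mult_left_mono[of "-1" "cos \<alpha>" t] by simp
  moreover have "1 - 2 * t + t\<^sup>2 = (1 - t)\<^sup>2" by (simp add: power2_eq_square algebra_simps)
  moreover have "(1 - t)\<^sup>2 > 0" using t by simp
  ultimately show ?thesis by linarith
qed

lemma one_plus_t_cos_pos: "1 + t * cos \<alpha> > 0"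
  using t mult_left_mono[of "-1" "cos \<alpha>" t] by simp

lemma lam_pos: "lam t \<alpha> > 0"
  using lam_numerator_pos one_minus_t_pos by (simp add: lam_def)

text \<open>As \<open>y = t sin \<alpha> / (1 + t cos \<alpha>)\<close> is the tangent of the argument of \<open>1 + t cis \<alpha>\<close>, the number
  \<open>cis (- 2 arctan y)\<close> is the quotient of the conjugate of \<open>1 + t cis \<alpha>\<close> by \<open>1 + t cis \<alpha>\<close> itself.\<close>

lemma cis_vis: "cis (vis t b \<alpha>) = cis b * ((cis \<alpha> + of_real t) / (1 + of_real t * cis \<alpha>))"
proof -
  define y where "y = t * sin \<alpha> / (1 + t * cos \<alpha>)"
  have c: "1 + t * cos \<alpha> \<noteq> 0" using one_plus_t_cos_pos[of \<alpha>] by simp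
  have q: "1 + y\<^sup>2 > 0" by (simp add: add_pos_nonneg)
  have ch: "cis (arctan y) = (1 + \<i> * of_real y) / of_real (sqrt (1 + y\<^sup>2))"
    by (simp add: complex_eq_iff cos_arctan sin_arctan)
  have "cis (- (2 * arctan y)) = inverse (cis (arctan y) * cis (arctan y))"
    by (simp add: cis_mult flip: cis_inverse)
  also have "\<dots> = of_real (1 + y\<^sup>2) / (1 + \<i> * of_real y)\<^sup>2"
    using q unfolding ch by (simp add: power2_eq_square flip: of_real_mult)
  also have "of_real (1 + y\<^sup>2) = (1 + \<i> * of_real y) * (1 - \<i> * of_real y)"
    by (simp add: power2_eq_square algebra_simps)
  also have "\<dots> / (1 + \<i> * of_real y)\<^sup>2 = (1 - \<i> * of_real y) / (1 + \<i> * of_real y)"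
    by (simp add: power2_eq_square complex_eq_iff)
  also have "\<dots> = (1 + of_real t * cnj (cis \<alpha>)) / (1 + of_real t * cis \<alpha>)"
  proof -
    have "1 + of_real t * cis \<alpha> = of_real (1 + t * cos \<alpha>) * (1 + \<i> * of_real y)"
      "1 + of_real t * cnj (cis \<alpha>) = of_real (1 + t * cos \<alpha>) * (1 - \<i> * of_real y)"
      using c by (simp_all add: y_def complex_eq_iff)
    then show ?thesis using c by (simp del: of_real_add)
  qed
  finally have "cis \<alpha> * cis (- (2 * arctan y)) = (cis \<alpha> + of_real t * (cis \<alpha> * cnj (cis \<alpha>))) / (1 + of_real t * cis \<alpha>)"
    by (simp add: algebra_simps)
  also have "cis \<alpha> * cnj (cis \<alpha>) = 1" by (simp add: cis_cnj cis_mult)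
  finally have "cis \<alpha> * cis (- (2 * arctan y)) = (cis \<alpha> + of_real t) / (1 + of_real t * cis \<alpha>)" by simp
  moreover have "cis (vis t b \<alpha>) = cis b * (cis \<alpha> * cis (- (2 * arctan y)))"
    by (simp add: vis_def y_def cis_mult algebra_simps)
  ultimately show ?thesis by simp
qed

lemma cis_vis_Re_Im:
  "Re (cis (vis t b \<alpha>)) = (cos b * (cos \<alpha> * (1 + t\<^sup>2) + 2 * t) - sin b * (sin \<alpha> * (1 - t\<^sup>2))) / (1 + 2 * t * cos \<alpha> + t\<^sup>2)"
  "Im (cis (vis t b \<alpha>)) = (sin b * (cos \<alpha> * (1 + t\<^sup>2) + 2 * t) + cos b * (sin \<alpha> * (1 - t\<^sup>2))) / (1 + 2 * t * cos \<alpha> + t\<^sup>2)"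
proof -
  note sc = sin_mult_sin(1)[of \<alpha>]
  have "(cis \<alpha> + of_real t) / (1 + of_real t * cis \<alpha>)
      = Complex (cos \<alpha> * (1 + t\<^sup>2) + 2 * t) (sin \<alpha> * (1 - t\<^sup>2)) / of_real (1 + 2 * t * cos \<alpha> + t\<^sup>2)"
  proof -
    have n: "1 + of_real t * cis \<alpha> \<noteq> 0"
      using one_plus_t_cos_pos[of \<alpha>] by (auto simp: complex_eq_iff)
    have d: "complex_of_real (1 + 2 * t * cos \<alpha> + t\<^sup>2) \<noteq> 0"
      using lam_numerator_pos[of \<alpha>] by (simp only: of_real_eq_0_iff)
    have r: "(cos \<alpha> + t) * (1 + 2 * t * cos \<alpha> + t\<^sup>2)
        = (cos \<alpha> * (1 + t\<^sup>2) + 2 * t) * (1 + t * cos \<alpha>) - (1 - t\<^sup>2) * t * (sin \<alpha> * sin \<alpha>)"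
      unfolding sc by (simp add: power2_eq_square algebra_simps)
    show ?thesis unfolding frac_eq_eq[OF n d]
      using r by (simp add: complex_eq_iff power2_eq_square algebra_simps)
  qed
  then have "cis (vis t b \<alpha>) = cis b * Complex (cos \<alpha> * (1 + t\<^sup>2) + 2 * t) (sin \<alpha> * (1 - t\<^sup>2)) / of_real (1 + 2 * t * cos \<alpha> + t\<^sup>2)"
    by (simp add: cis_vis)
  then show "Re (cis (vis t b \<alpha>)) = (cos b * (cos \<alpha> * (1 + t\<^sup>2) + 2 * t) - sin b * (sin \<alpha> * (1 - t\<^sup>2))) / (1 + 2 * t * cos \<alpha> + t\<^sup>2)"
    "Im (cis (vis t b \<alpha>)) = (sin b * (cos \<alpha> * (1 + t\<^sup>2) + 2 * t) + cos b * (sin \<alpha> * (1 - t\<^sup>2))) / (1 + 2 * t * cos \<alpha> + t\<^sup>2)"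
    by (simp_all only: Re_divide_of_real Im_divide_of_real times_complex.sel cis.sel complex.sel) (simp_all add: algebra_simps)
qed

text \<open>Together these identities say that the lightlike vector
  \<open>hpt t b + cos \<alpha> radial t b + sin \<alpha> angular b\<close> is \<open>lam t \<alpha>\<close> times \<open>(1, cis (vis t b \<alpha>))\<close>.\<close>

lemma horo_vis:
  shows "horo (hpt t b) (cis (vis t b \<alpha>)) = 1 / lam t \<alpha>"
    and "horo (radial t b) (cis (vis t b \<alpha>)) = - cos \<alpha> / lam t \<alpha>"
    and "horo (angular b) (cis (vis t b \<alpha>)) = - sin \<alpha> / lam t \<alpha>"
proof -
  define d A B where "d = 1 + 2 * t * cos \<alpha> + t\<^sup>2" and "A = cos \<alpha> * (1 + t\<^sup>2) + 2 * t" and "B = sin \<alpha> * (1 - t\<^sup>2)"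
  have d: "d > 0" and t2: "1 - t\<^sup>2 > 0" using lam_numerator_pos one_minus_t_pos by (simp_all add: d_def)
  have z: "Re (cis (vis t b \<alpha>)) = (cos b * A - sin b * B) / d" "Im (cis (vis t b \<alpha>)) = (sin b * A + cos b * B) / d"
    unfolding cis_vis_Re_Im A_def B_def d_def by simp_all
  have cs: "cos b * cos b + sin b * sin b = 1" by (simp add: sin_mult_sin)
  have cs': "x * (cos b * cos b) + x * (sin b * sin b) = x" for x
    by (simp add: cs flip: distrib_left)
  have "cos b * (cos b * A - sin b * B) + sin b * (sin b * A + cos b * B) = A"
    "- sin b * (cos b * A - sin b * B) + cos b * (sin b * A + cos b * B) = B"
    by (simp_all add: algebra_simps cs')
  then have 1: "cos b * ((cos b * A - sin b * B) / d) + sin b * ((sin b * A + cos b * B) / d) = A / d"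
    and 2: "- sin b * ((cos b * A - sin b * B) / d) + cos b * ((sin b * A + cos b * B) / d) = B / d"
    by (simp_all only: times_divide_eq_right flip: add_divide_distrib)
  have lin: "u - v * cos b * x - v * sin b * y = u - v * (cos b * x + sin b * y)" for u v x y
    by (simp add: algebra_simps)
  have l: "lam t \<alpha> = d / (1 - t\<^sup>2)" by (simp add: lam_def d_def)
  have "horo (hpt t b) (cis (vis t b \<alpha>)) = (1 + t\<^sup>2) / (1 - t\<^sup>2) - 2 * t / (1 - t\<^sup>2) * (A / d)"
    unfolding 1[symmetric] unfolding horo_def hpt_def z vector_3 lin by (rule refl)
  also have "\<dots> = ((1 + t\<^sup>2) * d - 2 * t * A) / ((1 - t\<^sup>2) * d)"
    using d t2 by (simp add: diff_divide_distrib)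
  also have "(1 + t\<^sup>2) * d - 2 * t * A = (1 - t\<^sup>2) * (1 - t\<^sup>2)"
    by (simp add: d_def A_def power2_eq_square algebra_simps)
  also have "(1 - t\<^sup>2) * (1 - t\<^sup>2) / ((1 - t\<^sup>2) * d) = 1 / lam t \<alpha>" using d t2 by (simp add: l)
  finally show "horo (hpt t b) (cis (vis t b \<alpha>)) = 1 / lam t \<alpha>" .
  have "horo (radial t b) (cis (vis t b \<alpha>)) = 2 * t / (1 - t\<^sup>2) - (1 + t\<^sup>2) / (1 - t\<^sup>2) * (A / d)"
    unfolding 1[symmetric] unfolding horo_def radial_def z vector_3 lin by (rule refl)
  also have "\<dots> = (2 * t * d - (1 + t\<^sup>2) * A) / ((1 - t\<^sup>2) * d)"
    using d t2 by (simp add: diff_divide_distrib)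
  also have "2 * t * d - (1 + t\<^sup>2) * A = (1 - t\<^sup>2) * ((1 - t\<^sup>2) * - cos \<alpha>)"
    by (simp add: d_def A_def power2_eq_square algebra_simps)
  also have "\<dots> / ((1 - t\<^sup>2) * d) = - cos \<alpha> / lam t \<alpha>" using d t2 by (simp add: l)
  finally show "horo (radial t b) (cis (vis t b \<alpha>)) = - cos \<alpha> / lam t \<alpha>" .
  have "horo (angular b) (cis (vis t b \<alpha>)) = - (B / d)"
    unfolding 2[symmetric] unfolding horo_def angular_def z vector_3 by simp
  also have "\<dots> = - sin \<alpha> / lam t \<alpha>" using d t2 by (simp add: l B_def)
  finally show "horo (angular b) (cis (vis t b \<alpha>)) = - sin \<alpha> / lam t \<alpha>" .
qed

lemma vis_has_derivative: "(vis t b has_real_derivative 1 / lam t \<alpha>) (at \<alpha> within S)"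
proof -
  have c: "1 + t * cos \<alpha> > 0" by (rule one_plus_t_cos_pos)
  have d: "1 + 2 * t * cos \<alpha> + t\<^sup>2 > 0" by (rule lam_numerator_pos)
  note sc = sin_mult_sin(1)[of \<alpha>]
  define y where "y = t * sin \<alpha> / (1 + t * cos \<alpha>)"
  have 1: "1 + y\<^sup>2 = (1 + 2 * t * cos \<alpha> + t\<^sup>2) / (1 + t * cos \<alpha>)\<^sup>2"
  proof -
    have "y * (1 + t * cos \<alpha>) = t * sin \<alpha>" using c by (simp add: y_def)
    then have "y\<^sup>2 * (1 + t * cos \<alpha>)\<^sup>2 = t\<^sup>2 * (sin \<alpha> * sin \<alpha>)"
      by (metis power2_eq_square power_mult_distrib)
    then have "(1 + y\<^sup>2) * (1 + t * cos \<alpha>)\<^sup>2 = (1 + t * cos \<alpha>)\<^sup>2 + t\<^sup>2 * (sin \<alpha> * sin \<alpha>)"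
      by (simp add: distrib_right)
    also have "\<dots> = 1 + 2 * t * cos \<alpha> + t\<^sup>2"
      unfolding sc by (simp add: power2_eq_square algebra_simps)
    finally show ?thesis using c by (simp add: field_simps)
  qed
  have 2: "(t * cos \<alpha> * (1 + t * cos \<alpha>) + t * sin \<alpha> * (t * sin \<alpha>)) / ((1 + t * cos \<alpha>) * (1 + t * cos \<alpha>))
      = (t * cos \<alpha> + t\<^sup>2) / (1 + t * cos \<alpha>)\<^sup>2"
    by (simp add: power2_eq_square algebra_simps sin_mult_sin)
  have D: "((\<lambda>\<alpha>. t * sin \<alpha> / (1 + t * cos \<alpha>)) has_real_derivative (t * cos \<alpha> + t\<^sup>2) / (1 + t * cos \<alpha>)\<^sup>2) (at \<alpha> within S)"
    unfolding 2[symmetric] using c by (auto intro!: derivative_eq_intros)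
  have "((\<lambda>\<alpha>. arctan (t * sin \<alpha> / (1 + t * cos \<alpha>))) has_real_derivative
      inverse (1 + y\<^sup>2) * ((t * cos \<alpha> + t\<^sup>2) / (1 + t * cos \<alpha>)\<^sup>2)) (at \<alpha> within S)"
    unfolding y_def by (rule DERIV_chain'[OF D DERIV_arctan])
  also have "inverse (1 + y\<^sup>2) * ((t * cos \<alpha> + t\<^sup>2) / (1 + t * cos \<alpha>)\<^sup>2) = (t * cos \<alpha> + t\<^sup>2) / (1 + 2 * t * cos \<alpha> + t\<^sup>2)"
    unfolding 1 using c by simp
  finally have A: "((\<lambda>\<alpha>. arctan (t * sin \<alpha> / (1 + t * cos \<alpha>))) has_real_derivative
      (t * cos \<alpha> + t\<^sup>2) / (1 + 2 * t * cos \<alpha> + t\<^sup>2)) (at \<alpha> within S)" .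
  have e: "1 - 2 * ((t * cos \<alpha> + t\<^sup>2) / (1 + 2 * t * cos \<alpha> + t\<^sup>2)) = 1 / lam t \<alpha>"
    using d by (simp add: lam_def field_simps)
  show ?thesis unfolding vis_def e[symmetric]
    by (rule derivative_eq_intros A refl | simp)+
qed

lemma continuous_on_lam [continuous_intros]:
  "continuous_on S g \<Longrightarrow> continuous_on S (\<lambda>x. lam t (g x))" for g :: "real \<Rightarrow> real"
  unfolding lam_def using one_minus_t_pos by (intro continuous_intros) auto

lemma continuous_on_vis [continuous_intros]:
  "continuous_on S g \<Longrightarrow> continuous_on S (\<lambda>x. vis t b (g x))" for g :: "real \<Rightarrow> real"
  by (rule continuous_on_compose2[OF _ _ subset_UNIV])
    (auto intro!: continuous_at_imp_continuous_on DERIV_isCont vis_has_derivative)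

lemma vis_strict_mono: "\<alpha> < \<beta> \<Longrightarrow> vis t b \<alpha> < vis t b \<beta>"
  by (rule DERIV_pos_imp_increasing) (use vis_has_derivative lam_pos in \<open>auto intro!: exI\<close>)

text \<open>Change of variables to the visual angle. It replaces the use of isometries: integrals over the
  circle may be computed as if \<open>hpt t b\<close> were the centre of the disk.\<close>

lemma circle_int_vis:
  assumes h: "continuous_on (sphere 0 1) h"
  shows "circle_int h = integral {0..2*pi} (\<lambda>\<alpha>. h (cis (vis t b \<alpha>)) / lam t \<alpha>)"
proof -
  have "((\<lambda>\<alpha>. (1 / lam t \<alpha>) *\<^sub>R h (cis (vis t b \<alpha>))) has_integral
      (integral {vis t b 0..vis t b (2*pi)} (\<lambda>s. h (cis s)))) {0..2*pi}"
  proof (rule has_integral_substitution)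
    show "vis t b 0 \<le> vis t b (2*pi)" using vis_add_2pi[of t b 0] by simp
    have "vis t b ` {0..2*pi} \<subseteq> {vis t b 0..vis t b (2*pi)}"
      using vis_strict_mono by (force simp: le_less)
    then show "vis t b ` {0..2*pi} \<subseteq> {vis t b 0..vis t b (2*pi)}" .
  qed (auto intro!: vis_has_derivative continuous_on_compose_cis continuous_intros h)
  moreover have "vis t b (2*pi) = vis t b 0 + 2*pi" using vis_add_2pi[of t b 0] by simp
  ultimately show ?thesis
    using circle_int_shift[OF h, of "vis t b 0"] by (simp add: has_integral_iff)
qed

lemma moment_vis:
  assumes f: "continuous_on (sphere 0 1) f" and p: "hpt t b \<in> future_cone"
  shows "moment f (Suc n) (hpt t b) = integral {0..2*pi} (\<lambda>\<alpha>. f (cis (vis t b \<alpha>)) * lam t \<alpha> ^ n)"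
proof -
  have "moment f (Suc n) (hpt t b) = integral {0..2*pi} (\<lambda>\<alpha>. f (cis (vis t b \<alpha>)) / horo (hpt t b) (cis (vis t b \<alpha>)) ^ Suc n / lam t \<alpha>)"
    unfolding moment_def by (rule circle_int_vis) (rule continuous_on_moment_integrand[OF f p])
  also have "\<dots> = integral {0..2*pi} (\<lambda>\<alpha>. f (cis (vis t b \<alpha>)) * lam t \<alpha> ^ n)"
    using lam_pos by (intro integral_cong) (simp add: horo_vis less_imp_neq[symmetric] power_divide)
  finally show ?thesis .
qed

lemma frame_cosh_sinh:
  "(1 + t\<^sup>2) / (1 - t\<^sup>2) * ((1 + t\<^sup>2) / (1 - t\<^sup>2)) = 1 + 2 * t / (1 - t\<^sup>2) * (2 * t / (1 - t\<^sup>2))"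
proof -
  define D E F where "D = 1 - t\<^sup>2" and "E = 1 + t\<^sup>2" and "F = 2 * t"
  have "E * E = D * D + F * F" "D \<noteq> 0"
    using one_minus_t_pos by (simp_all add: D_def E_def F_def power2_eq_square algebra_simps)
  then have "E / D * (E / D) = 1 + F / D * (F / D)" by (simp add: field_simps)
  then show ?thesis by (simp only: D_def E_def F_def)
qed

lemma frame_coordinates:
  "\<exists>C S. hpt t b = vector [C, S * cos b, S * sin b] \<and> radial t b = vector [S, C * cos b, C * sin b]
    \<and> C * C = 1 + S * S"
proof -
  define C S where "C = (1 + t\<^sup>2) / (1 - t\<^sup>2)" and "S = 2 * t / (1 - t\<^sup>2)"
  have "hpt t b = vector [C, S * cos b, S * sin b]" "radial t b = vector [S, C * cos b, C * sin b]"
    by (simp_all add: hpt_def radial_def C_def S_def)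
  moreover have "C * C = 1 + S * S" using frame_cosh_sinh by (simp only: C_def S_def)
  ultimately show ?thesis by blast
qed

lemma frame_mink:
  "mink (hpt t b) (hpt t b) = -1" "mink (radial t b) (radial t b) = 1" "mink (angular b) (angular b) = 1"
  "mink (hpt t b) (radial t b) = 0" "mink (hpt t b) (angular b) = 0" "mink (radial t b) (angular b) = 0"
proof -
  obtain C S where v: "hpt t b = vector [C, S * cos b, S * sin b]" "radial t b = vector [S, C * cos b, C * sin b]"
    and CS: "C * C = 1 + S * S" using frame_coordinates by blast
  have CS': "C * (C * x) = x + S * (S * x)" for x by (simp add: distrib_right CS flip: mult.assoc)
  show "mink (hpt t b) (hpt t b) = -1" "mink (radial t b) (radial t b) = 1" "mink (angular b) (angular b) = 1"
    "mink (hpt t b) (radial t b) = 0" "mink (hpt t b) (angular b) = 0" "mink (radial t b) (angular b) = 0"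
    unfolding v by (simp_all add: mink_def angular_def CS CS' sin_mult_sin algebra_simps)
qed

lemma hpt_in_H2: "hpt t b \<in> H2"
  using frame_mink(1) one_minus_t_pos by (simp add: H2_def hpt_def add_pos_nonneg)

lemma frame_hJ:
  "hJ (hpt t b) (radial t b) = angular b" "hJ (hpt t b) (angular b) = - radial t b"
  and frame_mcross: "radial t b \<boxtimes> angular b = - hpt t b"
proof -
  obtain C S where v: "hpt t b = vector [C, S * cos b, S * sin b]" "radial t b = vector [S, C * cos b, C * sin b]"
    and CS: "C * C = 1 + S * S" using frame_coordinates by blast
  have CS': "C * (C * x) = x + S * (S * x)" for x by (simp add: distrib_right CS flip: mult.assoc)
  show "hJ (hpt t b) (radial t b) = angular b" "hJ (hpt t b) (angular b) = - radial t b"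
    "radial t b \<boxtimes> angular b = - hpt t b"
    unfolding v hJ_def mcross_components
    by (simp_all add: vec_eq_iff forall_3 angular_def CS CS' sin_mult_sin algebra_simps)
qed

lemma frame_expand:
  "v = (- mink v (hpt t b)) *\<^sub>R hpt t b + mink v (radial t b) *\<^sub>R radial t b + mink v (angular b) *\<^sub>R angular b"
proof -
  obtain C S where v: "hpt t b = vector [C, S * cos b, S * sin b]" "radial t b = vector [S, C * cos b, C * sin b]"
    and CS: "C * C = 1 + S * S" using frame_coordinates by blast
  have CS': "C * (C * x) = x + S * (S * x)" for x by (simp add: distrib_right CS flip: mult.assoc)
  show ?thesis
    unfolding v by (simp add: vec_eq_iff forall_3 mink_def angular_def CS CS' sin_mult_sin algebra_simps)
qed

end

section \<open>Functions of class Ck\<close>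

lemma Ck_on_cong:
  assumes "open S" "\<And>x. x \<in> S \<Longrightarrow> f x = g x" "Ck_on k f S"
  shows "Ck_on k g S"
  using assms(2,3)
proof (induction k arbitrary: f g)
  case 0
  then show ?case by (auto cong: continuous_on_cong)
next
  case (Suc k)
  have d: "(g has_derivative D) (at x)" if "x \<in> S" "(f has_derivative D) (at x)" for x D
    by (rule has_derivative_transform_within_open[OF that(2) assms(1) that(1) Suc.prems(1)])
  have "g differentiable at x" if "x \<in> S" for x
    using Suc.prems(2) that d by (auto simp: differentiable_def) blast
  moreover have "Ck_on k (\<lambda>x. frechet_derivative g (at x) v) S" for v
  proof (rule Suc.IH)
    show "Ck_on k (\<lambda>x. frechet_derivative f (at x) v) S" using Suc.prems(2) by simp
    fix x assume x: "x \<in> S"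
    then have "(f has_derivative frechet_derivative f (at x)) (at x)"
      using Suc.prems(2) by (simp add: frechet_derivative_works)
    then show "frechet_derivative f (at x) v = frechet_derivative g (at x) v"
      using frechet_derivative_at[OF d[OF x]] by simp
  qed
  ultimately show ?case by simp
qed

lemma Ck_on_SucI:
  assumes "open S" "\<And>x. x \<in> S \<Longrightarrow> (f has_derivative D x) (at x)" "\<And>v. Ck_on k (\<lambda>x. D x v) S"
  shows "Ck_on (Suc k) f S"
  unfolding Ck_on.simps
proof (intro conjI ballI allI)
  show "f differentiable at x" if "x \<in> S" for x
    using assms(2)[OF that] by (auto simp: differentiable_def)
  show "Ck_on k (\<lambda>x. frechet_derivative f (at x) v) S" for v
    by (rule Ck_on_cong[OF assms(1) _ assms(3)]) (simp add: frechet_derivative_at[OF assms(2)])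
qed

lemma Ck_on_SucD: "Ck_on (Suc k) f S \<Longrightarrow> Ck_on k f S"
proof (induction k arbitrary: f)
  case 0
  then show ?case
    by (auto intro!: continuous_at_imp_continuous_on differentiable_imp_continuous_within)
qed simp

lemma Ck_on_const: "open S \<Longrightarrow> Ck_on k (\<lambda>x. c) S"
proof (induction k arbitrary: c)
  case (Suc k)
  then show ?case by (intro Ck_on_SucI[where D = "\<lambda>_ _. 0"] has_derivative_const)
qed simp

lemma Ck_on_bounded_linear:
  assumes "open S" "bounded_linear f"
  shows "Ck_on k f S"
proof (cases k)
  case 0
  then show ?thesis using assms by (simp add: linear_continuous_on)
next
  case (Suc m)
  show ?thesis
    unfolding Suc using assms
    by (intro Ck_on_SucI[where D = "\<lambda>_. f"] bounded_linear_imp_has_derivative Ck_on_const)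
qed

lemma Ck_on_add: "open S \<Longrightarrow> Ck_on k f S \<Longrightarrow> Ck_on k g S \<Longrightarrow> Ck_on k (\<lambda>x. f x + g x) S"
proof (induction k arbitrary: f g)
  case (Suc k)
  then show ?case
    by (intro Ck_on_SucI[where D = "\<lambda>x v. frechet_derivative f (at x) v + frechet_derivative g (at x) v"])
      (auto intro!: has_derivative_add simp: frechet_derivative_works)
qed (auto intro: continuous_on_add)

lemma Ck_on_mult:
  fixes f g :: "'a::real_normed_vector \<Rightarrow> real"
  shows "open S \<Longrightarrow> Ck_on k f S \<Longrightarrow> Ck_on k g S \<Longrightarrow> Ck_on k (\<lambda>x. f x * g x) S"
proof (induction k arbitrary: f g)
  case (Suc k)
  have fg: "Ck_on k f S" "Ck_on k g S" using Suc.prems(2,3) by (blast intro: Ck_on_SucD)+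
  show ?case
  proof (rule Ck_on_SucI[where D = "\<lambda>x v. f x * frechet_derivative g (at x) v + frechet_derivative f (at x) v * g x"])
    fix v
    show "Ck_on k (\<lambda>x. f x * frechet_derivative g (at x) v + frechet_derivative f (at x) v * g x) S"
      using Suc.prems fg by (intro Ck_on_add Suc.IH) auto
  qed (use Suc.prems in \<open>auto intro!: has_derivative_mult simp: frechet_derivative_works\<close>)
qed (auto intro: continuous_on_mult)

lemma Ck_on_moment:
  "continuous_on (sphere 0 1) f \<Longrightarrow> Ck_on k (moment f n) future_cone"
proof (induction k arbitrary: f n)
  case 0
  then show ?case
    using moment_has_derivative by (auto intro!: continuous_at_imp_continuous_on has_derivative_continuous)
next
  case (Suc k)
  show ?case
  proof (rule Ck_on_SucI[OF open_future_cone moment_has_derivative[OF Suc.prems]])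
    fix v
    show "Ck_on k (\<lambda>x. - real n * moment (\<lambda>z. f z * horo v z) (Suc n) x) future_cone"
      by (intro Ck_on_mult Ck_on_const Suc.IH open_future_cone continuous_intros Suc.prems)
  qed
qed

section \<open>Second derivatives on the hyperbolic plane\<close>

text \<open>The differential of \<open>u\<close> and the second differential, both of the extension of \<open>u\<close> that is
  constant along rays. On tangent vectors of \<open>H2\<close> the second differential is the Hessian (\<open>Hess_eq\<close>),
  since the position vector is normal to \<open>H2\<close>.\<close>

definition D1 :: "(real^3 \<Rightarrow> real) \<Rightarrow> real^3 \<Rightarrow> real^3 \<Rightarrow> real" where
  "D1 u x w = frechet_derivative (u \<circ> retract_H2) (at x) w"

definition D2 :: "(real^3 \<Rightarrow> real) \<Rightarrow> real^3 \<Rightarrow> real^3 \<Rightarrow> real^3 \<Rightarrow> real" where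
  "D2 u x v w = frechet_derivative (\<lambda>x. D1 u x w) (at x) v"

text \<open>The vector that represents a linear form with respect to \<open>mink\<close>.\<close>

definition mdual :: "(real^3 \<Rightarrow> real) \<Rightarrow> real^3" where
  "mdual f = (- f (axis 1 1)) *\<^sub>R axis 1 1 + f (axis 2 1) *\<^sub>R axis 2 1 + f (axis 3 1) *\<^sub>R axis 3 1"

lemma mink_mdual: "linear f \<Longrightarrow> mink (mdual f) w = f w"
proof -
  assume f: "linear f"
  have "w = (w$1) *\<^sub>R axis 1 1 + (w$2) *\<^sub>R axis 2 1 + (w$3) *\<^sub>R axis 3 1"
    by (simp add: vec_eq_iff forall_3 axis_def)
  from arg_cong[OF this, of f]
  have "f w = w$1 * f (axis 1 1) + w$2 * f (axis 2 1) + w$3 * f (axis 3 1)"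
    by (simp add: linear_add[OF f] linear_cmul[OF f])
  then show ?thesis by (simp add: mdual_def mink_def axis_def)
qed

lemma tangent_pos_def:
  assumes p: "p \<in> H2" and v: "v \<in> tangent p" and le: "mink v v \<le> 0"
  shows "v = 0"
proof -
  obtain t b where t: "0 \<le> t" "t < 1" "p = hpt t b" using hpt_exists[OF p] .
  have e: "v = mink v (radial t b) *\<^sub>R radial t b + mink v (angular b) *\<^sub>R angular b"
    using frame_expand[OF t(1,2), of v b] v t(3) by (simp add: tangent_def)
  define x y where "x = mink v (radial t b)" and "y = mink v (angular b)"
  have "mink v v = x\<^sup>2 + y\<^sup>2"
    unfolding e[folded x_def y_def] using frame_mink[OF t(1,2), of b] mink_commute[of "angular b" "radial t b"]
    by (simp add: mink.add_left mink.add_right mink.scaleR_left mink.scaleR_right power2_eq_square)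
  then have "x = 0 \<and> y = 0" using le sum_power2_le_zero_iff by metis
  then show ?thesis using e by (simp add: x_def y_def)
qed

lemma retract_H2_scaleR: "c > 0 \<Longrightarrow> retract_H2 (c *\<^sub>R x) = retract_H2 x"
proof -
  assume c: "c > 0"
  have "sqrt (- mink (c *\<^sub>R x) (c *\<^sub>R x)) = c * sqrt (- mink x x)"
  proof -
    have "- mink (c *\<^sub>R x) (c *\<^sub>R x) = c\<^sup>2 * (- mink x x)"
      by (simp add: mink.scaleR_left mink.scaleR_right power2_eq_square)
    then show ?thesis using c by (simp only: real_sqrt_mult) simp
  qed
  then show ?thesis using c by (simp add: retract_H2_def)
qed

lemma future_cone_scaleR: "c > 0 \<Longrightarrow> x \<in> future_cone \<Longrightarrow> c *\<^sub>R x \<in> future_cone"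
  by (simp add: future_cone_def mink.scaleR_left mink.scaleR_right mult_pos_neg)

lemma H2_in_cone: "p \<in> H2 \<Longrightarrow> p \<in> future_cone"
  using H2_subset_cone by blast

locale C2_function =
  fixes u :: "real^3 \<Rightarrow> real"
  assumes C2: "Ck_on 2 (u \<circ> retract_H2) future_cone"
begin

lemma D1_has_derivative: "x \<in> future_cone \<Longrightarrow> (u \<circ> retract_H2 has_derivative D1 u x) (at x)"
  using C2 by (simp add: numeral_2_eq_2 D1_def[abs_def] frechet_derivative_works)

lemma D2_has_derivative: "x \<in> future_cone \<Longrightarrow> ((\<lambda>x. D1 u x w) has_derivative (\<lambda>v. D2 u x v w)) (at x)"
  using C2 by (simp add: numeral_2_eq_2 D1_def[abs_def] D2_def[abs_def] frechet_derivative_works)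

lemma linear_D1: "x \<in> future_cone \<Longrightarrow> linear (D1 u x)"
  using D1_has_derivative has_derivative_linear by blast

lemma linear_D2_left: "x \<in> future_cone \<Longrightarrow> linear (\<lambda>v. D2 u x v w)"
  using D2_has_derivative has_derivative_linear by blast

lemma linear_D2_right:
  assumes x: "x \<in> future_cone"
  shows "linear (D2 u x v)"
proof (rule linearI)
  fix w w' c
  have "((\<lambda>x. D1 u x w + D1 u x w') has_derivative (\<lambda>v. D2 u x v (w + w'))) (at x)"
    by (rule has_derivative_transform_within_open[OF D2_has_derivative[OF x] open_future_cone x])
      (simp add: linear_add[OF linear_D1])
  from has_derivative_unique[OF this has_derivative_add[OF D2_has_derivative[OF x] D2_has_derivative[OF x]]]
  show "D2 u x v (w + w') = D2 u x v w + D2 u x v w'" by (rule fun_cong)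
  have "((\<lambda>x. c *\<^sub>R D1 u x w) has_derivative (\<lambda>v. D2 u x v (c *\<^sub>R w))) (at x)"
    by (rule has_derivative_transform_within_open[OF D2_has_derivative[OF x] open_future_cone x])
      (simp add: linear_cmul[OF linear_D1])
  from has_derivative_unique[OF this has_derivative_scaleR_right[OF D2_has_derivative[OF x]]]
  show "D2 u x v (c *\<^sub>R w) = c *\<^sub>R D2 u x v w" by (rule fun_cong)
qed

lemma D1_scaleR:
  assumes x: "x \<in> future_cone" and c: "c > 0"
  shows "D1 u (c *\<^sub>R x) v = D1 u x v / c"
proof -
  have "((\<lambda>x. (u \<circ> retract_H2) (c *\<^sub>R x)) has_derivative (\<lambda>v. D1 u (c *\<^sub>R x) (c *\<^sub>R v))) (at x)"
    by (rule has_derivative_compose[where f = "\<lambda>x. c *\<^sub>R x" and f' = "\<lambda>v. c *\<^sub>R v"])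
      (auto intro!: derivative_eq_intros D1_has_derivative[OF future_cone_scaleR[OF c x], unfolded o_def])
  moreover have "(\<lambda>x. (u \<circ> retract_H2) (c *\<^sub>R x)) = u \<circ> retract_H2"
    using c by (simp add: fun_eq_iff retract_H2_scaleR)
  ultimately have "D1 u x v = D1 u (c *\<^sub>R x) (c *\<^sub>R v)"
    using has_derivative_unique[OF D1_has_derivative[OF x]] by metis
  also have "\<dots> = c * D1 u (c *\<^sub>R x) v"
    using linear_cmul[OF linear_D1[OF future_cone_scaleR[OF c x]]] by simp
  finally show ?thesis using c by simp
qed

lemma D1_radial:
  assumes p: "p \<in> H2"
  shows "D1 u p p = 0"
proof -
  have "(u \<circ> retract_H2 has_derivative D1 u p) (at (retract_H2 p))"
    using D1_has_derivative[OF H2_in_cone[OF p]] retract_H2_id[OF p] by simp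
  from has_derivative_compose[OF retract_H2_has_derivative[OF p] this]
  have "((\<lambda>x. (u \<circ> retract_H2) (retract_H2 x)) has_derivative (\<lambda>v. D1 u p (v + mink v p *\<^sub>R p))) (at p)"
    by simp
  then have "(u \<circ> retract_H2 has_derivative (\<lambda>v. D1 u p (v + mink v p *\<^sub>R p))) (at p)"
    by (rule has_derivative_transform_within_open[OF _ open_future_cone H2_in_cone[OF p]])
      (simp add: retract_H2_id[OF retract_H2_in])
  from fun_cong[OF has_derivative_unique[OF D1_has_derivative[OF H2_in_cone[OF p]] this], of p]
  show ?thesis using p by (simp add: H2_def linear_0[OF linear_D1[OF H2_in_cone[OF p]]])
qed

lemma grad_eq:
  assumes p: "p \<in> H2"
  shows "grad u p = mdual (D1 u p)"
  unfolding grad_def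
proof (rule the_equality)
  note m = mink_mdual[OF linear_D1[OF H2_in_cone[OF p]]]
  have h: "hderiv u p w = D1 u p w" for w by (simp add: hderiv_def D1_def)
  show *: "mdual (D1 u p) \<in> tangent p \<and> (\<forall>w\<in>tangent p. mink (mdual (D1 u p)) w = hderiv u p w)"
    by (simp add: tangent_def m D1_radial[OF p] h)
  fix v assume v: "v \<in> tangent p \<and> (\<forall>w\<in>tangent p. mink v w = hderiv u p w)"
  define d where "d = v - mdual (D1 u p)"
  have "d \<in> tangent p" using v * by (simp add: d_def tangent_def mink.diff_left)
  moreover have "mink d d = 0"
    using v * \<open>d \<in> tangent p\<close> by (simp add: d_def mink.diff_left)
  ultimately have "d = 0" using tangent_pos_def[OF p] by simp
  then show "v = mdual (D1 u p)" by (simp add: d_def)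
qed

lemma grad_has_derivative:
  assumes p: "p \<in> H2"
  shows "(grad u \<circ> retract_H2 has_derivative (\<lambda>v. mdual (D2 u p v) - mink v p *\<^sub>R mdual (D1 u p))) (at p)"
proof -
  have pc: "p \<in> future_cone" and m: "mink p p = -1" using p H2_in_cone by (auto simp: H2_def)
  have eq: "sqrt (- mink x x) *\<^sub>R mdual (D1 u x) = (grad u \<circ> retract_H2) x" if x: "x \<in> future_cone" for x
  proof -
    have s: "sqrt (- mink x x) > 0" using x by (simp add: future_cone_def)
    have "D1 u (retract_H2 x) v = sqrt (- mink x x) * D1 u x v" for v
      unfolding retract_H2_def using D1_scaleR[OF x, of "inverse (sqrt (- mink x x))"] s by (simp add: field_simps)
    then show ?thesis using grad_eq[OF retract_H2_in[OF x]]
      by (simp add: mdual_def scaleR_add_right scaleR_diff_right)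
  qed
  note d = mink_self_has_derivative[of p]
  have s: "((\<lambda>x. sqrt (- mink x x)) has_derivative (\<lambda>v. - mink v p)) (at p)"
    using m by (auto intro!: derivative_eq_intros d simp: mink_commute)
  have g: "((\<lambda>x. mdual (D1 u x)) has_derivative (\<lambda>v. mdual (D2 u p v))) (at p)"
    unfolding mdual_def by (auto intro!: derivative_eq_intros D2_has_derivative pc)
  have "((\<lambda>x. sqrt (- mink x x) *\<^sub>R mdual (D1 u x)) has_derivative
      (\<lambda>v. mdual (D2 u p v) - mink v p *\<^sub>R mdual (D1 u p))) (at p)"
    by (rule has_derivative_eq_rhs[OF has_derivative_scaleR[OF s g]]) (simp add: m fun_eq_iff)
  then show ?thesis
    by (rule has_derivative_transform_within_open[OF _ open_future_cone pc eq])
qed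

lemma Hess_eq:
  assumes p: "p \<in> H2" and v: "v \<in> tangent p" and w: "w \<in> tangent p"
  shows "Hess u p v w = D2 u p v w"
proof -
  have h: "hderiv (grad u) p v = mdual (D2 u p v)"
    using v fun_cong[OF frechet_derivative_at[OF grad_has_derivative[OF p]], of v]
    by (simp add: hderiv_def tangent_def)
  show ?thesis using w mink_commute[of p w]
    by (simp add: Hess_def nabla_def h mink.add_left mink.scaleR_left tangent_def
        mink_mdual[OF linear_D2_right[OF H2_in_cone[OF p]]])
qed

text \<open>The derivative of \<open>q \<boxtimes> grad u q\<close> has two terms. The one that differentiates the first factor is the
  product of two tangent vectors, hence normal, and the projection onto the tangent plane removes it;
  so \<open>J\<close> is parallel.\<close>

lemma nabla_hJ_grad:
  assumes t: "0 \<le> t" "t < 1" and v: "v \<in> tangent (hpt t b)"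
  shows "nabla (\<lambda>q. hJ q (grad u q)) (hpt t b) v
    = D2 u (hpt t b) v (radial t b) *\<^sub>R angular b - D2 u (hpt t b) v (angular b) *\<^sub>R radial t b"
proof -
  let ?p = "hpt t b"
  have p: "?p \<in> H2" by (rule hpt_in_H2[OF t])
  define G where "G = mdual (D2 u ?p v)"
  define g where "g = grad u ?p"
  have Gm: "mink G w = D2 u ?p v w" for w
    unfolding G_def by (rule mink_mdual[OF linear_D2_right[OF H2_in_cone[OF p]]])
  have pG: "?p \<boxtimes> G = D2 u ?p v (radial t b) *\<^sub>R angular b - D2 u ?p v (angular b) *\<^sub>R radial t b"
    by (subst frame_expand[OF t, of G b])
      (simp add: mcross.add_right mcross.diff_right mcross.scaleR_right mcross_self frame_hJ[OF t, unfolded hJ_def] Gm)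
  have "g \<in> tangent ?p"
    unfolding g_def grad_eq[OF p] tangent_def
    using D1_radial[OF p] mink_mdual[OF linear_D1[OF H2_in_cone[OF p]]] by simp
  then obtain c d where gg: "g = c *\<^sub>R radial t b + d *\<^sub>R angular b"
    using frame_expand[OF t, of g b] by (auto simp: tangent_def)
  from v obtain a e where vv: "v = a *\<^sub>R radial t b + e *\<^sub>R angular b"
    using frame_expand[OF t, of v b] by (auto simp: tangent_def)
  have vg: "v \<boxtimes> g = (e * c - a * d) *\<^sub>R ?p"
    unfolding gg vv using mcross_commute[of "angular b" "radial t b"]
    by (simp add: mcross.add_left mcross.add_right mcross.scaleR_left mcross.scaleR_right mcross_self
        frame_mcross[OF t] algebra_simps)
  have "((\<lambda>x. retract_H2 x \<boxtimes> (grad u \<circ> retract_H2) x) has_derivative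
      (\<lambda>v. retract_H2 ?p \<boxtimes> (mdual (D2 u ?p v) - mink v ?p *\<^sub>R mdual (D1 u ?p))
        + (v + mink v ?p *\<^sub>R ?p) \<boxtimes> (grad u \<circ> retract_H2) ?p)) (at ?p)"
    by (rule mcross.FDERIV[OF retract_H2_has_derivative[OF p] grad_has_derivative[OF p]])
  then have "((\<lambda>q. hJ q (grad u q)) \<circ> retract_H2 has_derivative
      (\<lambda>v. ?p \<boxtimes> (mdual (D2 u ?p v) - mink v ?p *\<^sub>R mdual (D1 u ?p))
        + (v + mink v ?p *\<^sub>R ?p) \<boxtimes> g)) (at ?p)"
    by (simp add: o_def hJ_def retract_H2_id[OF p] g_def)
  from fun_cong[OF frechet_derivative_at[OF this], of v]
  have "hderiv (\<lambda>q. hJ q (grad u q)) ?p v = ?p \<boxtimes> G + v \<boxtimes> g"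
    using v[unfolded tangent_def mem_Collect_eq] by (simp add: hderiv_def G_def)
  then have "nabla (\<lambda>q. hJ q (grad u q)) ?p v = ?p \<boxtimes> G"
    unfolding nabla_def vg pG using frame_mink[OF t, of b] mink_commute[of ?p "radial t b"] mink_commute[of ?p "angular b"]
    by (simp add: mink.add_left mink.diff_left mink.scaleR_left scaleR_diff_left)
  then show ?thesis by (simp add: pG)
qed

lemma dbar_hJ_grad:
  fixes t b :: real
  assumes t: "0 \<le> t" "t < 1"
  defines "p \<equiv> hpt t b" and "e \<equiv> radial t b" and "f \<equiv> angular b"
  defines "m \<equiv> (D2 u p e e - D2 u p f f) / 2" and "n \<equiv> (D2 u p e f + D2 u p f e) / 2"
  shows "dbar (\<lambda>q. hJ q (grad u q)) p (x *\<^sub>R e + y *\<^sub>R f) = (m * y - n * x) *\<^sub>R e + (m * x + n * y) *\<^sub>R f"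
proof -
  have pc: "p \<in> future_cone" unfolding p_def by (rule H2_in_cone[OF hpt_in_H2[OF t]])
  have tan: "a *\<^sub>R e + c *\<^sub>R f \<in> tangent p" for a c
    using frame_mink[OF t, of b] mink_commute[of e p] mink_commute[of f p]
    by (simp add: tangent_def p_def e_def f_def mink.add_left mink.scaleR_left)
  have J: "hJ p (a *\<^sub>R e + c *\<^sub>R f) = (- c) *\<^sub>R e + a *\<^sub>R f" for a c
    using frame_hJ[OF t, of b] by (simp add: hJ_def p_def e_def f_def mcross.add_right mcross.scaleR_right)
  have lin: "D2 u p (a *\<^sub>R e + c *\<^sub>R f) w = a * D2 u p e w + c * D2 u p f w" for a c w
    using linear_add[OF linear_D2_left[OF pc]] linear_cmul[OF linear_D2_left[OF pc]] by simp
  have N: "nabla (\<lambda>q. hJ q (grad u q)) p (a *\<^sub>R e + c *\<^sub>R f)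
    = (- (a * D2 u p e f + c * D2 u p f f)) *\<^sub>R e + (a * D2 u p e e + c * D2 u p f e) *\<^sub>R f" for a c
    using nabla_hJ_grad[OF t tan[of a c, unfolded p_def], folded p_def e_def f_def] by (simp add: lin algebra_simps)
  show ?thesis unfolding dbar_def J N
    by (simp add: m_def n_def algebra_simps diff_divide_distrib add_divide_distrib)
qed

lemma gnorm_frame:
  assumes t: "0 \<le> t" "t < 1"
  shows "gnorm (x *\<^sub>R radial t b + y *\<^sub>R angular b) = sqrt (x\<^sup>2 + y\<^sup>2)"
  using frame_mink[OF t, of b] mink_commute[of "angular b" "radial t b"]
  by (simp add: gnorm_def mink.add_left mink.add_right mink.scaleR_left mink.scaleR_right power2_eq_square)

text \<open>The matrix of the \<open>\<partial>\<close>-bar derivative in the frame is \<open>J\<close> times the symmetric tracefree part of the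
  Hessian. Symmetric tracefree matrices with entries \<open>m\<close> and \<open>n\<close> multiply lengths by
  \<open>sqrt (m\<^sup>2 + n\<^sup>2)\<close>.\<close>

lemma tangent_onorm_dbar:
  fixes t b :: real
  assumes t: "0 \<le> t" "t < 1"
  defines "p \<equiv> hpt t b" and "e \<equiv> radial t b" and "f \<equiv> angular b"
  defines "m \<equiv> (D2 u p e e - D2 u p f f) / 2" and "n \<equiv> (D2 u p e f + D2 u p f e) / 2"
  shows "tangent_onorm p (dbar (\<lambda>q. hJ q (grad u q)) p) = sqrt (m\<^sup>2 + n\<^sup>2)"
proof -
  let ?V = "\<lambda>q. hJ q (grad u q)"
  have N: "gnorm (dbar ?V p (x *\<^sub>R e + y *\<^sub>R f)) = sqrt (m\<^sup>2 + n\<^sup>2) * sqrt (x\<^sup>2 + y\<^sup>2)" for x y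
  proof -
    have "gnorm (dbar ?V p (x *\<^sub>R e + y *\<^sub>R f)) = sqrt ((m * y - n * x)\<^sup>2 + (m * x + n * y)\<^sup>2)"
      using dbar_hJ_grad[OF t, of b x y] gnorm_frame[OF t]
      unfolding p_def e_def f_def m_def n_def by simp
    also have "(m * y - n * x)\<^sup>2 + (m * x + n * y)\<^sup>2 = (m\<^sup>2 + n\<^sup>2) * (x\<^sup>2 + y\<^sup>2)"
      by (simp add: power2_eq_square algebra_simps)
    finally show ?thesis by (simp add: real_sqrt_mult)
  qed
  show ?thesis unfolding tangent_onorm_def
  proof (rule cSup_eq_maximum)
    have "e \<in> tangent p" "gnorm e = 1"
      using frame_mink[OF t, of b] mink_commute[of e p]
      by (simp_all add: tangent_def gnorm_def p_def e_def)
    moreover have "gnorm (dbar ?V p e) = sqrt (m\<^sup>2 + n\<^sup>2)" using N[of 1 0] by simp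
    ultimately show "sqrt (m\<^sup>2 + n\<^sup>2) \<in> {gnorm (dbar ?V p Y) |Y. Y \<in> tangent p \<and> gnorm Y \<le> 1}"
      by (metis (mono_tags, lifting) mem_Collect_eq order_refl)
  next
    fix r assume "r \<in> {gnorm (dbar ?V p Y) |Y. Y \<in> tangent p \<and> gnorm Y \<le> 1}"
    then obtain Y where Y: "Y \<in> tangent p" "gnorm Y \<le> 1" "r = gnorm (dbar ?V p Y)" by auto
    obtain x y where xy: "Y = x *\<^sub>R e + y *\<^sub>R f"
      using frame_expand[OF t, of Y b] Y(1) by (auto simp: tangent_def p_def e_def f_def)
    have "sqrt (x\<^sup>2 + y\<^sup>2) \<le> 1" using Y(2) gnorm_frame[OF t] by (simp add: xy e_def f_def)
    then show "r \<le> sqrt (m\<^sup>2 + n\<^sup>2)"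
      unfolding Y(3) xy N by (intro mult_left_le) simp_all
  qed
qed

lemma Laplace_eq:
  assumes t: "0 \<le> t" "t < 1"
  shows "Laplace u (hpt t b) = D2 u (hpt t b) (radial t b) (radial t b) + D2 u (hpt t b) (angular b) (angular b)"
proof -
  define p e f where "p = hpt t b" and "e = radial t b" and "f = angular b"
  have p: "p \<in> H2" unfolding p_def by (rule hpt_in_H2[OF t])
  note pc = H2_in_cone[OF p]
  have fm: "mink e e = 1" "mink f f = 1" "mink e f = 0" "mink f e = 0" "mink e p = 0" "mink f p = 0"
    using frame_mink[OF t, of b] by (simp_all add: p_def e_def f_def mink_commute)
  have inv: "Hess u p g g + Hess u p h h = D2 u p e e + D2 u p f f" if of: "orthonormal_frame p g h" for g h
  proof -
    have gh: "g \<in> tangent p" "h \<in> tangent p" "mink g g = 1" "mink h h = 1" "mink g h = 0"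
      using of by (auto simp: orthonormal_frame_def)
    obtain x y where g: "g = x *\<^sub>R e + y *\<^sub>R f"
      using frame_expand[OF t, of g b] gh(1) by (auto simp: tangent_def p_def e_def f_def)
    obtain z w where h: "h = z *\<^sub>R e + w *\<^sub>R f"
      using frame_expand[OF t, of h b] gh(2) by (auto simp: tangent_def p_def e_def f_def)
    have xy: "x * x + y * y = 1" and zw: "z * z + w * w = 1" and o: "x * z + y * w = 0"
      using gh(3-5) fm unfolding g h
      by (simp_all add: mink.add_left mink.add_right mink.scaleR_left mink.scaleR_right mult.commute)
    \<comment> \<open>The coordinate matrix has orthonormal rows, hence also orthonormal columns.\<close>
    define k where "k = x * w - y * z"
    have "z * (x * x + y * y) = x * (x * z + y * w) - y * k"
      "w * (x * x + y * y) = y * (x * z + y * w) + x * k"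
      by (simp_all add: k_def algebra_simps)
    then have zk: "z = - (y * k)" and wk: "w = x * k" unfolding xy o by simp_all
    have "k * k * (x * x + y * y) = 1" using zw unfolding zk wk by (simp add: algebra_simps)
    then have k: "k * k = 1" using xy by simp
    have zw': "z * z = y * y" "w * w = x * x" "z * w = - (x * y)"
    proof -
      have "z * z = k * k * (y * y)" "w * w = k * k * (x * x)" "z * w = - (k * k * (x * y))"
        by (simp_all add: zk wk)
      then show "z * z = y * y" "w * w = x * x" "z * w = - (x * y)" by (simp_all add: k)
    qed
    have D: "D2 u p (a *\<^sub>R e + c *\<^sub>R f) (a *\<^sub>R e + c *\<^sub>R f)
        = (a * a) * D2 u p e e + (a * c) * (D2 u p e f + D2 u p f e) + (c * c) * D2 u p f f" for a c
      using linear_add[OF linear_D2_left[OF pc]] linear_cmul[OF linear_D2_left[OF pc]]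
        linear_add[OF linear_D2_right[OF pc]] linear_cmul[OF linear_D2_right[OF pc]]
      by (simp add: algebra_simps)
    have "Hess u p g g + Hess u p h h = D2 u p g g + D2 u p h h"
      using Hess_eq[OF p] gh by simp
    also have "\<dots> = (x * x + y * y) * (D2 u p e e + D2 u p f f)"
      unfolding g h D zw' by (simp add: algebra_simps)
    finally show ?thesis using xy by simp
  qed
  have of: "orthonormal_frame p e f" by (simp add: orthonormal_frame_def tangent_def fm)
  have "Laplace u p = D2 u p e e + D2 u p f f"
    unfolding Laplace_def
  proof (rule the_equality)
    fix r assume "\<forall>g h. orthonormal_frame p g h \<longrightarrow> r = Hess u p g g + Hess u p h h"
    then show "r = D2 u p e e + D2 u p f f" using of inv by metis
  qed (simp add: inv)
  then show ?thesis by (simp add: p_def e_def f_def)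
qed

end

section \<open>The Klein disk and affine functions\<close>

text \<open>The Klein disk is the slice of the future cone at height one: \<open>cvec \<eta>\<close> is the point of the slice over
  \<open>\<eta>\<close>, \<open>lift \<eta>\<close> the point of \<open>H2\<close> on the same ray, and \<open>kfac \<eta>\<close> the factor by which \<open>disk_fun\<close> rescales.\<close>

definition cvec :: "complex \<Rightarrow> real^3" where
  "cvec \<eta> = vector [1, Re \<eta>, Im \<eta>]"

definition kfac :: "complex \<Rightarrow> real" where
  "kfac \<eta> = sqrt (1 - (cmod \<eta>)\<^sup>2)"

definition lift :: "complex \<Rightarrow> real^3" where
  "lift \<eta> = retract_H2 (cvec \<eta>)"

lemma cvec_component [simp]: "cvec \<eta> $ 1 = 1" "cvec \<eta> $ 2 = Re \<eta>" "cvec \<eta> $ 3 = Im \<eta>"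
  by (simp_all add: cvec_def)

lemma mink_cvec: "mink (cvec \<eta>) (cvec \<eta>) = - (1 - (cmod \<eta>)\<^sup>2)"
  unfolding cmod_power2 by (simp add: mink_def power2_eq_square)

lemma kfac_pos: "cmod \<eta> < 1 \<Longrightarrow> kfac \<eta> > 0"
  by (simp add: kfac_def abs_square_less_1)

lemma kfac_power2: "cmod \<eta> \<le> 1 \<Longrightarrow> (kfac \<eta>)\<^sup>2 = 1 - (cmod \<eta>)\<^sup>2"
  by (simp add: kfac_def power_le_one)

lemma kfac_small_near_circle:
  assumes "s > 0"
  obtains \<rho> where "0 \<le> \<rho>" "\<rho> < 1" "\<And>\<eta>. \<rho> < cmod \<eta> \<Longrightarrow> cmod \<eta> < 1 \<Longrightarrow> kfac \<eta> < s"
proof -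
  define \<sigma> where "\<sigma> = sqrt (1 - (min s 1)\<^sup>2)"
  have \<sigma>: "0 \<le> \<sigma>" "\<sigma> < 1" using assms by (auto simp: \<sigma>_def power_le_one)
  have "kfac \<eta> < s" if \<eta>: "\<sigma> < cmod \<eta>" "cmod \<eta> < 1" for \<eta>
  proof -
    have "\<sigma>\<^sup>2 < (cmod \<eta>)\<^sup>2" using \<eta> \<sigma> by (intro power_strict_mono) auto
    then have "1 - (cmod \<eta>)\<^sup>2 < (min s 1)\<^sup>2" using assms by (simp add: \<sigma>_def power_le_one)
    then have "kfac \<eta> < min s 1" unfolding kfac_def using assms by (intro real_less_lsqrt) auto
    then show ?thesis by simp
  qed
  then show ?thesis using that \<sigma> by blast
qed

lemma cvec_in_cone: "cmod \<eta> < 1 \<Longrightarrow> cvec \<eta> \<in> future_cone"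
  using mink_cvec[of \<eta>] by (simp add: future_cone_def abs_square_less_1)

lemma lift_in_H2: "cmod \<eta> < 1 \<Longrightarrow> lift \<eta> \<in> H2"
  unfolding lift_def by (intro retract_H2_in cvec_in_cone)

lemma lift_eq: "lift \<eta> = cvec \<eta> /\<^sub>R kfac \<eta>"
  by (simp add: lift_def retract_H2_def mink_cvec kfac_def)

lemma H2_props:
  assumes "p \<in> H2"
  shows "p$1 \<ge> 1" "cmod (Klein p) < 1" "kfac (Klein p) = 1 / p$1" "lift (Klein p) = p"
proof -
  have m: "(p$1)\<^sup>2 = 1 + (p$2)\<^sup>2 + (p$3)\<^sup>2" "p$1 > 0"
    using assms by (auto simp: H2_def mink_def power2_eq_square)
  show p1: "p$1 \<ge> 1" using m by (smt (verit) power_less_one_iff zero_le_power2 zero_less_numeral)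
  have "(cmod (Klein p))\<^sup>2 = ((p$2)\<^sup>2 + (p$3)\<^sup>2) / (p$1)\<^sup>2"
    by (simp add: Klein_def cmod_power2 power_divide add_divide_distrib)
  also have "(p$2)\<^sup>2 + (p$3)\<^sup>2 = (p$1)\<^sup>2 - 1" using m(1) by simp
  finally have k: "1 - (cmod (Klein p))\<^sup>2 = 1 / (p$1)\<^sup>2"
    using m(2) by (simp add: diff_divide_distrib)
  then have "(cmod (Klein p))\<^sup>2 < 1" using m(2) by (smt (verit) zero_less_divide_iff zero_less_power)
  then show "cmod (Klein p) < 1" by (simp add: abs_square_less_1)
  show kf: "kfac (Klein p) = 1 / p$1" using m(2) unfolding kfac_def k by (simp add: real_sqrt_divide)
  show "lift (Klein p) = p" unfolding lift_eq kf using m(2)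
    by (simp add: vec_eq_iff forall_3 Klein_def)
qed

lemma Klein_lift: "cmod \<eta> < 1 \<Longrightarrow> Klein (lift \<eta>) = \<eta>"
  using kfac_pos[of \<eta>] by (simp add: Klein_def lift_eq complex_eq_iff)

lemma inv_Klein: "cmod \<eta> < 1 \<Longrightarrow> inv_into H2 Klein \<eta> = lift \<eta>"
  using inv_into_f_f[OF inj_on_inverseI[of H2 lift Klein, OF H2_props(4)] lift_in_H2, of \<eta>] Klein_lift[of \<eta>]
  by simp

lemma disk_fun_eq: "cmod \<eta> < 1 \<Longrightarrow> disk_fun u \<eta> = kfac \<eta> * u (lift \<eta>)"
  by (simp add: disk_fun_def kfac_def inv_Klein)

lemma affine_fun_iff: "affine_fun a \<longleftrightarrow> (\<exists>y. a = horo y)"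
proof
  assume "affine_fun a"
  then obtain L c where L: "linear L" "a = (\<lambda>z. L z + c)" by (auto simp: affine_fun_def)
  have Lz: "L z = Re z * L 1 + Im z * L \<i>" for z
  proof -
    have "L z = L (Re z *\<^sub>R 1 + Im z *\<^sub>R \<i>)"
      by (rule arg_cong[of _ _ L]) (simp add: complex_eq_iff)
    then show ?thesis by (simp add: linear_add[OF L(1)] linear_cmul[OF L(1)])
  qed
  have "a = horo (vector [c, - L 1, - L \<i>])"
    unfolding L(2) by (rule ext, subst Lz) (simp add: horo_def)
  then show "\<exists>y. a = horo y" ..
next
  assume "\<exists>y. a = horo y"
  then obtain y where y: "a = horo y" ..
  have "linear (\<lambda>z. - (y$2 * Re z) - y$3 * Im z)"
    by (rule linearI) (simp_all add: algebra_simps)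
  moreover have "a = (\<lambda>z. (- (y$2 * Re z) - y$3 * Im z) + y$1)"
    by (simp add: y fun_eq_iff horo_def)
  ultimately show "affine_fun a" unfolding affine_fun_def by blast
qed

lemma horo_Klein: "p \<in> H2 \<Longrightarrow> horo y (Klein p) = - mink y p / p$1"
  using H2_props(1)[of p] by (simp add: horo_def Klein_def mink_def field_simps)

section \<open>The Poisson extension\<close>

text \<open>The function \<open>f\<close>, extended to the light cone with degree one and restricted to the circle of lightlike
  vectors \<open>hpt t b + cos \<alpha> radial t b + sin \<alpha> angular b\<close>.\<close>

definition Phi :: "(complex \<Rightarrow> real) \<Rightarrow> real \<Rightarrow> real \<Rightarrow> real \<Rightarrow> real" where
  "Phi f t b \<alpha> = lam t \<alpha> * f (cis (vis t b \<alpha>))"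

definition poisson :: "(complex \<Rightarrow> real) \<Rightarrow> real^3 \<Rightarrow> real" where
  "poisson f = (\<lambda>p\<in>H2. moment f 2 p / (2 * pi))"

lemma continuous_on_Phi:
  fixes g :: "real \<Rightarrow> real"
  assumes "0 \<le> t" "t < 1" "continuous_on (sphere 0 1) f" "continuous_on S g"
  shows "continuous_on S (\<lambda>x. Phi f t b (g x))"
  unfolding Phi_def
  by (intro continuous_on_mult continuous_on_lam continuous_on_compose_cis continuous_on_vis assms)

lemma poisson_vis:
  assumes t: "0 \<le> t" "t < 1" and f: "continuous_on (sphere 0 1) f"
  shows "poisson f (hpt t b) = integral {0..2*pi} (Phi f t b) / (2 * pi)"
  using moment_vis[OF t f H2_in_cone[OF hpt_in_H2[OF t]], where n = 1 and b = b] hpt_in_H2[OF t, of b]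
  by (simp add: poisson_def numeral_2_eq_2 Phi_def[abs_def] mult.commute)

lemma poisson_retract:
  assumes "x \<in> future_cone"
  shows "(poisson f \<circ> retract_H2) x = - mink x x * moment f 2 x / (2 * pi)"
  using assms retract_H2_in[OF assms] moment_scaleR[of "inverse (sqrt (- mink x x))" f 2 x]
  by (simp add: poisson_def retract_H2_def future_cone_def power_inverse field_simps)

lemma Ck_on_mink_self: "Ck_on k (\<lambda>x. - mink x x / c) future_cone"
proof -
  have l: "bounded_linear (\<lambda>x::real^3. d * x$i)" for d i
    by (intro bounded_linear_const_mult bounded_linear_vec_nth)
  have "Ck_on k (\<lambda>x. (1/c * x$1) * (1 * x$1) + (((-1/c) * x$2) * (1 * x$2) + ((-1/c) * x$3) * (1 * x$3))) future_cone"
    by (intro Ck_on_add Ck_on_mult Ck_on_bounded_linear l open_future_cone)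
  then show ?thesis
    by (rule Ck_on_cong[OF open_future_cone, rotated]) (simp add: mink_def field_simps add_divide_distrib diff_divide_distrib)
qed

lemma smooth_poisson:
  assumes f: "continuous_on (sphere 0 1) f"
  shows "smooth_H2 (poisson f)"
  unfolding smooth_H2_def
proof
  fix k
  have "Ck_on k (\<lambda>x. (- mink x x / (2 * pi)) * moment f 2 x) future_cone"
    by (intro Ck_on_mult Ck_on_mink_self Ck_on_moment open_future_cone f)
  then show "Ck_on k (poisson f \<circ> retract_H2) future_cone"
    by (rule Ck_on_cong[OF open_future_cone, rotated]) (simp add: poisson_retract del: o_apply)
qed

text \<open>On tangent vectors the derivatives of the prefactor \<open>- mink x x\<close> contribute only through
  \<open>mink v w\<close>, because its gradient at \<open>p\<close> is normal.\<close>

lemma D2_poisson: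
  assumes f: "continuous_on (sphere 0 1) f" and p: "p \<in> H2" and v: "v \<in> tangent p" and w: "w \<in> tangent p"
  shows "D2 (poisson f) p v w
    = (6 * moment (\<lambda>z. f z * horo w z * horo v z) 4 p - 2 * mink v w * moment f 2 p) / (2 * pi)"
proof -
  have pc: "p \<in> future_cone" and pp: "mink p p = -1" and vw: "mink v p = 0" "mink p v = 0" "mink w p = 0" "mink p w = 0"
    using p H2_in_cone v w mink_commute by (auto simp: H2_def tangent_def)
  note m2 = moment2_has_derivative[OF f] and m3 = moment3_has_derivative[OF f] and qd = mink_self_has_derivative
  have D1: "D1 (poisson f) x w = (2 * mink x x * moment (\<lambda>z. f z * horo w z) 3 x - 2 * mink x w * moment f 2 x) / (2 * pi)"
    if x: "x \<in> future_cone" for x w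
  proof -
    have "((\<lambda>x. - mink x x * moment f 2 x / (2 * pi)) has_derivative
        (\<lambda>w. (- mink x x * (- 2 * moment (\<lambda>z. f z * horo w z) 3 x) + - (2 * mink x w) * moment f 2 x) / (2 * pi))) (at x)"
      by (intro bounded_linear.has_derivative[OF bounded_linear_divide] has_derivative_mult has_derivative_minus qd m2 x)
    from has_derivative_transform_within_open[OF this open_future_cone x poisson_retract[symmetric]]
    have "(poisson f \<circ> retract_H2 has_derivative
      (\<lambda>w. (- mink x x * (- 2 * moment (\<lambda>z. f z * horo w z) 3 x) + - (2 * mink x w) * moment f 2 x) / (2 * pi))) (at x)" .
    from fun_cong[OF frechet_derivative_at[OF this], of w, symmetric]
    show ?thesis unfolding D1_def by simp
  qed
  have "((\<lambda>x. (2 * mink x x * moment (\<lambda>z. f z * horo w z) 3 x - 2 * mink x w * moment f 2 x) / (2 * pi)) has_derivative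
      (\<lambda>v. ((2 * mink p p * (- 3 * moment (\<lambda>z. f z * horo w z * horo v z) 4 p)
          + (2 * (2 * mink p v)) * moment (\<lambda>z. f z * horo w z) 3 p)
        - (2 * mink p w * (- 2 * moment (\<lambda>z. f z * horo v z) 3 p) + 2 * mink v w * moment f 2 p)) / (2 * pi))) (at p)"
    by (intro bounded_linear.has_derivative[OF bounded_linear_divide] has_derivative_diff has_derivative_mult
        has_derivative_mult_right bounded_linear.has_derivative[OF mink.bounded_linear_left] has_derivative_ident qd m2 m3 pc)
  from has_derivative_transform_within_open[OF this open_future_cone pc D1[symmetric]]
  have "((\<lambda>x. D1 (poisson f) x w) has_derivative
      (\<lambda>v. ((2 * mink p p * (- 3 * moment (\<lambda>z. f z * horo w z * horo v z) 4 p)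
          + (2 * (2 * mink p v)) * moment (\<lambda>z. f z * horo w z) 3 p)
        - (2 * mink p w * (- 2 * moment (\<lambda>z. f z * horo v z) 3 p) + 2 * mink v w * moment f 2 p)) / (2 * pi))) (at p)" .
  from fun_cong[OF frechet_derivative_at[OF this], of v, symmetric]
  show ?thesis unfolding D2_def by (simp add: pp vw)
qed

lemma C2_poisson: "continuous_on (sphere 0 1) f \<Longrightarrow> C2_function (poisson f)"
  using smooth_poisson unfolding smooth_H2_def C2_function_def by blast

lemma poisson_mono:
  assumes "continuous_on (sphere 0 1) f" "continuous_on (sphere 0 1) g" "\<And>z. cmod z = 1 \<Longrightarrow> f z \<le> g z" "p \<in> H2"
  shows "poisson f p \<le> poisson g p"
proof -
  have "moment f 2 p \<le> moment g 2 p"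
    unfolding moment_def
    by (intro circle_int_mono continuous_on_moment_integrand H2_in_cone divide_right_mono assms) simp_all
  then show ?thesis using assms(4) by (simp add: poisson_def divide_right_mono)
qed

lemma continuous_on_horo_circle: "continuous_on S (horo y)"
  by (intro continuous_intros)

lemma lam_horo:
  assumes t: "0 \<le> t" "t < 1"
  shows "lam t \<alpha> * horo y (cis (vis t b \<alpha>))
    = - mink y (hpt t b) - mink y (radial t b) * cos \<alpha> - mink y (angular b) * sin \<alpha>"
proof -
  have "horo y (cis (vis t b \<alpha>)) = - mink y (hpt t b) / lam t \<alpha> + mink y (radial t b) * (- cos \<alpha> / lam t \<alpha>)
      + mink y (angular b) * (- sin \<alpha> / lam t \<alpha>)"
    by (subst frame_expand[OF t, of y b]) (simp only: horo_add horo_scaleR horo_vis[OF t], simp)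
  also have "\<dots> = (- mink y (hpt t b) - mink y (radial t b) * cos \<alpha> - mink y (angular b) * sin \<alpha>) / lam t \<alpha>"
    by (simp add: diff_divide_distrib)
  finally show ?thesis using lam_pos[OF t, of \<alpha>] by simp
qed

lemma has_integral_trig:
  "((\<lambda>\<alpha>. sin (real (Suc k) * \<alpha>)) has_integral 0) {0..2*pi}"
  "((\<lambda>\<alpha>. cos (real (Suc k) * \<alpha>)) has_integral 0) {0..2*pi}"
proof -
  have "((\<lambda>\<alpha>. sin (real (Suc k) * \<alpha>)) has_integral
     (- cos (real (Suc k) * (2*pi)) / real (Suc k) - (- cos (real (Suc k) * 0) / real (Suc k)))) {0..2*pi}"
    by (rule fundamental_theorem_of_calculus)
      (auto intro!: derivative_eq_intros simp flip: has_real_derivative_iff_has_vector_derivative)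
  moreover have "cos (real (Suc k) * (2*pi)) = 1" using cos_int_2pin[of "int (Suc k)"] by (simp add: mult.commute mult.left_commute)
  ultimately show "((\<lambda>\<alpha>. sin (real (Suc k) * \<alpha>)) has_integral 0) {0..2*pi}" by simp
  have "((\<lambda>\<alpha>. cos (real (Suc k) * \<alpha>)) has_integral
     (sin (real (Suc k) * (2*pi)) / real (Suc k) - (sin (real (Suc k) * 0) / real (Suc k)))) {0..2*pi}"
    by (rule fundamental_theorem_of_calculus)
      (auto intro!: derivative_eq_intros simp flip: has_real_derivative_iff_has_vector_derivative)
  moreover have "sin (real (Suc k) * (2*pi)) = 0" using sin_int_2pin[of "int (Suc k)"] by (simp add: mult.commute mult.left_commute)
  ultimately show "((\<lambda>\<alpha>. cos (real (Suc k) * \<alpha>)) has_integral 0) {0..2*pi}" by simp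
qed

text \<open>The mean over the visual circle of a linear form is its value at the centre.\<close>

lemma poisson_horo:
  assumes "p \<in> H2"
  shows "poisson (horo y) p = - mink y p"
proof -
  obtain t b where t: "0 \<le> t" "t < 1" and p: "p = hpt t b" using hpt_exists[OF assms] .
  define A B C where "A = - mink y p" and "B = mink y (radial t b)" and "C = mink y (angular b)"
  have "((\<lambda>\<alpha>. A - B * cos \<alpha> - C * sin \<alpha>) has_integral (2*pi) * A - B * 0 - C * 0) {0..2*pi}"
    using has_integral_trig[of 0] has_integral_const_real[of A 0 "2*pi"]
    by (intro has_integral_diff has_integral_mult_right) simp_all
  then have "integral {0..2*pi} (Phi (horo y) t b) = 2 * pi * A"
    unfolding Phi_def[abs_def] lam_horo[OF t] A_def B_def C_def p by (simp add: has_integral_iff)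
  then show ?thesis using poisson_vis[OF t continuous_on_horo_circle] by (simp add: p A_def)
qed

text \<open>In the visual angle the integrand of \<open>D2_poisson\<close> becomes \<open>Phi\<close> times a quadratic form in
  \<open>(cos \<alpha>, sin \<alpha>)\<close>: the powers of \<open>lam\<close> that come from \<open>horo_vis\<close> and from the change of variables leave
  exactly one.\<close>

lemma D2_poisson_frame:
  fixes t b :: real
  assumes t: "0 \<le> t" "t < 1" and f: "continuous_on (sphere 0 1) f"
  defines "p \<equiv> hpt t b" and "e \<equiv> radial t b" and "g \<equiv> angular b"
  defines "I \<equiv> \<lambda>k. integral {0..2*pi} (\<lambda>\<alpha>. Phi f t b \<alpha> * k \<alpha>)"
  shows "D2 (poisson f) p e e = (6 * I (\<lambda>\<alpha>. cos \<alpha> * cos \<alpha>) - 2 * I (\<lambda>_. 1)) / (2 * pi)"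
    and "D2 (poisson f) p g g = (6 * I (\<lambda>\<alpha>. sin \<alpha> * sin \<alpha>) - 2 * I (\<lambda>_. 1)) / (2 * pi)"
    and "D2 (poisson f) p e g = 6 * I (\<lambda>\<alpha>. sin \<alpha> * cos \<alpha>) / (2 * pi)"
    and "D2 (poisson f) p g e = 6 * I (\<lambda>\<alpha>. sin \<alpha> * cos \<alpha>) / (2 * pi)"
proof -
  have p: "p \<in> H2" unfolding p_def by (rule hpt_in_H2[OF t])
  have pc: "hpt t b \<in> future_cone" by (rule H2_in_cone[OF hpt_in_H2[OF t]])
  have fm: "mink e e = 1" "mink g g = 1" "mink e g = 0" "mink g e = 0" "mink e p = 0" "mink g p = 0"
    using frame_mink[OF t, of b] by (simp_all add: p_def e_def g_def mink_commute)
  have tan: "e \<in> tangent p" "g \<in> tangent p" by (simp_all add: tangent_def fm)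
  have 0: "moment f 2 p = I (\<lambda>_. 1)"
    using moment_vis[OF t f pc, where n = 1] by (simp add: p_def I_def Phi_def numeral_2_eq_2 mult.commute)
  have M: "moment (\<lambda>z. f z * horo w z * horo v z) 4 p = I (\<lambda>\<alpha>. h \<alpha> * k \<alpha>)"
    if "\<And>\<alpha>. horo w (cis (vis t b \<alpha>)) = - h \<alpha> / lam t \<alpha>" "\<And>\<alpha>. horo v (cis (vis t b \<alpha>)) = - k \<alpha> / lam t \<alpha>" for v w h k
  proof -
    have "continuous_on (sphere 0 1) (\<lambda>z. f z * horo w z * horo v z)" by (intro continuous_intros f)
    from moment_vis[OF t this pc, where n = 3]
    have "moment (\<lambda>z. f z * horo w z * horo v z) 4 p
      = integral {0..2*pi} (\<lambda>\<alpha>. f (cis (vis t b \<alpha>)) * (- h \<alpha> / lam t \<alpha>) * (- k \<alpha> / lam t \<alpha>) * lam t \<alpha> ^ 3)"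
      by (simp add: that p_def)
    also have "\<dots> = I (\<lambda>\<alpha>. h \<alpha> * k \<alpha>)"
      unfolding I_def Phi_def
      by (rule integral_cong) (use lam_pos[OF t] in \<open>simp add: power3_eq_cube less_imp_neq[symmetric]\<close>)
    finally show ?thesis .
  qed
  have he: "horo e (cis (vis t b \<alpha>)) = - cos \<alpha> / lam t \<alpha>" and hg: "horo g (cis (vis t b \<alpha>)) = - sin \<alpha> / lam t \<alpha>" for \<alpha>
    by (simp_all add: e_def g_def horo_vis[OF t])
  note D = D2_poisson[OF f p]
  show "D2 (poisson f) p e e = (6 * I (\<lambda>\<alpha>. cos \<alpha> * cos \<alpha>) - 2 * I (\<lambda>_. 1)) / (2 * pi)"
    by (simp add: D tan fm 0 M[of e cos e cos, OF he he])
  show "D2 (poisson f) p g g = (6 * I (\<lambda>\<alpha>. sin \<alpha> * sin \<alpha>) - 2 * I (\<lambda>_. 1)) / (2 * pi)"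
    by (simp add: D tan fm 0 M[of g sin g sin, OF hg hg])
  show "D2 (poisson f) p e g = 6 * I (\<lambda>\<alpha>. sin \<alpha> * cos \<alpha>) / (2 * pi)"
    by (simp add: D tan fm 0 M[of g sin e cos, OF hg he])
  show "D2 (poisson f) p g e = 6 * I (\<lambda>\<alpha>. sin \<alpha> * cos \<alpha>) / (2 * pi)"
    by (simp add: D tan fm 0 M[of e cos g sin, OF he hg]) (simp add: mult.commute)
qed

lemma Phi_trig_integrable:
  assumes "0 \<le> t" "t < 1" "continuous_on (sphere 0 1) f" "continuous_on UNIV k"
  shows "(\<lambda>\<alpha>. Phi f t b \<alpha> * k \<alpha>) integrable_on {u..v}"
  by (intro integrable_continuous_interval continuous_on_mult continuous_on_Phi assms continuous_on_id
      continuous_on_subset[OF assms(4)]) auto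

lemma Laplace_poisson:
  assumes "p \<in> H2" and f: "continuous_on (sphere 0 1) f"
  shows "Laplace (poisson f) p = 2 * poisson f p"
proof -
  obtain t b where t: "0 \<le> t" "t < 1" and p: "p = hpt t b" using hpt_exists[OF assms(1)] .
  define I where "I k = integral {0..2*pi} (\<lambda>\<alpha>. Phi f t b \<alpha> * k \<alpha>)" for k
  have "I (\<lambda>\<alpha>. cos \<alpha> * cos \<alpha>) + I (\<lambda>\<alpha>. sin \<alpha> * sin \<alpha>) = I (\<lambda>\<alpha>. cos \<alpha> * cos \<alpha> + sin \<alpha> * sin \<alpha>)"
    unfolding I_def distrib_left
    by (intro integral_add[symmetric] Phi_trig_integrable t f continuous_intros)
  then have s: "I (\<lambda>\<alpha>. sin \<alpha> * sin \<alpha>) = I (\<lambda>_. 1) - I (\<lambda>\<alpha>. cos \<alpha> * cos \<alpha>)" by simp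
  have "Laplace (poisson f) p = (6 * I (\<lambda>\<alpha>. cos \<alpha> * cos \<alpha>) - 2 * I (\<lambda>_. 1)) / (2 * pi) + (6 * I (\<lambda>\<alpha>. sin \<alpha> * sin \<alpha>) - 2 * I (\<lambda>_. 1)) / (2 * pi)"
    unfolding p C2_function.Laplace_eq[OF C2_poisson[OF f] t] D2_poisson_frame[OF t f] I_def ..
  also have "\<dots> = 2 * (I (\<lambda>_. 1) / (2 * pi))"
    unfolding s by (simp add: field_simps)
  also have "I (\<lambda>_. 1) / (2 * pi) = poisson f p"
    by (simp add: I_def p poisson_vis[OF t f])
  finally show ?thesis .
qed

text \<open>The norm of the \<open>\<partial>\<close>-bar derivative is, up to the constant, the modulus of the second Fourier coefficient of \<open>Phi\<close>.\<close>

lemma tangent_onorm_poisson: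
  fixes t b :: real
  assumes t: "0 \<le> t" "t < 1" and f: "continuous_on (sphere 0 1) f"
  defines "A \<equiv> integral {0..2*pi} (\<lambda>\<alpha>. Phi f t b \<alpha> * cos (2 * \<alpha>))"
    and "B \<equiv> integral {0..2*pi} (\<lambda>\<alpha>. Phi f t b \<alpha> * sin (2 * \<alpha>))"
  shows "tangent_onorm (hpt t b) (dbar (\<lambda>q. hJ q (grad (poisson f) q)) (hpt t b)) = 3 / (2 * pi) * sqrt (A\<^sup>2 + B\<^sup>2)"
proof -
  define I where "I k = integral {0..2*pi} (\<lambda>\<alpha>. Phi f t b \<alpha> * k \<alpha>)" for k
  have "A = I (\<lambda>\<alpha>. cos \<alpha> * cos \<alpha> - sin \<alpha> * sin \<alpha>)"
    by (simp add: A_def I_def cos_double power2_eq_square)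
  also have "\<dots> = I (\<lambda>\<alpha>. cos \<alpha> * cos \<alpha>) - I (\<lambda>\<alpha>. sin \<alpha> * sin \<alpha>)"
    unfolding I_def right_diff_distrib
    by (intro integral_diff Phi_trig_integrable t f continuous_intros)
  finally have A: "A = I (\<lambda>\<alpha>. cos \<alpha> * cos \<alpha>) - I (\<lambda>\<alpha>. sin \<alpha> * sin \<alpha>)" .
  have B: "B = 2 * I (\<lambda>\<alpha>. sin \<alpha> * cos \<alpha>)"
    unfolding B_def I_def integral_mult_right[symmetric] by (simp add: sin_double mult.assoc mult.left_commute)
  have m: "((6 * x - 2 * z) / (2 * pi) - (6 * y - 2 * z) / (2 * pi)) / 2 = 3 / (2 * pi) * (x - y)" for x y z
    by (simp add: field_simps)
  have n: "(6 * x / (2 * pi) + 6 * x / (2 * pi)) / 2 = 3 / (2 * pi) * (2 * x)" for x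
    by (simp add: field_simps)
  show ?thesis
    unfolding C2_function.tangent_onorm_dbar[OF C2_poisson[OF f] t] D2_poisson_frame[OF t f] I_def[symmetric] m n
      A[symmetric] B[symmetric]
    by (simp only: power_mult_distrib distrib_left[symmetric] real_sqrt_mult real_sqrt_abs) simp
qed

text \<open>Poisson extension preserves inequalities and reproduces affine functions, so affine bounds of \<open>f\<close> on
  the circle persist in the disk.\<close>

lemma poisson_squeeze:
  assumes z0: "cmod z0 = 1" and f: "continuous_on (sphere 0 1) f" and p: "p \<in> H2"
    and le: "\<And>z. cmod z = 1 \<Longrightarrow> \<bar>f z - c\<bar> \<le> e + C * (1 - z0 \<bullet> z)"
  shows "\<bar>disk_fun (poisson f) (Klein p) - c\<bar> \<le> e + C * (1 - z0 \<bullet> Klein p)"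
proof -
  define y where "y = (vector [1, Re z0, Im z0] :: real^3)"
  have y: "1 - z0 \<bullet> z = horo y z" for z by (simp add: y_def horo_def inner_complex_def)
  have one: "horo (axis 1 1) = (\<lambda>_. 1)" by (simp add: horo_def fun_eq_iff axis_def)
  have lin: "horo ((c + s * e) *\<^sub>R axis 1 1 + (s * C) *\<^sub>R y) z = c + s * (e + C * (1 - z0 \<bullet> z))" for s z
    by (simp add: horo_add horo_scaleR one y algebra_simps)
  have k: "kfac (Klein p) > 0" "p$1 \<ge> 1" "kfac (Klein p) = 1 / p$1"
    using H2_props[OF p] by auto
  have hp: "kfac (Klein p) * poisson (horo w) p = horo w (Klein p)" for w
    unfolding poisson_horo[OF p] horo_Klein[OF p] k(3) by simp
  have d: "disk_fun (poisson f) (Klein p) = kfac (Klein p) * poisson f p"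
    using H2_props[OF p] by (simp add: disk_fun_eq)
  have up: "f z \<le> horo ((c + 1 * e) *\<^sub>R axis 1 1 + (1 * C) *\<^sub>R y) z"
    and low: "horo ((c + (-1) * e) *\<^sub>R axis 1 1 + ((-1) * C) *\<^sub>R y) z \<le> f z" if "cmod z = 1" for z
    unfolding lin using le[OF that] by (simp_all add: abs_le_iff)
  have "poisson f p \<le> poisson (horo ((c + 1 * e) *\<^sub>R axis 1 1 + (1 * C) *\<^sub>R y)) p"
    by (intro poisson_mono f p continuous_on_horo_circle up)
  then have 1: "kfac (Klein p) * poisson f p \<le> c + 1 * (e + C * (1 - z0 \<bullet> Klein p))"
    unfolding lin[symmetric] hp[symmetric] using k(1) by (intro mult_left_mono) auto
  have "poisson (horo ((c + (-1) * e) *\<^sub>R axis 1 1 + ((-1) * C) *\<^sub>R y)) p \<le> poisson f p"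
    by (intro poisson_mono f p continuous_on_horo_circle low)
  then have 2: "c + (-1) * (e + C * (1 - z0 \<bullet> Klein p)) \<le> kfac (Klein p) * poisson f p"
    unfolding lin[symmetric] hp[symmetric] using k(1) by (intro mult_left_mono) auto
  show ?thesis unfolding d using 1 2 by (simp add: abs_le_iff)
qed

text \<open>The affine function \<open>1 - z0 \<bullet> z\<close> vanishes at \<open>z0\<close> and is positive on the rest of the circle, where it is
  half the squared distance to \<open>z0\<close>.\<close>

lemma continuity_modulus_affine:
  fixes f :: "complex \<Rightarrow> real"
  assumes f: "continuous_on (sphere 0 1) f" and z0: "cmod z0 = 1" and e: "e > 0"
  obtains C where "C \<ge> 0" "\<And>z. cmod z = 1 \<Longrightarrow> \<bar>f z - f z0\<bar> \<le> e + C * (1 - z0 \<bullet> z)"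
proof -
  have "bounded (f ` sphere 0 1)"
    by (intro compact_imp_bounded compact_continuous_image f compact_sphere)
  then obtain M where "\<forall>x\<in>f ` sphere 0 1. norm x \<le> M" unfolding bounded_iff by blast
  then have M: "\<bar>f z\<bar> \<le> M" if "cmod z = 1" for z using that by simp
  obtain d where d: "d > 0" "\<forall>z\<in>sphere 0 1. dist z z0 < d \<longrightarrow> dist (f z) (f z0) < e"
    using f z0 e unfolding continuous_on_iff by (metis mem_sphere_0)
  define C where "C = 4 * M / d\<^sup>2"
  have M0: "M \<ge> 0" using M[OF z0] by linarith
  show ?thesis
  proof (rule that)
    show "C \<ge> 0" using M0 by (simp add: C_def)
    fix z :: complex assume z: "cmod z = 1"
    have zz: "1 - z0 \<bullet> z = (cmod (z - z0))\<^sup>2 / 2"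
    proof -
      have "(cmod (z - z0))\<^sup>2 = (cmod z)\<^sup>2 + (cmod z0)\<^sup>2 - 2 * (z0 \<bullet> z)"
        unfolding power2_norm_eq_inner by (simp add: inner_diff_left inner_diff_right inner_commute)
      then show ?thesis by (simp add: z z0)
    qed
    show "\<bar>f z - f z0\<bar> \<le> e + C * (1 - z0 \<bullet> z)"
    proof (cases "cmod (z - z0) < d")
      case True
      have "0 \<le> C * (1 - z0 \<bullet> z)" unfolding zz using \<open>C \<ge> 0\<close> by simp
      then show ?thesis using bspec[OF d(2), of z] z True by (simp add: dist_norm)
    next
      case False
      then have "d\<^sup>2 \<le> (cmod (z - z0))\<^sup>2" using d(1) by (intro power_mono) auto
      then have "C * (d\<^sup>2 / 2) \<le> C * (1 - z0 \<bullet> z)" unfolding zz using \<open>C \<ge> 0\<close> by (intro mult_left_mono) auto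
      moreover have "C * (d\<^sup>2 / 2) = 2 * M" using d(1) by (simp add: C_def)
      ultimately show ?thesis using M[OF z] M[OF z0] e by linarith
    qed
  qed
qed

lemma continuous_lift:
  assumes "continuous_on S g" "\<And>x. x \<in> S \<Longrightarrow> cmod (g x) < 1"
  shows "continuous_on S (\<lambda>x. lift (g x))"
proof -
  have c: "cvec = (\<lambda>\<eta>. axis 1 1 + Re \<eta> *\<^sub>R axis 2 1 + Im \<eta> *\<^sub>R axis 3 1)"
    by (auto simp: fun_eq_iff vec_eq_iff forall_3 axis_def)
  show ?thesis unfolding lift_eq kfac_def c
    by (intro continuous_intros assms ballI) (use assms(2) in \<open>auto simp: abs_square_eq_1\<close>, force simp: abs_square_eq_1)
qed

lemma poisson_boundary:
  assumes f: "continuous_on (sphere 0 1) f"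
  defines "F \<equiv> \<lambda>\<eta>. if cmod \<eta> < 1 then disk_fun (poisson f) \<eta> else f \<eta>"
  shows "continuous_on (cball 0 1) F"
proof -
  have "continuous_on future_cone (poisson f \<circ> retract_H2)"
    using smooth_poisson[OF f] unfolding smooth_H2_def by (metis Ck_on.simps(1))
  then have "continuous_on (ball 0 1) (\<lambda>\<eta>. (poisson f \<circ> retract_H2) (lift \<eta>))"
    by (rule continuous_on_compose2) (auto intro!: continuous_lift continuous_intros H2_in_cone lift_in_H2)
  then have "continuous_on (ball 0 1) (\<lambda>\<eta>. kfac \<eta> * (poisson f \<circ> retract_H2) (lift \<eta>))"
    unfolding kfac_def by (intro continuous_intros)
  then have int: "continuous_on (ball 0 1) F"
    by (rule continuous_on_eq) (simp add: F_def disk_fun_eq retract_H2_id lift_in_H2)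
  have bd: "continuous (at z0 within cball 0 1) F" if z0: "cmod z0 = 1" for z0
    unfolding continuous_within Lim_within
  proof (intro allI impI)
    fix e :: real assume e: "e > 0"
    obtain C where C: "C \<ge> 0" "\<And>z. cmod z = 1 \<Longrightarrow> \<bar>f z - f z0\<bar> \<le> e/2 + C * (1 - z0 \<bullet> z)"
      using continuity_modulus_affine[OF f z0, of "e/2"] e by auto
    have *: "\<bar>F \<eta> - f z0\<bar> \<le> e/2 + C * (1 - z0 \<bullet> \<eta>)" if "cmod \<eta> \<le> 1" for \<eta>
    proof (cases "cmod \<eta> < 1")
      case True
      then show ?thesis
        using poisson_squeeze[OF z0 f lift_in_H2 C(2), of \<eta>] by (simp add: Klein_lift F_def)
    next
      case False
      then show ?thesis using C(2)[of \<eta>] that by (simp add: F_def)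
    qed
    have "((\<lambda>\<eta>. e/2 + C * (1 - z0 \<bullet> \<eta>)) \<longlongrightarrow> e/2 + C * (1 - z0 \<bullet> z0)) (at z0 within cball 0 1)"
      by (intro tendsto_intros)
    moreover have "z0 \<bullet> z0 = 1" using z0 by (simp add: norm_eq_1)
    ultimately have "((\<lambda>\<eta>. e/2 + C * (1 - z0 \<bullet> \<eta>)) \<longlongrightarrow> e/2) (at z0 within cball 0 1)" by simp
    then have "\<forall>\<^sub>F \<eta> in at z0 within cball 0 1. e/2 + C * (1 - z0 \<bullet> \<eta>) < e"
      by (rule order_tendstoD(2)) (use e in simp)
    then obtain d where "d > 0" "\<forall>\<eta>\<in>cball 0 1. \<eta> \<noteq> z0 \<and> dist \<eta> z0 < d \<longrightarrow> e/2 + C * (1 - z0 \<bullet> \<eta>) < e"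
      unfolding eventually_at by auto
    then show "\<exists>d>0. \<forall>\<eta>\<in>cball 0 1. 0 < dist \<eta> z0 \<and> dist \<eta> z0 < d \<longrightarrow> dist (F \<eta>) (F z0) < e"
      using * z0 by (intro exI[of _ d]) (force simp: dist_norm F_def)
  qed
  show ?thesis
    unfolding continuous_on_eq_continuous_within
  proof
    fix \<eta> :: complex assume "\<eta> \<in> cball 0 1"
    then consider "cmod \<eta> = 1" | "cmod \<eta> < 1" by fastforce
    then show "continuous (at \<eta> within cball 0 1) F"
    proof cases
      case 2
      then have "continuous (at \<eta>) F"
        using int by (auto simp: continuous_on_eq_continuous_at)
      then show ?thesis by (rule continuous_at_imp_continuous_at_within)
    qed (rule bd)
  qed
qed

section \<open>Uniqueness\<close>

lemma line_has_derivative: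
  fixes F :: "'a::real_normed_vector \<Rightarrow> real"
  assumes "(F has_derivative F') (at (x + t *\<^sub>R v))"
  shows "((\<lambda>s. F (x + s *\<^sub>R v)) has_real_derivative F' v) (at t)"
proof -
  have "((\<lambda>s. x + s *\<^sub>R v) has_derivative (\<lambda>s. s *\<^sub>R v)) (at t)"
    by (auto intro!: derivative_eq_intros)
  from has_derivative_compose[OF this assms]
  have "((\<lambda>s. F (x + s *\<^sub>R v)) has_derivative (\<lambda>s. F' (s *\<^sub>R v))) (at t)" .
  moreover have "(\<lambda>s. F' (s *\<^sub>R v)) = (*) (F' v)"
    using linear_cmul[OF has_derivative_linear[OF assms]] by (simp add: fun_eq_iff mult.commute)
  ultimately show ?thesis by (simp add: has_field_derivative_def)
qed

lemma second_derivative_at_max: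
  fixes g g' :: "real \<Rightarrow> real"
  assumes d: "d > 0" and g': "\<And>t. \<bar>t\<bar> < d \<Longrightarrow> (g has_real_derivative g' t) (at t)"
    and g2: "(g' has_real_derivative c) (at 0)" and max: "\<And>t. \<bar>t\<bar> < d \<Longrightarrow> g t \<le> g 0"
  shows "c \<le> 0"
proof (rule ccontr)
  assume c: "\<not> c \<le> 0"
  have "g' 0 = 0"
    by (rule DERIV_local_max[OF g'[of 0] d]) (use d max in auto)
  moreover obtain e where e: "e > 0" "\<And>h. 0 < h \<Longrightarrow> h < e \<Longrightarrow> g' 0 < g' (0 + h)"
    using DERIV_pos_inc_right[OF g2] c by auto
  ultimately have pos: "g' h > 0" if "0 < h" "h < e" for h using that by simp
  define s where "s = min d e / 2"
  have s: "0 < s" "s < d" "s < e" using d e by (auto simp: s_def)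
  obtain z where z: "0 < z" "z < s" "g s - g 0 = (s - 0) * g' z"
    using MVT2[of 0 s g g'] s g' by auto
  have "s * g' z > 0" using pos[of z] z s by simp
  then show False using z(3) max[of s] s by simp
qed

lemma D2_le_0_at_max:
  assumes W: "C2_function W" and p: "p \<in> H2" and max: "\<And>q. q \<in> H2 \<Longrightarrow> W q \<le> W p"
  shows "D2 W p v v \<le> 0"
proof -
  interpret C2_function W by (rule W)
  have "open ((\<lambda>s. p + s *\<^sub>R v) -` future_cone)"
    by (intro continuous_open_vimage open_future_cone) (intro continuous_intros)
  moreover have "0 \<in> (\<lambda>s. p + s *\<^sub>R v) -` future_cone" using H2_in_cone[OF p] by simp
  ultimately obtain d where d: "d > 0" "ball 0 d \<subseteq> (\<lambda>s. p + s *\<^sub>R v) -` future_cone"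
    using open_contains_ball by blast
  then have cone: "p + s *\<^sub>R v \<in> future_cone" if "\<bar>s\<bar> < d" for s
    using that by (auto simp: subset_iff dist_norm)
  show ?thesis
  proof (rule second_derivative_at_max[OF d(1)])
    fix t :: real assume t: "\<bar>t\<bar> < d"
    show "((\<lambda>s. (W \<circ> retract_H2) (p + s *\<^sub>R v)) has_real_derivative D1 W (p + t *\<^sub>R v) v) (at t)"
      by (rule line_has_derivative[OF D1_has_derivative[OF cone[OF t]]])
    show "(W \<circ> retract_H2) (p + t *\<^sub>R v) \<le> (W \<circ> retract_H2) (p + 0 *\<^sub>R v)"
      using max[OF retract_H2_in[OF cone[OF t]]] by (simp add: retract_H2_id[OF p])
  next
    show "((\<lambda>s. D1 W (p + s *\<^sub>R v) v) has_real_derivative D2 W p v v) (at 0)"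
      by (rule line_has_derivative[of "\<lambda>x. D1 W x v" "\<lambda>w. D2 W p w v"]) (simp add: D2_has_derivative[OF H2_in_cone[OF p]])
  qed
qed

lemma C2_lincomb:
  assumes u: "C2_function u" and w: "C2_function w"
  shows "C2_function (\<lambda>p. u p + c * w p)"
    and "x \<in> future_cone \<Longrightarrow> D2 (\<lambda>p. u p + c * w p) x v v' = D2 u x v v' + c * D2 w x v v'"
proof -
  interpret u: C2_function u by (rule u)
  interpret w: C2_function w by (rule w)
  have "Ck_on 2 (\<lambda>x. (u \<circ> retract_H2) x + c * (w \<circ> retract_H2) x) future_cone"
    by (intro Ck_on_add Ck_on_mult Ck_on_const open_future_cone u.C2 w.C2)
  then show C: "C2_function (\<lambda>p. u p + c * w p)" by (simp add: C2_function_def o_def)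
  interpret uw: C2_function "\<lambda>p. u p + c * w p" by (rule C)
  assume x: "x \<in> future_cone"
  have D1: "D1 (\<lambda>p. u p + c * w p) x v = D1 u x v + c * D1 w x v" if x: "x \<in> future_cone" for x v
  proof -
    have "((\<lambda>x. (u \<circ> retract_H2) x + c * (w \<circ> retract_H2) x) has_derivative (\<lambda>v. D1 u x v + c * D1 w x v)) (at x)"
      by (intro has_derivative_add has_derivative_mult_right u.D1_has_derivative w.D1_has_derivative x)
    from has_derivative_unique[OF _ this]
    have *: "((\<lambda>x. (u \<circ> retract_H2) x + c * (w \<circ> retract_H2) x) has_derivative D) (at x) \<Longrightarrow> D = (\<lambda>v. D1 u x v + c * D1 w x v)" for D .
    have "((\<lambda>x. (u \<circ> retract_H2) x + c * (w \<circ> retract_H2) x) has_derivative D1 (\<lambda>p. u p + c * w p) x) (at x)"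
      using uw.D1_has_derivative[OF x] by (simp add: o_def)
    from *[OF this] show ?thesis by simp
  qed
  have "((\<lambda>x. D1 u x v' + c * D1 w x v') has_derivative (\<lambda>v. D2 u x v v' + c * D2 w x v v')) (at x)"
    by (intro has_derivative_add has_derivative_mult_right u.D2_has_derivative w.D2_has_derivative x)
  from has_derivative_transform_within_open[OF this open_future_cone x D1[symmetric]]
  have "((\<lambda>x. D1 (\<lambda>p. u p + c * w p) x v') has_derivative (\<lambda>v. D2 u x v v' + c * D2 w x v v')) (at x)" .
  from fun_cong[OF has_derivative_unique[OF uw.D2_has_derivative[OF x] this], of v]
  show "D2 (\<lambda>p. u p + c * w p) x v v' = D2 u x v v' + c * D2 w x v v'" .
qed

lemma C2_const: "C2_function (\<lambda>_. c)" and D2_const: "D2 (\<lambda>_. c) x v w = 0"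
  by (auto simp: C2_function_def o_def D2_def D1_def intro!: Ck_on_const open_future_cone)

text \<open>Maximum principle. If \<open>v1 - v2\<close> were positive somewhere, its quotient by \<open>p$1 + 1\<close> would have a positive
  maximum \<open>M\<close>, attained in the interior because the rescaled difference vanishes on the circle. There
  \<open>W = v1 - v2 - M (p$1 + 1)\<close> has a maximum with value \<open>0\<close>, so \<open>\<Delta> W \<le> 0\<close>; but
  \<open>\<Delta> W = 2 (v1 - v2 - M p$1) = 2 M\<close>.\<close>

lemma harmonic_extension_le:
  assumes 1: "harmonic_extension X v1" and 2: "harmonic_extension X v2" and q: "q \<in> H2"
  shows "v1 q \<le> v2 q"
proof (rule ccontr)
  assume neg: "\<not> v1 q \<le> v2 q"
  obtain F1 where F1: "continuous_on (cball 0 1) F1" "\<And>\<eta>. cmod \<eta> < 1 \<Longrightarrow> F1 \<eta> = disk_fun v1 \<eta>"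
    "\<And>z. cmod z = 1 \<Longrightarrow> F1 z = supp_fun X z"
    using 1 unfolding harmonic_extension_def by (metis mem_ball_0 mem_sphere_0)
  obtain F2 where F2: "continuous_on (cball 0 1) F2" "\<And>\<eta>. cmod \<eta> < 1 \<Longrightarrow> F2 \<eta> = disk_fun v2 \<eta>"
    "\<And>z. cmod z = 1 \<Longrightarrow> F2 z = supp_fun X z"
    using 2 unfolding harmonic_extension_def by (metis mem_ball_0 mem_sphere_0)
  have C: "C2_function v1" "C2_function v2"
    using 1 2 by (auto simp: harmonic_extension_def smooth_H2_def C2_function_def)
  define K where "K = (\<lambda>\<eta>. (F1 \<eta> - F2 \<eta>) / (1 + kfac \<eta>))"
  have "continuous_on (cball 0 1) K"
    unfolding K_def kfac_def
    by (intro continuous_intros F1(1) F2(1)) (auto simp: power_le_one add_nonneg_eq_0_iff)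
  then obtain \<eta> where \<eta>: "cmod \<eta> \<le> 1" "\<And>\<zeta>. cmod \<zeta> \<le> 1 \<Longrightarrow> K \<zeta> \<le> K \<eta>"
    using continuous_attains_sup[of "cball 0 1" K] by auto
  define M where "M = K \<eta>"
  \<comment> \<open>\<open>h\<close> is the first coordinate \<open>p$1\<close>; \<open>h + 1\<close> is a strict supersolution.\<close>
  define h where "h = poisson (horo (axis 1 1))"
  have hC: "C2_function h" unfolding h_def by (rule C2_poisson[OF continuous_on_horo_circle])
  have h: "h p = p$1" if "p \<in> H2" for p
    unfolding h_def poisson_horo[OF that] by (simp add: mink_def axis_def)
  have K: "K (Klein p) = (v1 p - v2 p) / (h p + 1)" if p: "p \<in> H2" for p
  proof -
    have "K (Klein p) = (1 / p$1 * v1 p - 1 / p$1 * v2 p) / (1 + 1 / p$1)"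
      using H2_props(2)[OF p] by (simp add: K_def F1 F2 disk_fun_eq H2_props(3,4)[OF p])
    also have "\<dots> = ((v1 p - v2 p) / p$1) / ((p$1 + 1) / p$1)"
      using H2_props(1)[OF p] by (simp add: diff_divide_distrib add_divide_distrib add.commute)
    also have "\<dots> = (v1 p - v2 p) / (h p + 1)"
      using H2_props(1)[OF p] by (simp add: h[OF p])
    finally show ?thesis .
  qed
  have "0 < (v1 q - v2 q) / (h q + 1)" using neg h[OF q] H2_props(1)[OF q] by (intro divide_pos_pos) auto
  also have "\<dots> \<le> M" unfolding M_def K[OF q, symmetric] using H2_props(2)[OF q] by (intro \<eta>(2)) simp
  finally have M: "M > 0" .
  have "cmod \<eta> \<noteq> 1" using M F1(3) F2(3) by (auto simp: M_def K_def)
  then have \<eta>1: "cmod \<eta> < 1" using \<eta>(1) by simp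
  define p where "p = lift \<eta>"
  have p: "p \<in> H2" and Kp: "Klein p = \<eta>" unfolding p_def using \<eta>1 by (auto intro: lift_in_H2 Klein_lift)
  define W where "W = (\<lambda>p. ((v1 p + (-1) * v2 p) + (- M) * h p) + (- M) * 1)"
  have Wle: "W r \<le> 0" if r: "r \<in> H2" for r
  proof -
    have "(v1 r - v2 r) / (h r + 1) \<le> M"
      unfolding M_def K[OF r, symmetric] using H2_props(2)[OF r] by (intro \<eta>(2)) simp
    then show ?thesis using h[OF r] H2_props(1)[OF r] by (simp add: W_def field_simps)
  qed
  have Wp: "W p = 0"
    using K[OF p] h[OF p] H2_props(1)[OF p] by (simp add: W_def M_def Kp field_simps)
  have WC: "C2_function W" unfolding W_def by (intro C2_lincomb C C2_const hC)
  obtain t b where t: "0 \<le> t" "t < 1" and pt: "p = hpt t b" using hpt_exists[OF p] .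
  note pc = H2_in_cone[OF p]
  have D2W: "D2 W p v v = D2 v1 p v v - D2 v2 p v v - M * D2 h p v v" for v
    unfolding W_def by (simp only: C2_lincomb C C2_const hC pc D2_const)
  have "D2 W p v v \<le> 0" for v
    by (rule D2_le_0_at_max[OF WC p]) (simp add: Wp Wle)
  then have "D2 W p (radial t b) (radial t b) + D2 W p (angular b) (angular b) \<le> 0"
    by (simp add: add_nonpos_nonpos)
  then have "Laplace v1 p - Laplace v2 p - M * Laplace h p \<le> 0"
    unfolding pt D2W[unfolded pt] C2_function.Laplace_eq[OF C(1) t] C2_function.Laplace_eq[OF C(2) t] C2_function.Laplace_eq[OF hC t]
    by (simp add: algebra_simps)
  moreover have "Laplace v1 p = 2 * v1 p" "Laplace v2 p = 2 * v2 p"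
    using 1 2 p by (auto simp: harmonic_extension_def)
  moreover have "Laplace h p = 2 * h p"
    unfolding h_def by (rule Laplace_poisson[OF p continuous_on_horo_circle])
  ultimately have "2 * (v1 p - v2 p - M * h p) \<le> 0" by (simp add: algebra_simps)
  moreover have "v1 p - v2 p - M * h p = M" using Wp by (simp add: W_def)
  ultimately show False using M by simp
qed

section \<open>The support function\<close>

lemma supp_fun_props:
  assumes X: "continuous_circle_field X"
  shows "continuous_on (sphere 0 1) (supp_fun X)"
    and "cmod z = 1 \<Longrightarrow> X z = \<i> * z * of_real (supp_fun X z)"
proof -
  have eq: "supp_fun X z = Im (X z * cnj z)" and X_eq: "X z = \<i> * z * of_real (Im (X z * cnj z))" if z: "cmod z = 1" for z
  proof -
    have zz: "cnj z * z = 1" using z by (simp add: complex_norm_square[symmetric] mult.commute)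
    have "Re (X z * cnj z) = 0"
      using X z by (simp add: continuous_circle_field_def inner_complex_def)
    then have "X z * cnj z = \<i> * of_real (Im (X z * cnj z))" by (simp add: complex_eq_iff)
    then have "X z * (cnj z * z) = \<i> * of_real (Im (X z * cnj z)) * z" by (simp flip: mult.assoc)
    then show *: "X z = \<i> * z * of_real (Im (X z * cnj z))" unfolding zz by (simp add: mult_ac)
    have "z \<noteq> 0" using z by auto
    then show "supp_fun X z = Im (X z * cnj z)"
      unfolding supp_fun_def
      by (intro the_equality) (use * in simp, subst (asm) *, simp del: times_complex.sel)
  qed
  show "cmod z = 1 \<Longrightarrow> X z = \<i> * z * of_real (supp_fun X z)" using eq X_eq by metis
  have "continuous_on (sphere 0 1) (\<lambda>z. Im (X z * cnj z))"
    using X unfolding continuous_circle_field_def by (auto intro!: continuous_intros)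
  then show "continuous_on (sphere 0 1) (supp_fun X)"
    by (rule continuous_on_eq) (simp add: eq)
qed

lemma u_of_eq:
  assumes X: "continuous_circle_field X"
  shows "u_of X = poisson (supp_fun X)"
proof -
  note f = supp_fun_props(1)[OF X]
  have h: "harmonic_extension X (poisson (supp_fun X))"
    unfolding harmonic_extension_def
    using smooth_poisson[OF f] Laplace_poisson[OF _ f] poisson_boundary[OF f] by auto
  have e: "poisson (supp_fun X) \<in> extensional H2" by (simp add: poisson_def)
  show ?thesis unfolding u_of_def
  proof (rule the_equality)
    fix u assume u: "u \<in> extensional H2 \<and> harmonic_extension X u"
    show "u = poisson (supp_fun X)"
      by (rule extensionalityI[of _ H2]) (use u e h harmonic_extension_le in \<open>auto intro!: antisym\<close>)
  qed (use h e in simp)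
qed

section \<open>Affine minorants and the width\<close>

text \<open>The largest convex function on the disk with boundary values at most \<open>f\<close>; it is \<open>\<phi>\<^sup>-\<close> for the support function \<open>f\<close>. The upper
  function \<open>\<phi>\<^sup>+\<close> is obtained from \<open>- f\<close> (\<open>phi_plus_eq\<close>), so that every estimate is needed only once.\<close>

definition cvx_env :: "(complex \<Rightarrow> real) \<Rightarrow> complex \<Rightarrow> real" where
  "cvx_env f \<eta> = Sup {a \<eta> | a. affine_fun a \<and> (\<forall>w\<in>sphere 0 1. a w \<le> f w)}"

definition width_of :: "(complex \<Rightarrow> real) \<Rightarrow> complex \<Rightarrow> real" where
  "width_of f \<eta> = (- cvx_env (\<lambda>z. - f z) \<eta> - cvx_env f \<eta>) / kfac \<eta>"

lemma affine_fun_uminus: "affine_fun a \<Longrightarrow> affine_fun (\<lambda>z. - a z)"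
proof -
  assume "affine_fun a"
  then obtain L c where L: "linear L" "a = (\<lambda>z. L z + c)" by (auto simp: affine_fun_def)
  have "linear (\<lambda>z. - L z)" using L(1) by (rule linear_compose_neg)
  moreover have "(\<lambda>z. - a z) = (\<lambda>z. - L z + - c)" by (simp add: L(2))
  ultimately show ?thesis unfolding affine_fun_def by blast
qed

lemma phi_minus_eq: "phi_minus X = cvx_env (supp_fun X)"
  by (simp add: fun_eq_iff phi_minus_def cvx_env_def)

lemma phi_plus_eq: "phi_plus X \<eta> = - cvx_env (\<lambda>z. - supp_fun X z) \<eta>"
proof -
  have "uminus ` {a \<eta> | a. affine_fun a \<and> (\<forall>w\<in>sphere 0 1. supp_fun X w \<le> a w)}
      = {a \<eta> | a. affine_fun a \<and> (\<forall>w\<in>sphere 0 1. a w \<le> - supp_fun X w)}" (is "?A = ?B")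
  proof
    show "?A \<subseteq> ?B"
    proof
      fix r assume "r \<in> ?A"
      then obtain a where a: "affine_fun a" "\<forall>w\<in>sphere 0 1. supp_fun X w \<le> a w" "r = - a \<eta>" by auto
      then show "r \<in> ?B"
        by (intro CollectI exI[of _ "\<lambda>z. - a z"] conjI ballI affine_fun_uminus) auto
    qed
    show "?B \<subseteq> ?A"
    proof
      fix r assume "r \<in> ?B"
      then obtain a where a: "affine_fun a" "\<forall>w\<in>sphere 0 1. a w \<le> - supp_fun X w" "r = a \<eta>" by auto
      then have "- r \<in> {a \<eta> | a. affine_fun a \<and> (\<forall>w\<in>sphere 0 1. supp_fun X w \<le> a w)}"
        by (intro CollectI exI[of _ "\<lambda>z. - a z"] conjI ballI affine_fun_uminus) (auto simp: le_minus_iff)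
      from imageI[OF this, of uminus] show "r \<in> ?A" by simp
    qed
  qed
  then show ?thesis by (simp add: phi_plus_def cvx_env_def Inf_real_def)
qed

lemma width_eq: "width X = width_of (supp_fun X)"
  by (simp add: fun_eq_iff width_def width_of_def phi_plus_eq phi_minus_eq kfac_def)

text \<open>A point of the disk lies between the two ends of its diameter.\<close>

lemma affine_le_on_disk:
  assumes "affine_fun a" "\<And>w. cmod w = 1 \<Longrightarrow> a w \<le> M" "cmod \<eta> \<le> 1"
  shows "a \<eta> \<le> M"
proof -
  obtain L c where L: "linear L" "a = (\<lambda>z. L z + c)" using assms(1) by (auto simp: affine_fun_def)
  define r where "r = cmod \<eta>"
  obtain z where z: "cmod z = 1" "\<eta> = r *\<^sub>R z"
  proof (cases "\<eta> = 0")
    case True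
    then show ?thesis using that[of 1] by (simp add: r_def)
  next
    case False
    then show ?thesis using that[of "sgn \<eta>"] by (simp add: r_def norm_sgn sgn_div_norm)
  qed
  have "a \<eta> = (1 + r) / 2 * a z + (1 - r) / 2 * a (- z)"
    unfolding L(2) z(2) by (simp add: linear_cmul[OF L(1)] linear_neg[OF L(1)] field_simps)
  also have "\<dots> \<le> (1 + r) / 2 * M + (1 - r) / 2 * M"
    using assms(2)[of z] assms(2)[of "- z"] assms(3) z(1)
    by (intro add_mono mult_left_mono) (auto simp: r_def)
  finally show ?thesis by (simp add: field_simps)
qed

lemma circle_bounded:
  fixes f :: "complex \<Rightarrow> real"
  assumes "continuous_on (sphere 0 1) f"
  obtains M where "M \<ge> 0" "\<And>z. cmod z = 1 \<Longrightarrow> \<bar>f z\<bar> \<le> M"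
proof -
  have "bounded (f ` sphere 0 1)"
    by (intro compact_imp_bounded compact_continuous_image assms compact_sphere)
  then obtain M where "\<forall>x\<in>f ` sphere 0 1. norm x \<le> M" unfolding bounded_iff by blast
  then have M: "\<bar>f z\<bar> \<le> M" if "cmod z = 1" for z using that by simp
  moreover have "M \<ge> 0" using M[of 1] by simp
  ultimately show ?thesis using that by blast
qed

lemma affine_const: "affine_fun (\<lambda>_. c)"
  unfolding affine_fun_def by (rule exI[of _ "\<lambda>_. 0"]) (auto intro: linearI)

context
  fixes f :: "complex \<Rightarrow> real" and \<eta> :: complex
  assumes f: "continuous_on (sphere 0 1) f" and \<eta>: "cmod \<eta> \<le> 1"
begin

lemma cvx_env_upper:
  assumes "affine_fun a" "\<And>w. cmod w = 1 \<Longrightarrow> a w \<le> f w"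
  shows "a \<eta> \<le> cvx_env f \<eta>"
proof -
  obtain M where M: "\<And>z. cmod z = 1 \<Longrightarrow> \<bar>f z\<bar> \<le> M" using circle_bounded[OF f] by blast
  show ?thesis unfolding cvx_env_def
  proof (rule cSup_upper)
    show "bdd_above {a \<eta> |a. affine_fun a \<and> (\<forall>w\<in>sphere 0 1. a w \<le> f w)}"
    proof (rule bdd_aboveI[of _ M])
      fix r assume "r \<in> {a \<eta> |a. affine_fun a \<and> (\<forall>w\<in>sphere 0 1. a w \<le> f w)}"
      then obtain a where a: "affine_fun a" "\<forall>w\<in>sphere 0 1. a w \<le> f w" "r = a \<eta>" by auto
      show "r \<le> M" unfolding a(3)
      proof (rule affine_le_on_disk[OF a(1) _ \<eta>])
        fix w :: complex assume w: "cmod w = 1"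
        have "a w \<le> f w" using a(2) w by simp
        then show "a w \<le> M" using M[OF w] by linarith
      qed
    qed
  qed (use assms in auto)
qed

lemma cvx_env_le:
  assumes "\<And>a. affine_fun a \<Longrightarrow> (\<And>w. cmod w = 1 \<Longrightarrow> a w \<le> f w) \<Longrightarrow> a \<eta> \<le> M"
  shows "cvx_env f \<eta> \<le> M"
  unfolding cvx_env_def
proof (rule cSup_least)
  obtain K where K: "\<And>z. cmod z = 1 \<Longrightarrow> \<bar>f z\<bar> \<le> K" using circle_bounded[OF f] by blast
  have "- K \<in> {a \<eta> |a. affine_fun a \<and> (\<forall>w\<in>sphere 0 1. a w \<le> f w)}"
    using K by (intro CollectI exI[of _ "\<lambda>_. - K"]) (force simp: affine_const abs_le_iff)
  then show "{a \<eta> |a. affine_fun a \<and> (\<forall>w\<in>sphere 0 1. a w \<le> f w)} \<noteq> {}" by blast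
qed (use assms in auto)

lemma cvx_env_approx:
  assumes "e > 0"
  obtains a where "affine_fun a" "\<And>w. cmod w = 1 \<Longrightarrow> a w \<le> f w" "cvx_env f \<eta> - e < a \<eta>"
proof (rule ccontr)
  assume *: "\<not> thesis"
  have "cvx_env f \<eta> \<le> cvx_env f \<eta> - e"
  proof (rule cvx_env_le)
    fix a assume "affine_fun a" "\<And>w. cmod w = 1 \<Longrightarrow> a w \<le> f w"
    then show "a \<eta> \<le> cvx_env f \<eta> - e" using * that not_le by blast
  qed
  then show False using assms by simp
qed

end

section \<open>The width bounds the traceless Hessian\<close>

text \<open>For a linear form \<open>Phi\<close> is a combination of \<open>1\<close>, \<open>cos \<alpha>\<close> and \<open>sin \<alpha>\<close>, which are orthogonal to the
  second harmonics.\<close>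

lemma Phi_linear_integral:
  assumes t: "0 \<le> t" "t < 1"
  shows "integral {0..2*pi} (\<lambda>\<alpha>. Phi (horo y) t b \<alpha> * cos (2 * \<alpha>)) = 0"
    and "integral {0..2*pi} (\<lambda>\<alpha>. Phi (horo y) t b \<alpha> * sin (2 * \<alpha>)) = 0"
proof -
  define A B C where "A = - mink y (hpt t b)" and "B = mink y (radial t b)" and "C = mink y (angular b)"
  have P: "Phi (horo y) t b \<alpha> = A - B * cos \<alpha> - C * sin \<alpha>" for \<alpha>
    by (simp add: Phi_def lam_horo[OF t] A_def B_def C_def)
  have c: "((\<lambda>\<alpha>. cos (real (Suc k) * \<alpha>)) has_integral 0) {0..2*pi}"
    and s: "((\<lambda>\<alpha>. sin (real (Suc k) * \<alpha>)) has_integral 0) {0..2*pi}" for k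
    using has_integral_trig by auto
  have T: "cos \<alpha> * cos (2 * \<alpha>) = (cos (3 * \<alpha>) + cos \<alpha>) / 2"
    "sin \<alpha> * cos (2 * \<alpha>) = (sin (3 * \<alpha>) - sin \<alpha>) / 2"
    "cos \<alpha> * sin (2 * \<alpha>) = (sin (3 * \<alpha>) + sin \<alpha>) / 2"
    "sin \<alpha> * sin (2 * \<alpha>) = (cos \<alpha> - cos (3 * \<alpha>)) / 2" for \<alpha> :: real
    using cos_add[of "2*\<alpha>" \<alpha>] cos_diff[of "2*\<alpha>" \<alpha>] sin_add[of "2*\<alpha>" \<alpha>] sin_diff[of "2*\<alpha>" \<alpha>]
    by (simp_all add: mult.commute)
  have "(A - B * cos \<alpha> - C * sin \<alpha>) * cos (2 * \<alpha>)
      = A * cos (2 * \<alpha>) - (B/2) * (cos (3 * \<alpha>) + cos \<alpha>) - (C/2) * (sin (3 * \<alpha>) - sin \<alpha>)"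
    "(A - B * cos \<alpha> - C * sin \<alpha>) * sin (2 * \<alpha>)
      = A * sin (2 * \<alpha>) - (B/2) * (sin (3 * \<alpha>) + sin \<alpha>) - (C/2) * (cos \<alpha> - cos (3 * \<alpha>))" for \<alpha>
    by (simp_all only: left_diff_distrib mult.assoc T)
  then have e: "(\<lambda>\<alpha>. Phi (horo y) t b \<alpha> * cos (2 * \<alpha>))
      = (\<lambda>\<alpha>. A * cos (2 * \<alpha>) - (B/2) * (cos (3 * \<alpha>) + cos \<alpha>) - (C/2) * (sin (3 * \<alpha>) - sin \<alpha>))"
    "(\<lambda>\<alpha>. Phi (horo y) t b \<alpha> * sin (2 * \<alpha>))
      = (\<lambda>\<alpha>. A * sin (2 * \<alpha>) - (B/2) * (sin (3 * \<alpha>) + sin \<alpha>) - (C/2) * (cos \<alpha> - cos (3 * \<alpha>)))"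
    by (simp_all only: P)
  have "((\<lambda>\<alpha>. Phi (horo y) t b \<alpha> * cos (2 * \<alpha>)) has_integral A * 0 - (B/2) * (0 + 0) - (C/2) * (0 - 0)) {0..2*pi}"
    unfolding e using c[of 0] c[of 1] c[of 2] s[of 0] s[of 2]
    by (intro has_integral_diff has_integral_add has_integral_mult_right) simp_all
  then show "integral {0..2*pi} (\<lambda>\<alpha>. Phi (horo y) t b \<alpha> * cos (2 * \<alpha>)) = 0" by (simp add: has_integral_iff)
  have "((\<lambda>\<alpha>. Phi (horo y) t b \<alpha> * sin (2 * \<alpha>)) has_integral A * 0 - (B/2) * (0 + 0) - (C/2) * (0 - 0)) {0..2*pi}"
    unfolding e using c[of 0] c[of 2] s[of 0] s[of 1] s[of 2]
    by (intro has_integral_diff has_integral_add has_integral_mult_right) simp_all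
  then show "integral {0..2*pi} (\<lambda>\<alpha>. Phi (horo y) t b \<alpha> * sin (2 * \<alpha>)) = 0" by (simp add: has_integral_iff)
qed

text \<open>Take affine \<open>a \<le> f \<le> a'\<close>. Testing against \<open>k\<close> does not see \<open>a\<close>, so the integral is at most that of
  \<open>Phi (f - a)\<close> and hence of \<open>Phi (a' - a)\<close>, which is \<open>2 pi / kfac\<close> times the value of \<open>a' - a\<close> at the
  Klein coordinate of the point. Near-optimal \<open>a\<close> and \<open>a'\<close> give the width.\<close>

lemma Phi_trig_le_width:
  assumes t: "0 \<le> t" "t < 1" and f: "continuous_on (sphere 0 1) f"
    and k: "continuous_on UNIV k" "\<And>\<alpha>. \<bar>k \<alpha>\<bar> \<le> 1" "\<And>y. integral {0..2*pi} (\<lambda>\<alpha>. Phi (horo y) t b \<alpha> * k \<alpha>) = 0"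
  shows "\<bar>integral {0..2*pi} (\<lambda>\<alpha>. Phi f t b \<alpha> * k \<alpha>)\<bar>
    \<le> 2 * pi * width_of f (Klein (hpt t b))"
    (is "?I \<le> 2 * pi * width_of f ?\<eta>")
proof -
  let ?W = "- cvx_env (\<lambda>z. - f z) ?\<eta> - cvx_env f ?\<eta>"
  have p: "hpt t b \<in> H2" by (rule hpt_in_H2[OF t])
  note P = H2_props[OF p]
  have \<eta>: "cmod ?\<eta> \<le> 1" and kf: "kfac ?\<eta> > 0" using P kfac_pos by auto
  have f': "continuous_on (sphere 0 1) (\<lambda>z. - f z)" by (intro continuous_intros f)
  have "?I \<le> 2 * pi * ((?W + e) / kfac ?\<eta>)" if e: "e > 0" for e
  proof -
    obtain a where a: "affine_fun a" "\<And>w. cmod w = 1 \<Longrightarrow> a w \<le> f w" "cvx_env f ?\<eta> - e/2 < a ?\<eta>"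
      using cvx_env_approx[OF f \<eta>, of "e/2"] e by auto
    obtain a' where a': "affine_fun a'" "\<And>w. cmod w = 1 \<Longrightarrow> a' w \<le> - f w" "cvx_env (\<lambda>z. - f z) ?\<eta> - e/2 < a' ?\<eta>"
      using cvx_env_approx[OF f' \<eta>, of "e/2"] e by auto
    obtain y where y: "a = horo y" using a(1) affine_fun_iff by auto
    obtain x where x: "(\<lambda>z. - a' z) = horo x" using affine_fun_uminus[OF a'(1)] affine_fun_iff by auto
    have x': "a' z = - horo x z" for z using fun_cong[OF x, of z] by simp
    have hc: "continuous_on (sphere 0 1) (horo w)" for w by (rule continuous_on_horo_circle)
    have int: "Phi g t b integrable_on {0..2*pi}" if "continuous_on (sphere 0 1) g" for g
      using Phi_trig_integrable[OF t that continuous_on_const, of b 1] by simp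
    have "integral {0..2*pi} (\<lambda>\<alpha>. Phi f t b \<alpha> * k \<alpha>)
        = integral {0..2*pi} (\<lambda>\<alpha>. Phi f t b \<alpha> * k \<alpha>) - integral {0..2*pi} (\<lambda>\<alpha>. Phi (horo y) t b \<alpha> * k \<alpha>)"
      by (simp add: k(3))
    also have "\<dots> = integral {0..2*pi} (\<lambda>\<alpha>. Phi f t b \<alpha> * k \<alpha> - Phi (horo y) t b \<alpha> * k \<alpha>)"
      by (intro integral_diff[symmetric] Phi_trig_integrable t f hc k)
    finally have "?I = norm (integral {0..2*pi} (\<lambda>\<alpha>. Phi f t b \<alpha> * k \<alpha> - Phi (horo y) t b \<alpha> * k \<alpha>))" by simp
    also have "\<dots> \<le> integral {0..2*pi} (\<lambda>\<alpha>. Phi (horo x) t b \<alpha> - Phi (horo y) t b \<alpha>)"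
    proof (rule integral_norm_bound_integral)
      show "(\<lambda>\<alpha>. Phi f t b \<alpha> * k \<alpha> - Phi (horo y) t b \<alpha> * k \<alpha>) integrable_on {0..2 * pi}"
        by (intro integrable_diff Phi_trig_integrable t f hc k)
      show "(\<lambda>\<alpha>. Phi (horo x) t b \<alpha> - Phi (horo y) t b \<alpha>) integrable_on {0..2 * pi}"
        by (intro integrable_diff int hc)
      fix \<alpha>
      define z where "z = cis (vis t b \<alpha>)"
      have l: "lam t \<alpha> > 0" by (rule lam_pos[OF t])
      have ge: "horo y z \<le> f z" "f z \<le> horo x z" using a(2)[of z] a'(2)[of z] by (simp_all add: z_def y x')
      have "norm (Phi f t b \<alpha> * k \<alpha> - Phi (horo y) t b \<alpha> * k \<alpha>) = lam t \<alpha> * (f z - horo y z) * \<bar>k \<alpha>\<bar>"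
        using l ge by (simp add: Phi_def z_def[symmetric] abs_mult flip: left_diff_distrib right_diff_distrib)
      also have "\<dots> \<le> lam t \<alpha> * (f z - horo y z) * 1"
        using l ge k(2) by (intro mult_left_mono) auto
      also have "\<dots> \<le> lam t \<alpha> * (horo x z - horo y z)"
        using l ge by simp
      finally show "norm (Phi f t b \<alpha> * k \<alpha> - Phi (horo y) t b \<alpha> * k \<alpha>) \<le> Phi (horo x) t b \<alpha> - Phi (horo y) t b \<alpha>"
        by (simp add: Phi_def z_def right_diff_distrib)
    qed
    also have "\<dots> = integral {0..2*pi} (Phi (horo x) t b) - integral {0..2*pi} (Phi (horo y) t b)"
      by (intro integral_diff int hc)
    also have "\<dots> = 2 * pi * (poisson (horo x) (hpt t b) - poisson (horo y) (hpt t b))"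
      by (simp add: poisson_vis[OF t hc] field_simps)
    also have "poisson (horo x) (hpt t b) - poisson (horo y) (hpt t b) = (horo x ?\<eta> - horo y ?\<eta>) / kfac ?\<eta>"
      using P(1) by (simp add: poisson_horo[OF p] horo_Klein[OF p] P(3) field_simps)
    also have "2 * pi * \<dots> \<le> 2 * pi * ((?W + e) / kfac ?\<eta>)"
      using a(3) a'(3) kf by (intro mult_left_mono divide_right_mono) (simp_all add: y x')
    finally show ?thesis .
  qed
  then have *: "?I * kfac ?\<eta> / (2 * pi) - ?W \<le> e" if "e > 0" for e
  proof -
    have "?I * kfac ?\<eta> \<le> 2 * pi * ((?W + e) / kfac ?\<eta>) * kfac ?\<eta>"
      using \<open>\<And>e. e > 0 \<Longrightarrow> ?I \<le> 2 * pi * ((?W + e) / kfac ?\<eta>)\<close>[OF that] kf by (intro mult_right_mono) auto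
    also have "\<dots> = (?W + e) * (2 * pi)" using kf by simp
    finally have "?I * kfac ?\<eta> / (2 * pi) \<le> ?W + e" by (simp only: pos_divide_le_eq[OF mult_pos_pos[OF zero_less_numeral pi_gt_zero]])
    then show ?thesis by linarith
  qed
  have "?I * kfac ?\<eta> / (2 * pi) - ?W \<le> 0" by (rule field_le_epsilon) (simp add: *)
  then have "?I * kfac ?\<eta> \<le> ?W * (2 * pi)"
    by (simp only: diff_le_0_iff_le pos_divide_le_eq[OF mult_pos_pos[OF zero_less_numeral pi_gt_zero]])
  then have "?I \<le> ?W * (2 * pi) / kfac ?\<eta>" by (simp only: pos_le_divide_eq[OF kf])
  then show ?thesis by (simp add: width_of_def mult.commute)
qed

text \<open>For the support function \<open>f\<close> of \<open>X\<close> this is the norm of the \<open>\<partial>\<close>-bar derivative of \<open>HL X\<close>. The name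
  refers to the tracefree Hessian, of which it is the norm.\<close>

definition tracefree :: "(complex \<Rightarrow> real) \<Rightarrow> real^3 \<Rightarrow> real" where
  "tracefree f p = tangent_onorm p (dbar (\<lambda>q. hJ q (grad (poisson f) q)) p)"

lemma tracefree_le_width:
  assumes f: "continuous_on (sphere 0 1) f" and p: "p \<in> H2"
  shows "tracefree f p \<le> 6 * width_of f (Klein p)"
    (is "_ \<le> 6 * ?w")
proof -
  obtain t b where t: "0 \<le> t" "t < 1" and pt: "p = hpt t b" using hpt_exists[OF p] .
  define A B where "A = integral {0..2*pi} (\<lambda>\<alpha>. Phi f t b \<alpha> * cos (2 * \<alpha>))"
    and "B = integral {0..2*pi} (\<lambda>\<alpha>. Phi f t b \<alpha> * sin (2 * \<alpha>))"
  have "\<bar>A\<bar> \<le> 2 * pi * ?w"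
    unfolding A_def pt by (rule Phi_trig_le_width[OF t f]) (auto intro!: continuous_intros Phi_linear_integral[OF t])
  moreover have "\<bar>B\<bar> \<le> 2 * pi * ?w"
    unfolding B_def pt by (rule Phi_trig_le_width[OF t f]) (auto intro!: continuous_intros Phi_linear_integral[OF t])
  moreover have "sqrt (A\<^sup>2 + B\<^sup>2) \<le> \<bar>A\<bar> + \<bar>B\<bar>" by (rule sqrt_sum_squares_le_sum_abs)
  ultimately have "3 / (2 * pi) * sqrt (A\<^sup>2 + B\<^sup>2) \<le> 3 / (2 * pi) * (4 * pi * ?w)"
    by (intro mult_left_mono) auto
  also have "3 / (2 * pi) * (4 * pi * w) = 6 * w" for w by simp
  finally show ?thesis unfolding tracefree_def pt tangent_onorm_poisson[OF t f] A_def B_def .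
qed

section \<open>Convexity along chords\<close>

lemma D2_tracefree_bound:
  assumes f: "continuous_on (sphere 0 1) f" and p: "p \<in> H2" and w: "w \<in> tangent p"
  shows "\<bar>D2 (poisson f) p w w - poisson f p * mink w w\<bar> \<le> tracefree f p * mink w w"
proof -
  obtain t b where t: "0 \<le> t" "t < 1" and pt: "p = hpt t b" using hpt_exists[OF p] .
  interpret C2_function "poisson f" by (rule C2_poisson[OF f])
  define e g where "e = radial t b" and "g = angular b"
  note pc = H2_in_cone[OF p]
  have fm: "mink e e = 1" "mink g g = 1" "mink e g = 0" "mink g e = 0"
    using frame_mink[OF t, of b] by (simp_all add: e_def g_def mink_commute)
  obtain a c where ac: "w = a *\<^sub>R e + c *\<^sub>R g"
    using frame_expand[OF t, of w b] w by (auto simp: tangent_def pt e_def g_def)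
  have ww: "mink w w = a\<^sup>2 + c\<^sup>2"
    unfolding ac by (simp add: mink.add_left mink.add_right mink.scaleR_left mink.scaleR_right fm power2_eq_square)
  define m n where "m = (D2 (poisson f) p e e - D2 (poisson f) p g g) / 2"
    and "n = (D2 (poisson f) p e g + D2 (poisson f) p g e) / 2"
  have tf: "tracefree f p = sqrt (m\<^sup>2 + n\<^sup>2)"
    unfolding tracefree_def m_def n_def pt e_def g_def by (rule tangent_onorm_dbar[OF t])
  have tr: "D2 (poisson f) p e e + D2 (poisson f) p g g = 2 * poisson f p"
    using Laplace_eq[OF t, of b] Laplace_poisson[OF p f] by (simp add: pt e_def g_def)
  have "D2 (poisson f) p w w = a * a * D2 (poisson f) p e e + a * c * (2 * n) + c * c * D2 (poisson f) p g g"
    unfolding ac n_def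
    using linear_add[OF linear_D2_left[OF pc]] linear_cmul[OF linear_D2_left[OF pc]]
      linear_add[OF linear_D2_right[OF pc]] linear_cmul[OF linear_D2_right[OF pc]]
    by (simp add: algebra_simps)
  moreover have "D2 (poisson f) p e e = poisson f p + m" "D2 (poisson f) p g g = poisson f p - m"
    using tr by (simp_all add: m_def field_simps)
  ultimately have eq: "D2 (poisson f) p w w - poisson f p * mink w w = m * (a\<^sup>2 - c\<^sup>2) + n * (2 * a * c)"
    by (simp add: ww power2_eq_square algebra_simps)
  have "(m * (a\<^sup>2 - c\<^sup>2) + n * (2 * a * c))\<^sup>2 \<le> (m\<^sup>2 + n\<^sup>2) * (a\<^sup>2 + c\<^sup>2)\<^sup>2"
    using zero_le_power2[of "m * (2 * a * c) - n * (a\<^sup>2 - c\<^sup>2)"]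
    by (simp add: power2_eq_square algebra_simps)
  also have "\<dots> = (sqrt (m\<^sup>2 + n\<^sup>2) * (a\<^sup>2 + c\<^sup>2))\<^sup>2" by (simp add: power_mult_distrib)
  finally have "\<bar>m * (a\<^sup>2 - c\<^sup>2) + n * (2 * a * c)\<bar> \<le> sqrt (m\<^sup>2 + n\<^sup>2) * (a\<^sup>2 + c\<^sup>2)"
    by (rule abs_le_square_iff[THEN iffD2, THEN order_trans]) (simp add: abs_mult)
  then show ?thesis unfolding eq tf by (simp only: ww)
qed

definition mnorm :: "real^3 \<Rightarrow> real" where
  "mnorm x = sqrt (- mink x x)"

lemma mnorm_pos: "x \<in> future_cone \<Longrightarrow> mnorm x > 0"
  by (simp add: mnorm_def future_cone_def)

lemma mnorm_power2: "x \<in> future_cone \<Longrightarrow> (mnorm x)\<^sup>2 = - mink x x"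
  by (simp add: mnorm_def future_cone_def)

lemma mnorm_has_derivative:
  assumes x: "x \<in> future_cone"
  shows "(mnorm has_derivative (\<lambda>v. - mink x v / mnorm x)) (at x)"
proof -
  note d = has_derivative_minus[OF mink_self_has_derivative[of x]]
  have "- mink x x > 0" using x by (simp add: future_cone_def)
  from DERIV_compose_FDERIV[OF DERIV_real_sqrt[OF this] d]
  have "((\<lambda>x. sqrt (- mink x x)) has_derivative (\<lambda>v. - (2 * mink x v) * (inverse (sqrt (- mink x x)) / 2))) (at x)" .
  then show ?thesis
    unfolding mnorm_def[abs_def] by (rule has_derivative_eq_rhs) (simp add: fun_eq_iff inverse_eq_divide)
qed

text \<open>\<open>hext f\<close> is the extension of the Poisson extension of \<open>f\<close> to the cone that is homogeneous of degree one;
  on the slice at height one it is the rescaled function on the Klein disk. \<open>dhext\<close> and \<open>ddhext\<close> are its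
  first and its pure second directional derivatives. In contrast to the extension constant along rays,
  it is linear if \<open>f\<close> is affine.\<close>

definition hext :: "(complex \<Rightarrow> real) \<Rightarrow> real^3 \<Rightarrow> real" where
  "hext f x = mnorm x ^ 3 * moment f 2 x / (2 * pi)"

definition dhext :: "(complex \<Rightarrow> real) \<Rightarrow> real^3 \<Rightarrow> real^3 \<Rightarrow> real" where
  "dhext f x v = (- 3 * (mnorm x * mink x v * moment f 2 x) - 2 * (mnorm x ^ 3 * moment (\<lambda>z. f z * horo v z) 3 x)) / (2 * pi)"

definition ddhext :: "(complex \<Rightarrow> real) \<Rightarrow> real^3 \<Rightarrow> real^3 \<Rightarrow> real" where
  "ddhext f x v = (6 * mnorm x ^ 3 * moment (\<lambda>z. f z * horo v z * horo v z) 4 x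
     + 12 * mnorm x * mink x v * moment (\<lambda>z. f z * horo v z) 3 x
     + 3 * ((mink x v)\<^sup>2 / mnorm x - mnorm x * mink v v) * moment f 2 x) / (2 * pi)"

context
  fixes f :: "complex \<Rightarrow> real"
  assumes f: "continuous_on (sphere 0 1) f"
begin

lemma hext_has_derivative:
  assumes x: "x \<in> future_cone"
  shows "(hext f has_derivative dhext f x) (at x)"
proof -
  have N: "mnorm x > 0" by (rule mnorm_pos[OF x])
  have "((\<lambda>x. mnorm x ^ 3 * moment f 2 x / (2 * pi)) has_derivative
    (\<lambda>v. (mnorm x ^ 3 * (- 2 * moment (\<lambda>z. f z * horo v z) 3 x)
      + (of_nat 3 * (- mink x v / mnorm x) * mnorm x ^ (3 - 1)) * moment f 2 x) / (2 * pi))) (at x)"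
    by (intro bounded_linear.has_derivative[OF bounded_linear_divide] has_derivative_mult has_derivative_power
        mnorm_has_derivative moment2_has_derivative[OF f] x)
  then show ?thesis
    unfolding hext_def[abs_def] dhext_def[abs_def]
    by (rule has_derivative_eq_rhs) (use N in \<open>simp add: fun_eq_iff field_simps power2_eq_square power3_eq_cube\<close>)
qed

lemma dhext_has_derivative:
  assumes x: "x \<in> future_cone"
  obtains D where "((\<lambda>x. dhext f x v) has_derivative D) (at x)" "D v = ddhext f x v"
proof
  have N: "mnorm x > 0" by (rule mnorm_pos[OF x])
  let ?D = "\<lambda>w. (- 3 * (mnorm x * mink x v * (- 2 * moment (\<lambda>z. f z * horo w z) 3 x)
        + (mnorm x * mink w v + (- mink x w / mnorm x) * mink x v) * moment f 2 x)
      - 2 * (mnorm x ^ 3 * (- 3 * moment (\<lambda>z. f z * horo v z * horo w z) 4 x)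
      + (of_nat 3 * (- mink x w / mnorm x) * mnorm x ^ (3 - 1)) * moment (\<lambda>z. f z * horo v z) 3 x)) / (2 * pi)"
  show "((\<lambda>x. dhext f x v) has_derivative ?D) (at x)"
    unfolding dhext_def
    by (intro bounded_linear.has_derivative[OF bounded_linear_divide] has_derivative_diff has_derivative_mult
        has_derivative_mult_right has_derivative_power bounded_linear.has_derivative[OF mink.bounded_linear_left]
        has_derivative_ident mnorm_has_derivative moment2_has_derivative[OF f] moment3_has_derivative[OF f] x)
  show "?D v = ddhext f x v"
    unfolding ddhext_def using N
    by (simp add: power2_eq_square power3_eq_cube algebra_simps)
qed

text \<open>By homogeneity the position vector \<open>x\<close> is in the kernel of the second derivative, so \<open>v\<close> may be replaced by its
  component \<open>w\<close> tangent to \<open>H2\<close>, and on tangent vectors the second derivative is the tracefree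
  Hessian \<open>Hess u - u g\<close>. The bracket on the right is \<open>mink w w\<close>.\<close>

lemma ddhext_bound:
  assumes x: "x \<in> future_cone"
  shows "\<bar>ddhext f x v\<bar> \<le> tracefree f (retract_H2 x) * (mink v v + (mink x v)\<^sup>2 / (mnorm x)\<^sup>2) / mnorm x"
proof -
  define N m k M2 M3 M4 where "N = mnorm x" and "m = mink x v" and "k = mink v v"
    and "M2 = moment f 2 x" and "M3 = moment (\<lambda>z. f z * horo v z) 3 x"
    and "M4 = moment (\<lambda>z. f z * horo v z * horo v z) 4 x"
  have N: "N > 0" "mink x x = - N\<^sup>2" using mnorm_pos[OF x] mnorm_power2[OF x] by (simp_all add: N_def)
  define p w where "p = retract_H2 x" and "w = v + (m / N\<^sup>2) *\<^sub>R x"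
  have p: "p \<in> H2" unfolding p_def by (rule retract_H2_in[OF x])
  have px: "p = (1 / N) *\<^sub>R x" by (simp add: p_def retract_H2_def N_def mnorm_def divide_inverse)
  have "mink w x = 0"
    using N by (simp add: w_def mink.add_left mink.scaleR_left m_def mink_commute[of v x])
  then have w: "w \<in> tangent p" by (simp add: tangent_def px mink.scaleR_right)
  have ww: "mink w w = k + m\<^sup>2 / N\<^sup>2"
    using N by (simp add: w_def mink.add_left mink.add_right mink.scaleR_left mink.scaleR_right k_def m_def[symmetric]
        mink_commute[of v x] power2_eq_square field_simps)
  have cf: "continuous_on (sphere 0 1) (\<lambda>z. f z * horo v z * horo v z)"
    "continuous_on (sphere 0 1) (\<lambda>z. (2 * (m / N\<^sup>2)) * (f z * horo v z * horo x z))"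
    "continuous_on (sphere 0 1) (\<lambda>z. (m / N\<^sup>2)\<^sup>2 * (f z * horo x z * horo x z))"
    by (intro continuous_intros f)+
  have "(\<lambda>z. f z * horo w z * horo w z) = (\<lambda>z. (f z * horo v z * horo v z + (2 * (m / N\<^sup>2)) * (f z * horo v z * horo x z))
      + (m / N\<^sup>2)\<^sup>2 * (f z * horo x z * horo x z))"
    by (simp add: fun_eq_iff w_def horo_add horo_scaleR power2_eq_square algebra_simps)
  then have "moment (\<lambda>z. f z * horo w z * horo w z) 4 x
      = (M4 + 2 * (m / N\<^sup>2) * moment (\<lambda>z. f z * horo v z * horo x z) 4 x) + (m / N\<^sup>2)\<^sup>2 * moment (\<lambda>z. f z * horo x z * horo x z) 4 x"
    by (simp only: moment_add[OF continuous_on_add[OF cf(1,2)] cf(3) x] moment_add[OF cf(1,2) x] moment_cmult M4_def)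
  also have "moment (\<lambda>z. f z * horo v z * horo x z) 4 x = M3"
    using moment_horo[OF x, of "\<lambda>z. f z * horo v z" 3] by (simp add: M3_def)
  also have "moment (\<lambda>z. f z * horo x z * horo x z) 4 x = M2"
    using moment_horo[OF x, of "\<lambda>z. f z * horo x z" 3] moment_horo[OF x, of f 2] by (simp add: M2_def)
  finally have "moment (\<lambda>z. f z * horo w z * horo w z) 4 p = (M4 + 2 * (m / N\<^sup>2) * M3 + (m / N\<^sup>2)\<^sup>2 * M2) * N ^ 4"
    using N unfolding px by (subst moment_scaleR) (simp_all add: power_divide)
  moreover have "moment f 2 p = M2 * N\<^sup>2"
    using N unfolding px by (subst moment_scaleR) (simp_all add: power_divide M2_def)
  moreover have "poisson f p = moment f 2 p / (2 * pi)" using p by (simp add: poisson_def)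
  moreover have frac: "(6 * a - 2 * b * c) / d - c / d * b = (6 * a - 3 * b * c) / d" for a b c d :: real
    by (simp add: diff_divide_distrib)
  ultimately have "D2 (poisson f) p w w - poisson f p * mink w w
      = (6 * ((M4 + 2 * (m / N\<^sup>2) * M3 + (m / N\<^sup>2)\<^sup>2 * M2) * N ^ 4) - 3 * (k + m\<^sup>2 / N\<^sup>2) * (M2 * N\<^sup>2)) / (2 * pi)"
    unfolding D2_poisson[OF f p w w] ww by (simp only: frac)
  also have "6 * ((M4 + 2 * (m / N\<^sup>2) * M3 + (m / N\<^sup>2)\<^sup>2 * M2) * N ^ 4) - 3 * (k + m\<^sup>2 / N\<^sup>2) * (M2 * N\<^sup>2)
      = N * (6 * N ^ 3 * M4 + 12 * N * m * M3 + 3 * (m\<^sup>2 / N - N * k) * M2)"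
    using N(1) by (simp add: field_simps eval_nat_numeral)
  finally have "D2 (poisson f) p w w - poisson f p * mink w w = N * ddhext f x v"
    by (simp add: ddhext_def N_def m_def k_def M2_def M3_def M4_def)
  then have "N * \<bar>ddhext f x v\<bar> \<le> tracefree f p * (k + m\<^sup>2 / N\<^sup>2)"
    using D2_tracefree_bound[OF f p w] N(1) by (simp add: abs_mult ww)
  then show ?thesis using N(1) by (simp add: p_def N_def m_def k_def field_simps)
qed

end

text \<open>A convex function lies above its tangent at \<open>0\<close>, also in the limit at an endpoint where it need not be
  differentiable.\<close>

lemma convex_tangent_le_limit:
  fixes h h' :: "real \<Rightarrow> real"
  assumes h: "\<And>t. 0 \<le> t \<Longrightarrow> t < 1 \<Longrightarrow> (h has_real_derivative h' t) (at t)"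
    and h': "\<And>t. 0 \<le> t \<Longrightarrow> t < 1 \<Longrightarrow> \<exists>y\<ge>0. (h' has_real_derivative y) (at t)"
    and lim: "(h \<longlongrightarrow> L) (at_left 1)"
  shows "h 0 + h' 0 \<le> L"
proof -
  have mono: "h' 0 \<le> h' t" if "0 \<le> t" "t < 1" for t
    by (rule DERIV_nonneg_imp_nondecreasing[OF that(1)]) (use h' that in force)
  have le: "h 0 + s * h' 0 \<le> h s" if s: "0 < s" "s < 1" for s
  proof -
    obtain z where z: "0 < z" "z < s" "h s - h 0 = (s - 0) * h' z"
      using MVT2[of 0 s h h'] s h by auto
    have "s * h' 0 \<le> s * h' z" using mono[of z] z s by (intro mult_left_mono) auto
    then show ?thesis using z(3) by simp
  qed
  have "((\<lambda>s. h 0 + s * h' 0) \<longlongrightarrow> h 0 + 1 * h' 0) (at_left 1)" by (intro tendsto_intros)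
  then have "h 0 + 1 * h' 0 \<le> L"
  proof (rule tendsto_le[OF trivial_limit_at_left_real lim])
    have "\<forall>\<^sub>F s in at_left 1. s \<in> {0<..<1::real}" by (rule eventually_at_left_real) simp
    then show "\<forall>\<^sub>F s in at_left 1. h 0 + s * h' 0 \<le> h s" by eventually_elim (simp add: le)
  qed
  then show ?thesis by simp
qed

text \<open>The function on the left is convex on chords. By \<open>ddhext_bound\<close> the second derivative of the Poisson term is
  at most \<open>tracefree\<close> times \<open>q\<close>, where \<open>- q\<close> is the second derivative of \<open>kfac\<close>. Where \<open>tracefree\<close> is at
  most \<open>e\<close>, the term \<open>- e kfac\<close> compensates it; on \<open>|\<eta>| \<le> \<rho>\<close> the term \<open>- M kfac\<^sup>2\<close> does, whose second
  derivative \<open>2 M |v|\<^sup>2\<close> is bounded below by a multiple of \<open>q\<close> there. As both correction terms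
  vanish on the circle, the tangent plane at \<open>\<eta>\<close> is an affine minorant of \<open>f\<close>.\<close>

lemma poisson_minus_le_cvx_env:
  assumes f: "continuous_on (sphere 0 1) f"
    and \<rho>: "0 \<le> \<rho>" "\<rho> < 1" and e: "e \<ge> 0" and \<beta>: "\<beta> \<ge> 0"
    and outer: "\<And>p. p \<in> H2 \<Longrightarrow> \<rho> < cmod (Klein p) \<Longrightarrow> tracefree f p \<le> e"
    and inner: "\<And>p. p \<in> H2 \<Longrightarrow> cmod (Klein p) \<le> \<rho> \<Longrightarrow> tracefree f p \<le> \<beta>"
    and \<eta>: "cmod \<eta> < 1"
  defines "M \<equiv> \<beta> / (2 * sqrt (1 - \<rho>\<^sup>2) ^ 3)"
  shows "disk_fun (poisson f) \<eta> - e * kfac \<eta> - M * (kfac \<eta>)\<^sup>2 \<le> cvx_env f \<eta>"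
proof -
  \<comment> \<open>On the slice \<open>cvec \<eta>\<close> this is the function of the statement, because \<open>mnorm\<close> is \<open>kfac\<close> and
    \<open>mink x x\<close> is \<open>- kfac\<^sup>2\<close> there (see \<open>hx\<close>).\<close>
  define G where "G x = hext f x - e * mnorm x + M * mink x x" for x
  define DG where "DG x v = dhext f x v + e * (mink x v / mnorm x) + M * (2 * mink x v)" for x v
  have \<rho>2: "1 - \<rho>\<^sup>2 > 0" using \<rho> by (simp add: abs_square_less_1)
  have M0: "M \<ge> 0" using \<beta> \<rho>2 by (simp add: M_def)
  have DG: "(G has_derivative DG x) (at x)" if x: "x \<in> future_cone" for x
  proof -
    have "((\<lambda>x. hext f x - e * mnorm x + M * mink x x) has_derivative
        (\<lambda>v. dhext f x v - e * (- mink x v / mnorm x) + M * (2 * mink x v))) (at x)"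
      by (intro has_derivative_add has_derivative_diff has_derivative_mult_right hext_has_derivative[OF f]
          mnorm_has_derivative mink_self_has_derivative x)
    then show ?thesis unfolding G_def[abs_def] DG_def[abs_def] by simp
  qed
  have DDG: "((\<lambda>s. DG (x + s *\<^sub>R v) v) has_real_derivative
      ddhext f y v + e * ((mink v v + (mink y v)\<^sup>2 / (mnorm y)\<^sup>2) / mnorm y) + 2 * M * mink v v) (at t)"
    if y: "y = x + t *\<^sub>R v" "y \<in> future_cone" for x v y t
  proof -
    obtain D where D: "((\<lambda>x. dhext f x v) has_derivative D) (at y)" "D v = ddhext f y v"
      using dhext_has_derivative[OF f y(2)] by blast
    have N: "mnorm y > 0" by (rule mnorm_pos[OF y(2)])
    have "((\<lambda>x. DG x v) has_derivative (\<lambda>w. D w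
        + e * ((mink w v * mnorm y - mink y v * (- mink y w / mnorm y)) / (mnorm y * mnorm y))
        + M * (2 * mink w v))) (at y)"
      unfolding DG_def
      by (intro has_derivative_add has_derivative_mult_right D has_derivative_divide'
          bounded_linear.has_derivative[OF mink.bounded_linear_left] has_derivative_ident mnorm_has_derivative y)
        (use N in auto)
    from line_has_derivative[OF this[unfolded y(1)]]
    have "((\<lambda>s. DG (x + s *\<^sub>R v) v) has_real_derivative (D v
        + e * ((mink v v * mnorm y - mink y v * (- mink y v / mnorm y)) / (mnorm y * mnorm y))
        + M * (2 * mink v v))) (at t)" by (simp add: y(1))
    also have "(mink v v * mnorm y - mink y v * (- mink y v / mnorm y)) / (mnorm y * mnorm y)
        = (mink v v + (mink y v)\<^sup>2 / (mnorm y)\<^sup>2) / mnorm y"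
      using N by (simp add: field_simps power2_eq_square)
    finally show ?thesis by (simp add: D(2) mult.assoc mult.left_commute)
  qed
  have cv: "cvec \<eta> \<in> future_cone" by (rule cvec_in_cone[OF \<eta>])
  have hx: "G (cvec \<zeta>) = disk_fun (poisson f) \<zeta> - e * kfac \<zeta> - M * (kfac \<zeta>)\<^sup>2" if \<zeta>: "cmod \<zeta> < 1" for \<zeta>
  proof -
    have N: "mnorm (cvec \<zeta>) = kfac \<zeta>" by (simp add: mnorm_def mink_cvec kfac_def)
    have k2: "mink (cvec \<zeta>) (cvec \<zeta>) = - (kfac \<zeta>)\<^sup>2" using kfac_power2[of \<zeta>] \<zeta> by (simp add: mink_cvec)
    have "poisson f (lift \<zeta>) = (kfac \<zeta>)\<^sup>2 * moment f 2 (cvec \<zeta>) / (2 * pi)"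
      using poisson_retract[OF cvec_in_cone[OF \<zeta>], of f] by (simp add: lift_def k2)
    then show ?thesis
      unfolding G_def hext_def N k2 disk_fun_eq[OF \<zeta>] by (simp add: power2_eq_square power3_eq_cube)
  qed
  define dir where "dir w = (Re w *\<^sub>R axis 2 1 + Im w *\<^sub>R axis 3 1 :: real^3)" for w
  have cdir: "cvec \<zeta> + s *\<^sub>R dir w = cvec (\<zeta> + s *\<^sub>R w)" for \<zeta> s w
    by (simp add: dir_def vec_eq_iff forall_3 axis_def)
  \<comment> \<open>The tangent plane of the graph at \<open>\<eta>\<close>.\<close>
  define a where "a z = DG (cvec \<eta>) (dir z) + (G (cvec \<eta>) - DG (cvec \<eta>) (dir \<eta>))" for z
  have lin: "linear (DG (cvec \<eta>))" using DG[OF cv] has_derivative_linear by blast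
  have lind: "linear (\<lambda>z. DG (cvec \<eta>) (dir z))"
  proof -
    have "linear dir" by (rule linearI) (simp_all add: dir_def algebra_simps)
    from linear_compose[OF this lin] show ?thesis by (simp add: o_def)
  qed
  have aff: "affine_fun a" unfolding affine_fun_def a_def[abs_def] using lind by blast
  have "a z \<le> f z" if z: "cmod z = 1" for z
  proof -
    define v where "v = dir (z - \<eta>)"
    define h where "h t = G (cvec \<eta> + t *\<^sub>R v)" for t
    define h' where "h' t = DG (cvec \<eta> + t *\<^sub>R v) v" for t
    have seg: "cmod (\<eta> + t *\<^sub>R (z - \<eta>)) < 1" if t: "0 \<le> t" "t < 1" for t
    proof -
      have "\<eta> + t *\<^sub>R (z - \<eta>) = (1 - t) *\<^sub>R \<eta> + t *\<^sub>R z" by (simp add: algebra_simps)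
      then have "cmod (\<eta> + t *\<^sub>R (z - \<eta>)) \<le> (1 - t) * cmod \<eta> + t * cmod z"
        using norm_triangle_ineq[of "(1 - t) *\<^sub>R \<eta>" "t *\<^sub>R z"] t by simp
      also have "\<dots> < (1 - t) * 1 + t * 1" unfolding z using t mult_strict_left_mono[OF \<eta>, of "1 - t"] by linarith
      finally show ?thesis by simp
    qed
    have pt: "cvec \<eta> + t *\<^sub>R v = cvec (\<eta> + t *\<^sub>R (z - \<eta>))" for t unfolding v_def by (rule cdir)
    have cone: "cvec \<eta> + t *\<^sub>R v \<in> future_cone" if t: "0 \<le> t" "t < 1" for t
      unfolding pt by (rule cvec_in_cone[OF seg[OF t]])
    have "h 0 + h' 0 \<le> f z"
    proof (rule convex_tangent_le_limit)
      fix t :: real assume t: "0 \<le> t" "t < 1"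
      show "(h has_real_derivative h' t) (at t)"
        unfolding h_def h'_def by (rule line_has_derivative[OF DG[OF cone[OF t]]])
      define \<zeta> y where "\<zeta> = \<eta> + t *\<^sub>R (z - \<eta>)" and "y = cvec \<zeta>"
      have y: "y = cvec \<eta> + t *\<^sub>R v" "y \<in> future_cone" using cone[OF t] pt[of t] by (simp_all add: y_def \<zeta>_def)
      have \<zeta>: "cmod \<zeta> < 1" unfolding \<zeta>_def by (rule seg[OF t])
      have N: "mnorm y = kfac \<zeta>" by (simp add: y_def mnorm_def mink_cvec kfac_def)
      have N0: "kfac \<zeta> > 0" by (rule kfac_pos[OF \<zeta>])
      have ry: "retract_H2 y \<in> H2" "Klein (retract_H2 y) = \<zeta>"
        using retract_H2_in[OF y(2)] Klein_lift[OF \<zeta>] by (simp_all add: lift_def y_def)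
      define k m where "k = mink v v" and "m = mink y v"
      have k: "k = (cmod (z - \<eta>))\<^sup>2" unfolding k_def v_def dir_def cmod_power2
        by (simp add: mink_def axis_def power2_eq_square)
      have m: "m = \<zeta> \<bullet> (z - \<eta>)" unfolding m_def v_def dir_def y_def
        by (simp add: mink_def axis_def inner_complex_def)
      \<comment> \<open>Euclidean and hyperbolic length compare as \<open>q \<le> k / kfac\<^sup>3\<close>, which fixes the size of \<open>M\<close>.\<close>
      have "\<bar>m\<bar> \<le> cmod \<zeta> * cmod (z - \<eta>)" unfolding m by (rule Cauchy_Schwarz_ineq2)
      then have "m\<^sup>2 \<le> (cmod \<zeta>)\<^sup>2 * k" unfolding k by (metis abs_ge_zero power2_abs power_mono power_mult_distrib)
      also have "(cmod \<zeta>)\<^sup>2 = 1 - (kfac \<zeta>)\<^sup>2" using kfac_power2[of \<zeta>] \<zeta> by simp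
      finally have "m\<^sup>2 / (kfac \<zeta>)\<^sup>2 \<le> (1 - (kfac \<zeta>)\<^sup>2) * k / (kfac \<zeta>)\<^sup>2" by (rule divide_right_mono) simp
      also have "\<dots> = k / (kfac \<zeta>)\<^sup>2 - k" using N0 by (simp add: left_diff_distrib diff_divide_distrib)
      finally have mk: "k + m\<^sup>2 / (kfac \<zeta>)\<^sup>2 \<le> k / (kfac \<zeta>)\<^sup>2" by simp
      have k0: "k \<ge> 0" and km0: "k + m\<^sup>2 / (kfac \<zeta>)\<^sup>2 \<ge> 0" by (simp_all add: k)
      define q where "q = (k + m\<^sup>2 / (kfac \<zeta>)\<^sup>2) / kfac \<zeta>"
      have q0: "q \<ge> 0" unfolding q_def using km0 N0 by simp
      have dd: "\<bar>ddhext f y v\<bar> \<le> tracefree f (retract_H2 y) * q"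
        using ddhext_bound[OF f y(2), of v] by (simp add: N k_def m_def q_def)
      have "0 \<le> ddhext f y v + e * q + 2 * M * k"
      proof (cases "\<rho> < cmod \<zeta>")
        case True
        have "tracefree f (retract_H2 y) * q \<le> e * q"
          by (rule mult_right_mono[OF outer[OF ry(1)] q0]) (simp add: ry True)
        moreover have "2 * M * k \<ge> 0" using M0 k0 by simp
        ultimately show ?thesis using dd by linarith
      next
        case False
        have "tracefree f (retract_H2 y) * q \<le> \<beta> * q"
          by (rule mult_right_mono[OF inner[OF ry(1)] q0]) (use False in \<open>simp add: ry\<close>)
        also have "\<beta> * q \<le> 2 * M * k"
        proof -
          define \<kappa> where "\<kappa> = sqrt (1 - \<rho>\<^sup>2)"
          have \<kappa>: "\<kappa> > 0" using \<rho>2 by (simp add: \<kappa>_def)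
          have "(cmod \<zeta>)\<^sup>2 \<le> \<rho>\<^sup>2" using False by (intro power_mono) auto
          then have "\<kappa> \<le> kfac \<zeta>" by (simp add: \<kappa>_def kfac_def)
          then have "\<kappa> ^ 3 \<le> kfac \<zeta> ^ 3" using \<kappa> by (intro power_mono) auto
          have "q \<le> k / (kfac \<zeta>)\<^sup>2 / kfac \<zeta>" unfolding q_def using mk N0 by (intro divide_right_mono) auto
          also have "\<dots> = k / kfac \<zeta> ^ 3" by (simp add: power2_eq_square power3_eq_cube)
          also have "\<dots> \<le> k / \<kappa> ^ 3" using \<open>\<kappa> ^ 3 \<le> kfac \<zeta> ^ 3\<close> \<kappa> N0 k0 by (intro divide_left_mono) auto
          finally have "\<beta> * q \<le> \<beta> * (k / \<kappa> ^ 3)" using \<beta> by (rule mult_left_mono)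
          then show ?thesis by (simp add: M_def \<kappa>_def)
        qed
        moreover have "e * q \<ge> 0" using e q0 by simp
        ultimately show ?thesis using dd by linarith
      qed
      then show "\<exists>d\<ge>0. (h' has_real_derivative d) (at t)"
        using DDG[OF y, unfolded N k_def[symmetric] m_def[symmetric] q_def[symmetric]]
        unfolding h'_def[abs_def] by blast
    next
      define F where "F = (\<lambda>\<eta>. if cmod \<eta> < 1 then disk_fun (poisson f) \<eta> else f \<eta>)"
      define K where "K \<zeta> = F \<zeta> - e * kfac \<zeta> - M * (kfac \<zeta>)\<^sup>2" for \<zeta>
      have Kc: "continuous_on (cball 0 1) K"
        unfolding K_def F_def kfac_def by (intro continuous_intros poisson_boundary[OF f])
      have "cmod (\<eta> + t *\<^sub>R (z - \<eta>)) \<le> 1" if "t \<in> {0..1}" for t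
        using seg[of t] that z by (cases "t = 1") auto
      then have "(\<lambda>t. \<eta> + t *\<^sub>R (z - \<eta>)) ` {0..1} \<subseteq> cball 0 1" by (simp add: image_subset_iff)
      from continuous_on_compose2[OF Kc _ this]
      have "continuous_on {0..1} (\<lambda>t. K (\<eta> + t *\<^sub>R (z - \<eta>)))" by (simp add: continuous_intros)
      then have "continuous (at 1 within {0..1}) (\<lambda>t. K (\<eta> + t *\<^sub>R (z - \<eta>)))"
        by (simp add: continuous_on_eq_continuous_within)
      then have "((\<lambda>t. K (\<eta> + t *\<^sub>R (z - \<eta>))) \<longlongrightarrow> K z) (at 1 within {0..1})"
        by (simp add: continuous_within)
      then have "((\<lambda>t. K (\<eta> + t *\<^sub>R (z - \<eta>))) \<longlongrightarrow> K z) (at_left 1)"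
        by (simp add: at_within_Icc_at_left)
      moreover have "K z = f z" using z by (simp add: K_def F_def kfac_def)
      moreover have "\<forall>\<^sub>F t in at_left 1. t \<in> {0<..<1::real}" by (rule eventually_at_left_real) simp
      then have "\<forall>\<^sub>F t in at_left 1. K (\<eta> + t *\<^sub>R (z - \<eta>)) = h t"
        by eventually_elim (simp add: h_def pt hx seg K_def F_def)
      ultimately show "(h \<longlongrightarrow> f z) (at_left 1)" by (simp add: tendsto_cong)
    qed
    moreover have "a z = h 0 + h' 0"
    proof -
      have "dir z = v + dir \<eta>" by (simp add: v_def dir_def algebra_simps)
      then show ?thesis by (simp add: a_def h_def h'_def linear_add[OF lin])
    qed
    ultimately show ?thesis by simp
  qed
  from cvx_env_upper[OF f _ aff this] have "a \<eta> \<le> cvx_env f \<eta>" using \<eta> by simp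
  then show ?thesis by (simp add: a_def hx[OF \<eta>])
qed

section \<open>Vanishing at the boundary\<close>

lemma eventually_disk_boundary:
  "eventually P (filtercomap cmod (at_left 1)) \<longleftrightarrow> (\<exists>\<rho>. 0 \<le> \<rho> \<and> \<rho> < 1 \<and> (\<forall>\<eta>. \<rho> < cmod \<eta> \<and> cmod \<eta> < 1 \<longrightarrow> P \<eta>))"
proof
  assume "eventually P (filtercomap cmod (at_left 1))"
  then obtain Q where Q: "eventually Q (at_left 1)" "\<And>\<eta>. Q (cmod \<eta>) \<Longrightarrow> P \<eta>"
    unfolding eventually_filtercomap by blast
  then obtain b where "b < 1" "\<And>y. b < y \<Longrightarrow> y < 1 \<Longrightarrow> Q y" unfolding eventually_at_left_field by blast
  then show "\<exists>\<rho>. 0 \<le> \<rho> \<and> \<rho> < 1 \<and> (\<forall>\<eta>. \<rho> < cmod \<eta> \<and> cmod \<eta> < 1 \<longrightarrow> P \<eta>)"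
    using Q(2) by (intro exI[of _ "max b 0"]) auto
next
  assume "\<exists>\<rho>. 0 \<le> \<rho> \<and> \<rho> < 1 \<and> (\<forall>\<eta>. \<rho> < cmod \<eta> \<and> cmod \<eta> < 1 \<longrightarrow> P \<eta>)"
  then obtain \<rho> where "\<rho> < 1" "\<And>\<eta>. \<rho> < cmod \<eta> \<Longrightarrow> cmod \<eta> < 1 \<Longrightarrow> P \<eta>" by blast
  then show "eventually P (filtercomap cmod (at_left 1))"
    unfolding eventually_filtercomap
    by (intro exI[of _ "\<lambda>y. \<rho> < y \<and> y < 1"]) (auto simp: eventually_at_left_field)
qed

lemma eventually_boundary_H2:
  "eventually P boundary_H2 \<longleftrightarrow> (\<exists>\<rho>. 0 \<le> \<rho> \<and> \<rho> < 1 \<and> (\<forall>p\<in>H2. \<rho> < cmod (Klein p) \<longrightarrow> P p))"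
proof
  assume "eventually P boundary_H2"
  then obtain Q where Q: "eventually Q (at_left 1)" "\<And>p. Q (cmod (Klein p)) \<Longrightarrow> p \<in> H2 \<Longrightarrow> P p"
    unfolding boundary_H2_def eventually_inf_principal eventually_filtercomap by blast
  then obtain b where "b < 1" "\<And>y. b < y \<Longrightarrow> y < 1 \<Longrightarrow> Q y" unfolding eventually_at_left_field by blast
  then show "\<exists>\<rho>. 0 \<le> \<rho> \<and> \<rho> < 1 \<and> (\<forall>p\<in>H2. \<rho> < cmod (Klein p) \<longrightarrow> P p)"
    using Q(2) H2_props(2) by (intro exI[of _ "max b 0"]) auto
next
  assume "\<exists>\<rho>. 0 \<le> \<rho> \<and> \<rho> < 1 \<and> (\<forall>p\<in>H2. \<rho> < cmod (Klein p) \<longrightarrow> P p)"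
  then obtain \<rho> where "\<rho> < 1" "\<And>p. p \<in> H2 \<Longrightarrow> \<rho> < cmod (Klein p) \<Longrightarrow> P p" by blast
  then show "eventually P boundary_H2"
    unfolding boundary_H2_def eventually_inf_principal eventually_filtercomap
    by (intro exI[of _ "\<lambda>y. \<rho> < y \<and> y < 1"]) (auto simp: eventually_at_left_field)
qed

lemma tracefree_nonneg:
  assumes f: "continuous_on (sphere 0 1) f" and p: "p \<in> H2"
  shows "tracefree f p \<ge> 0"
proof -
  obtain t b where t: "0 \<le> t" "t < 1" and pt: "p = hpt t b" using hpt_exists[OF p] .
  show ?thesis unfolding tracefree_def pt tangent_onorm_poisson[OF t f] by simp
qed

lemma width_of_nonneg:
  assumes f: "continuous_on (sphere 0 1) f" and \<eta>: "cmod \<eta> < 1"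
  shows "width_of f \<eta> \<ge> 0"
proof -
  have "0 \<le> 6 * width_of f \<eta>"
    using order_trans[OF tracefree_nonneg tracefree_le_width, OF f lift_in_H2[OF \<eta>] f lift_in_H2[OF \<eta>]]
    unfolding Klein_lift[OF \<eta>] .
  then show ?thesis by simp
qed

lemma width_of_le_inner:
  assumes f: "continuous_on (sphere 0 1) f" and M: "\<And>z. cmod z = 1 \<Longrightarrow> \<bar>f z\<bar> \<le> M"
    and \<eta>: "cmod \<eta> \<le> \<rho>" "\<rho> < 1"
  shows "width_of f \<eta> \<le> 2 * M / sqrt (1 - \<rho>\<^sup>2)"
proof -
  have \<eta>1: "cmod \<eta> \<le> 1" and \<rho>0: "0 \<le> \<rho>" using \<eta> by (auto intro: order_trans[OF norm_ge_zero])
  have M0: "M \<ge> 0" using M[of 1] by simp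
  have f': "continuous_on (sphere 0 1) (\<lambda>z. - f z)" by (intro continuous_intros f)
  have "- M \<le> cvx_env f \<eta>"
    by (rule cvx_env_upper[OF f \<eta>1 affine_const]) (use M in \<open>force simp: abs_le_iff\<close>)
  moreover have "- M \<le> cvx_env (\<lambda>z. - f z) \<eta>"
    by (rule cvx_env_upper[OF f' \<eta>1 affine_const]) (use M in \<open>force simp: abs_le_iff\<close>)
  moreover have k: "kfac \<eta> > 0" using \<eta> by (intro kfac_pos) simp
  ultimately have "width_of f \<eta> \<le> 2 * M / kfac \<eta>"
    unfolding width_of_def by (intro divide_right_mono) auto
  also have "\<dots> \<le> 2 * M / sqrt (1 - \<rho>\<^sup>2)"
  proof (rule divide_left_mono)
    have "(cmod \<eta>)\<^sup>2 \<le> \<rho>\<^sup>2" using \<eta> by (intro power_mono) auto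
    then show "sqrt (1 - \<rho>\<^sup>2) \<le> kfac \<eta>" by (simp add: kfac_def)
    show "0 < kfac \<eta> * sqrt (1 - \<rho>\<^sup>2)"
      using k \<rho>0 \<eta>(2) by (simp add: abs_square_less_1)
  qed (use M0 in simp)
  finally show ?thesis .
qed

lemma tracefree_uminus:
  assumes f: "continuous_on (sphere 0 1) f" and p: "p \<in> H2"
  shows "tracefree (\<lambda>z. - f z) p = tracefree f p"
proof -
  obtain t b where t: "0 \<le> t" "t < 1" and pt: "p = hpt t b" using hpt_exists[OF p] .
  have f': "continuous_on (sphere 0 1) (\<lambda>z. - f z)" by (intro continuous_intros f)
  show ?thesis
    unfolding tracefree_def pt tangent_onorm_poisson[OF t f] tangent_onorm_poisson[OF t f']
    by (simp add: Phi_def)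
qed

lemma tracefree_vanishes_iff_width_vanishes:
  assumes f: "continuous_on (sphere 0 1) f"
  shows "(tracefree f \<longlongrightarrow> 0) boundary_H2 \<longleftrightarrow> (width_of f \<longlongrightarrow> 0) (filtercomap cmod (at_left 1))"
proof
  assume "(width_of f \<longlongrightarrow> 0) (filtercomap cmod (at_left 1))"
  show "(tracefree f \<longlongrightarrow> 0) boundary_H2"
    unfolding tendsto_iff
  proof (intro allI impI)
    fix e :: real assume e: "e > 0"
    have "\<forall>\<^sub>F \<eta> in filtercomap cmod (at_left 1). dist (width_of f \<eta>) 0 < e / 6"
      by (rule tendstoD[OF \<open>(width_of f \<longlongrightarrow> 0) _\<close>]) (use e in simp)
    then obtain \<rho> where \<rho>: "0 \<le> \<rho>" "\<rho> < 1" "\<And>\<eta>. \<rho> < cmod \<eta> \<Longrightarrow> cmod \<eta> < 1 \<Longrightarrow> dist (width_of f \<eta>) 0 < e / 6"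
      unfolding eventually_disk_boundary by blast
    have "dist (tracefree f p) 0 < e" if p: "p \<in> H2" "\<rho> < cmod (Klein p)" for p
      using \<rho>(3)[OF p(2) H2_props(2)[OF p(1)]] tracefree_le_width[OF f p(1)] tracefree_nonneg[OF f p(1)]
        width_of_nonneg[OF f H2_props(2)[OF p(1)]]
      by simp
    then show "\<forall>\<^sub>F p in boundary_H2. dist (tracefree f p) 0 < e"
      unfolding eventually_boundary_H2 using \<rho> by blast
  qed
next
  assume lim: "(tracefree f \<longlongrightarrow> 0) boundary_H2"
  obtain M0 where M0: "\<And>z. cmod z = 1 \<Longrightarrow> \<bar>f z\<bar> \<le> M0" using circle_bounded[OF f] by blast
  have f': "continuous_on (sphere 0 1) (\<lambda>z. - f z)" by (intro continuous_intros f)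
  show "(width_of f \<longlongrightarrow> 0) (filtercomap cmod (at_left 1))"
    unfolding tendsto_iff
  proof (intro allI impI)
    fix e :: real assume e: "e > 0"
    have "\<forall>\<^sub>F p in boundary_H2. dist (tracefree f p) 0 < e / 4"
      by (rule tendstoD[OF lim]) (use e in simp)
    then obtain \<rho> where \<rho>: "0 \<le> \<rho>" "\<rho> < 1" "\<And>p. p \<in> H2 \<Longrightarrow> \<rho> < cmod (Klein p) \<Longrightarrow> dist (tracefree f p) 0 < e / 4"
      unfolding eventually_boundary_H2 by blast
    define \<beta> where "\<beta> = 6 * \<bar>2 * M0 / sqrt (1 - \<rho>\<^sup>2)\<bar>"
    define M where "M = \<beta> / (2 * sqrt (1 - \<rho>\<^sup>2) ^ 3)"
    have outer: "tracefree f p \<le> e / 4" if "p \<in> H2" "\<rho> < cmod (Klein p)" for p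
      using \<rho>(3)[OF that] by simp
    have inner: "tracefree f p \<le> \<beta>" if p: "p \<in> H2" "cmod (Klein p) \<le> \<rho>" for p
      using tracefree_le_width[OF f p(1)] width_of_le_inner[OF f M0 p(2) \<rho>(2)]
        abs_ge_self[of "2 * M0 / sqrt (1 - \<rho>\<^sup>2)"]
      unfolding \<beta>_def by linarith
    have \<beta>: "\<beta> \<ge> 0" by (simp add: \<beta>_def)
    have le: "width_of f \<eta> \<le> e / 2 + 2 * M * kfac \<eta>" if \<eta>: "cmod \<eta> < 1" for \<eta>
    proof -
      have 1: "disk_fun (poisson f) \<eta> - e/4 * kfac \<eta> - M * (kfac \<eta>)\<^sup>2 \<le> cvx_env f \<eta>"
        unfolding M_def
        by (rule poisson_minus_le_cvx_env[OF f \<rho>(1,2) _ \<beta> outer inner \<eta>]) (use e in auto)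
      have 2: "disk_fun (poisson (\<lambda>z. - f z)) \<eta> - e/4 * kfac \<eta> - M * (kfac \<eta>)\<^sup>2 \<le> cvx_env (\<lambda>z. - f z) \<eta>"
        unfolding M_def
        by (rule poisson_minus_le_cvx_env[OF f' \<rho>(1,2) _ \<beta> _ _ \<eta>])
          (use e outer inner in \<open>simp_all add: tracefree_uminus[OF f]\<close>)
      have "disk_fun (poisson (\<lambda>z. - f z)) \<eta> = - disk_fun (poisson f) \<eta>"
        using moment_cmult[of "-1" f 2 "lift \<eta>"] lift_in_H2[OF \<eta>]
        by (simp add: disk_fun_eq[OF \<eta>] poisson_def)
      then have "- cvx_env (\<lambda>z. - f z) \<eta> - cvx_env f \<eta> \<le> (e / 2 + 2 * M * kfac \<eta>) * kfac \<eta>"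
        using 1 2 by (simp add: algebra_simps power2_eq_square)
      then show ?thesis using kfac_pos[OF \<eta>] by (simp add: width_of_def pos_divide_le_eq)
    qed
    have Mp: "M \<ge> 0" using \<beta> \<rho> by (simp add: M_def abs_square_less_1 power_le_one)
    define s where "s = e / (4 * (M + 1))"
    have s: "s > 0" using e Mp by (simp add: s_def)
    obtain \<sigma> where \<sigma>: "0 \<le> \<sigma>" "\<sigma> < 1" "\<And>\<eta>. \<sigma> < cmod \<eta> \<Longrightarrow> cmod \<eta> < 1 \<Longrightarrow> kfac \<eta> < s"
      using kfac_small_near_circle[OF s] by auto
    have "dist (width_of f \<eta>) 0 < e" if \<eta>: "\<sigma> < cmod \<eta>" "cmod \<eta> < 1" for \<eta>
    proof -
      have "2 * M * kfac \<eta> \<le> 2 * M * s" using \<sigma>(3)[OF \<eta>] Mp by (intro mult_left_mono) auto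
      also have "\<dots> < e / 2" using e Mp by (simp add: s_def field_simps)
      finally show ?thesis using le[OF \<eta>(2)] width_of_nonneg[OF f \<eta>(2)] by simp
    qed
    then show "\<forall>\<^sub>F \<eta> in filtercomap cmod (at_left 1). dist (width_of f \<eta>) 0 < e"
      unfolding eventually_disk_boundary using \<sigma> by blast
  qed
qed

section \<open>Quadruples\<close>

text \<open>The coefficients of \<open>X[Q]\<close> as a linear form in the values of the support function (\<open>field_at_coef\<close>):
  \<open>coef a b c\<close> is, up to an alternating sign, that of the value at the middle point \<open>b\<close> of three
  consecutive points.\<close>

definition coef :: "complex \<Rightarrow> complex \<Rightarrow> complex \<Rightarrow> complex" where
  "coef a b c = \<i> * b * (c - a) / ((b - a) * (c - b))"

lemma field_at_coef:
  assumes "a \<noteq> b" "b \<noteq> c" "c \<noteq> d" "d \<noteq> a"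
    and "X a = \<i> * a * \<psi> a" "X b = \<i> * b * \<psi> b" "X c = \<i> * c * \<psi> c" "X d = \<i> * d * \<psi> d"
  shows "field_at X (a, b, c, d) = coef a b c * \<psi> b - coef b c d * \<psi> c + coef c d a * \<psi> d - coef d a b * \<psi> a"
proof -
  have c: "coef x y z * w = \<i> * y * w * (1 / (y - x) + 1 / (z - y))" if "x \<noteq> y" "y \<noteq> z" for x y z w
    using that by (simp add: coef_def field_simps)
  show ?thesis
    unfolding field_at_def prod.case assms(5-8) c[OF assms(1,2)] c[OF assms(2,3)] c[OF assms(3,4)] c[OF assms(4,1)]
    by (simp add: diff_divide_distrib algebra_simps)
qed

lemma cis_diff: "cis x - cis y = 2 * \<i> * of_real (sin ((x - y) / 2)) * cis ((x + y) / 2)"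
proof -
  define u v where "u = (x + y) / 2" and "v = (x - y) / 2"
  have xy: "x = u + v" "y = u - v" by (simp_all add: u_def v_def field_simps)
  have "cis x - cis y = 2 * \<i> * of_real (sin v) * cis u"
    by (simp add: xy complex_eq_iff cos_add cos_diff sin_add sin_diff)
  then show ?thesis by (simp add: u_def v_def)
qed

text \<open>By half-angle formulas the coefficient is a quotient of sines of angles in \<open>(0, pi)\<close>.\<close>

lemma coef_cis:
  assumes "s < t" "t < u" "u < s + 2 * pi"
  obtains k where "k > 0" "coef (cis s) (cis t) (cis u) = of_real k"
proof -
  define A B C where "A = sin ((u - s) / 2)" and "B = sin ((t - s) / 2)" and "C = sin ((u - t) / 2)"
  have pos: "A > 0" "B > 0" "C > 0"
    unfolding A_def B_def C_def by (intro sin_gt_zero; use assms in simp)+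
  have cc: "cis ((t + s) / 2) * cis ((u + t) / 2) = cis t * cis ((u + s) / 2)"
  proof -
    have "(t + s) / 2 + (u + t) / 2 = t + (u + s) / 2" by (simp add: field_simps)
    then show ?thesis by (simp only: cis_mult)
  qed
  have "coef (cis s) (cis t) (cis u)
      = (\<i> * cis t * (2 * \<i> * of_real A * cis ((u + s) / 2)))
        / (2 * \<i> * of_real B * (2 * \<i> * of_real C) * (cis ((t + s) / 2) * cis ((u + t) / 2)))"
    unfolding coef_def cis_diff[of u s] cis_diff[of t s] cis_diff[of u t] A_def B_def C_def by (simp add: mult_ac)
  also have "\<dots> = of_real (A / (2 * (B * C)))"
    unfolding cc using pos by (simp add: field_simps)
  finally show ?thesis using that[of "A / (2 * (B * C))"] pos by simp
qed

lemma ccw_quadruple_coefs: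
  assumes "ccw_quadruple (a, b, c, d)"
  obtains k1 k2 k3 k4 where "k1 > 0" "k2 > 0" "k3 > 0" "k4 > 0"
    "coef a b c = of_real k1" "coef b c d = of_real k2" "coef c d a = of_real k3" "coef d a b = of_real k4"
    "a \<noteq> b" "b \<noteq> c" "c \<noteq> d" "d \<noteq> a" "a \<noteq> c" "b \<noteq> d" "cmod a = 1" "cmod b = 1" "cmod c = 1" "cmod d = 1"
proof -
  obtain s t u v where q: "s < t" "t < u" "u < v" "v < s + 2 * pi"
    and abcd: "a = cis s" "b = cis t" "c = cis u" "d = cis v"
    using assms by (auto simp: ccw_quadruple_def)
  have sh: "cis (x + 2 * pi) = cis x" for x by (simp add: cis.ctr)
  obtain k1 where k1: "k1 > 0" "coef a b c = of_real k1" using coef_cis[of s t u] q abcd by auto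
  obtain k2 where k2: "k2 > 0" "coef b c d = of_real k2" using coef_cis[of t u v] q abcd by auto
  obtain k3 where k3: "k3 > 0" "coef c d a = of_real k3" using coef_cis[of u v "s + 2 * pi"] q abcd sh by auto
  obtain k4 where k4: "k4 > 0" "coef d a b = of_real k4" using coef_cis[of v "s + 2 * pi" "t + 2 * pi"] q abcd sh by auto
  have "coef a b c \<noteq> 0" "coef b c d \<noteq> 0" "coef c d a \<noteq> 0" using k1 k2 k3 by simp_all
  then have ne: "a \<noteq> b" "b \<noteq> c" "c \<noteq> d" "d \<noteq> a" "a \<noteq> c" "b \<noteq> d" by (auto simp: coef_def)
  show ?thesis by (rule that[OF k1(1) k2(1) k3(1) k4(1) k1(2) k2(2) k3(2) k4(2) ne]) (simp_all add: abcd)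
qed

lemma cmod_coef: "cmod b = 1 \<Longrightarrow> cmod (coef a b c) = cmod (c - a) / (cmod (b - a) * cmod (c - b))"
  by (simp add: coef_def norm_mult norm_divide)

text \<open>This is the power of the point \<open>\<eta>\<close> with respect to the circle, computed on the chord through \<open>b\<close> and \<open>d\<close>.\<close>

lemma barycenter_power:
  assumes "cmod b = 1" "cmod d = 1" "of_real N * \<eta> = of_real k * b + of_real l * d" "N = k + l"
  shows "N\<^sup>2 * (1 - (cmod \<eta>)\<^sup>2) = k * l * (cmod (b - d))\<^sup>2"
proof -
  have "(cmod (of_real N * \<eta>))\<^sup>2 = (k * Re b + l * Re d)\<^sup>2 + (k * Im b + l * Im d)\<^sup>2"
    unfolding assms(3) cmod_power2 by simp
  then have n: "N\<^sup>2 * (cmod \<eta>)\<^sup>2 = (k * Re b + l * Re d)\<^sup>2 + (k * Im b + l * Im d)\<^sup>2"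
    by (simp add: norm_mult power_mult_distrib)
  have b: "(Re b)\<^sup>2 = 1 - (Im b)\<^sup>2" and d: "(Re d)\<^sup>2 = 1 - (Im d)\<^sup>2"
    using assms(1,2) cmod_power2[of b] cmod_power2[of d] by simp_all
  have "(cmod (b - d))\<^sup>2 = (Re b)\<^sup>2 + (Im b)\<^sup>2 + ((Re d)\<^sup>2 + (Im d)\<^sup>2) - 2 * (Re b * Re d + Im b * Im d)"
    unfolding cmod_power2 by (simp add: power2_eq_square algebra_simps)
  then have bd: "(cmod (b - d))\<^sup>2 = 2 - 2 * (Re b * Re d + Im b * Im d)" using b d by simp
  have "(k * Re b + l * Re d)\<^sup>2 + (k * Im b + l * Im d)\<^sup>2
      = k\<^sup>2 * ((Re b)\<^sup>2 + (Im b)\<^sup>2) + l\<^sup>2 * ((Re d)\<^sup>2 + (Im d)\<^sup>2) + 2 * k * l * (Re b * Re d + Im b * Im d)"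
    by (simp add: power2_eq_square algebra_simps)
  then have "N\<^sup>2 * (cmod \<eta>)\<^sup>2 = k\<^sup>2 + l\<^sup>2 + 2 * k * l * (Re b * Re d + Im b * Im d)"
    using n b d by simp
  then show ?thesis unfolding bd assms(4) by (simp add: power2_eq_square algebra_simps)
qed

lemma ptolemy: "(c - a) * (d - b) = (b - a) * (d - c) + (c - b) * (d - a)" for a b c d :: complex
  by (simp add: algebra_simps)

text \<open>The fields \<open>\<i> z\<close> and \<open>\<i> z\<^sup>2\<close> are annihilated by \<open>X[Q]\<close>. This makes the positive coefficients at
  \<open>b, d\<close> and at \<open>a, c\<close> have the same sum \<open>N\<close> and the same barycentre \<open>\<eta>\<close>, so that both averages of the
  support function lie between the values of its lower and upper envelope at \<open>\<eta>\<close>.\<close>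

lemma harmonic_quadruple_estimate:
  assumes f: "continuous_on (sphere 0 1) f" and X: "\<And>z. cmod z = 1 \<Longrightarrow> X z = \<i> * z * of_real (f z)"
    and Q: "ccw_quadruple Q" "cross_ratio Q = 1"
  obtains \<eta> where "cmod \<eta> < 1" "1 - (cmod \<eta>)\<^sup>2 \<le> min_scale Q" "cmod (field_at X Q) \<le> 2 * width_of f \<eta>"
proof -
  obtain a b c d where abcd: "Q = (a, b, c, d)" by (cases Q) auto
  obtain k1 k2 k3 k4 where k: "k1 > 0" "k2 > 0" "k3 > 0" "k4 > 0"
    and co: "coef a b c = of_real k1" "coef b c d = of_real k2" "coef c d a = of_real k3" "coef d a b = of_real k4"
    and ne: "a \<noteq> b" "b \<noteq> c" "c \<noteq> d" "d \<noteq> a" "a \<noteq> c" "b \<noteq> d"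
    and u: "cmod a = 1" "cmod b = 1" "cmod c = 1" "cmod d = 1"
    by (rule ccw_quadruple_coefs[OF Q(1)[unfolded abcd]])
  have val: "field_at X Q = of_real (k1 * f b - k2 * f c + k3 * f d - k4 * f a)"
    unfolding abcd using field_at_coef[OF ne(1-4), of X "\<lambda>z. of_real (f z)"] X u by (simp add: co)
  have "field_at (\<lambda>z. \<i> * z) (a, b, c, d) = of_real (k1 - k2 + k3 - k4)"
    using field_at_coef[OF ne(1-4), of "\<lambda>z. \<i> * z" "\<lambda>_. 1"] by (simp add: co)
  moreover have "(\<i> * x - \<i> * y) / (x - y) = \<i>" if "x \<noteq> y" for x y
    using that by (simp flip: right_diff_distrib)
  then have "field_at (\<lambda>z. \<i> * z) (a, b, c, d) = 0"
    using ne(1-4) by (simp add: field_at_def)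
  ultimately have "complex_of_real (k1 - k2 + k3 - k4) = 0" by simp
  then have "k1 - k2 + k3 - k4 = 0" by (simp only: of_real_eq_0_iff)
  then have sum: "k1 + k3 = k2 + k4" by simp
  have "field_at (\<lambda>z. \<i> * z * z) (a, b, c, d) = of_real k1 * b - of_real k2 * c + of_real k3 * d - of_real k4 * a"
    using field_at_coef[OF ne(1-4), of "\<lambda>z. \<i> * z * z" "\<lambda>z. z"] by (simp add: co)
  moreover have sq: "(\<i> * x * x - \<i> * y * y) / (x - y) = \<i> * (x + y)" if "x \<noteq> y" for x y
  proof -
    have "\<i> * x * x - \<i> * y * y = \<i> * (x + y) * (x - y)" by (simp add: algebra_simps)
    then show ?thesis using that by simp
  qed
  then have "field_at (\<lambda>z. \<i> * z * z) (a, b, c, d) = 0"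
    unfolding field_at_def prod.case sq[OF ne(1)[symmetric]] sq[OF ne(2)[symmetric]] sq[OF ne(3)[symmetric]] sq[OF ne(4)[symmetric]]
    by (simp add: algebra_simps)
  ultimately have bary: "of_real k1 * b + of_real k3 * d = of_real k2 * c + of_real k4 * a"
    by (simp add: algebra_simps)
  define N where "N = k1 + k3"
  define \<eta> where "\<eta> = (of_real k1 * b + of_real k3 * d) / of_real N"
  have N: "N > 0" "N = k1 + k3" "N = k2 + k4" using k sum by (simp_all add: N_def)
  have \<eta>: "of_real N * \<eta> = of_real k1 * b + of_real k3 * d" "of_real N * \<eta> = of_real k2 * c + of_real k4 * a"
    using N(1) by (simp_all add: \<eta>_def bary)
  \<comment> \<open>Side and diagonal lengths; the cross ratio condition makes Ptolemy's products equal.\<close>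
  define ab bc cd da ac bd where "ab = cmod (b - a)" and "bc = cmod (c - b)" and "cd = cmod (d - c)"
    and "da = cmod (d - a)" and "ac = cmod (c - a)" and "bd = cmod (d - b)"
  have pos: "ab > 0" "bc > 0" "cd > 0" "da > 0" "ac > 0" "bd > 0"
    using ne by (auto simp: ab_def bc_def cd_def da_def ac_def bd_def)
  have cr: "(b - a) * (d - c) = (c - b) * (d - a)"
    using Q(2) ne unfolding abcd cross_ratio_def by (simp add: field_simps)
  from arg_cong[OF this, of cmod] have opp: "ab * cd = bc * da"
    by (simp add: norm_mult ab_def bc_def cd_def da_def)
  have "(c - a) * (d - b) = 2 * ((b - a) * (d - c))" using ptolemy[of c a d b] cr by simp
  from arg_cong[OF this, of cmod] have pt: "ac * bd = 2 * (ab * cd)"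
    by (simp add: norm_mult ac_def bd_def ab_def cd_def)
  have kv: "k1 = ac / (ab * bc)" "k2 = bd / (bc * cd)" "k3 = ac / (cd * da)" "k4 = bd / (da * ab)"
    using arg_cong[OF co(1), of cmod] arg_cong[OF co(2), of cmod] arg_cong[OF co(3), of cmod] arg_cong[OF co(4), of cmod]
      k u cmod_coef[of b a c] cmod_coef[of c b d] cmod_coef[of d c a] cmod_coef[of a d b]
    by (simp_all add: ab_def bc_def cd_def da_def ac_def bd_def norm_minus_commute)
  have prod: "ac\<^sup>2 * bd\<^sup>2 = 4 * ((ab * cd) * (bc * da))"
  proof -
    have "ac\<^sup>2 * bd\<^sup>2 = (ac * bd) * (ac * bd)" by (simp add: power2_eq_square)
    also have "\<dots> = (2 * (ab * cd)) * (2 * (bc * da))" unfolding pt opp ..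
    finally show ?thesis by simp
  qed
  have kk: "k1 * k3 * bd\<^sup>2 = 4" "k2 * k4 * ac\<^sup>2 = 4"
  proof -
    have "k1 * k3 * bd\<^sup>2 = ac\<^sup>2 * bd\<^sup>2 / ((ab * cd) * (bc * da))" "k2 * k4 * ac\<^sup>2 = ac\<^sup>2 * bd\<^sup>2 / ((ab * cd) * (bc * da))"
      by (simp_all add: kv power2_eq_square mult_ac)
    then show "k1 * k3 * bd\<^sup>2 = 4" "k2 * k4 * ac\<^sup>2 = 4" unfolding prod using pos by simp_all
  qed
  have N4: "N\<^sup>2 * (1 - (cmod \<eta>)\<^sup>2) = 4"
    using barycenter_power[OF u(2,4) \<eta>(1) N(2)] kk(1) by (simp add: bd_def norm_minus_commute)
  define x where "x = 1 - (cmod \<eta>)\<^sup>2"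
  have x: "x = 4 / N\<^sup>2" using N4 N(1) by (simp add: x_def field_simps)
  have x0: "x > 0" unfolding x using N(1) by simp
  then have \<eta>1: "cmod \<eta> < 1" by (simp add: x_def abs_square_less_1)
  \<comment> \<open>The power of a point on a chord is at most the square of half its length.\<close>
  have half: "x \<le> l\<^sup>2 / 4" if "N = i + j" "i * j * l\<^sup>2 = 4" for i j l
  proof -
    have "4 * (i * j) \<le> N\<^sup>2" unfolding that(1) using zero_le_power2[of "i - j"] by (simp add: power2_eq_square algebra_simps)
    then have "4 * (i * j) * l\<^sup>2 \<le> N\<^sup>2 * l\<^sup>2" by (intro mult_right_mono) auto
    then have "16 \<le> N\<^sup>2 * l\<^sup>2" using that(2) by (simp add: mult.assoc)
    then show ?thesis unfolding x using N(1) by (simp add: field_simps)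
  qed
  have "x\<^sup>2 \<le> (bd\<^sup>2 / 4) * (ac\<^sup>2 / 4)"
    unfolding power2_eq_square[of x] using half[OF N(2) kk(1)] half[OF N(3) kk(2)] x0 by (intro mult_mono) auto
  also have "\<dots> = (ac * bd / 4)\<^sup>2" by (simp add: power2_eq_square)
  finally have "x\<^sup>2 \<le> (ac * bd / 4)\<^sup>2" .
  moreover have "0 \<le> ac * bd / 4" using pos by simp
  ultimately have "x \<le> ac * bd / 4" by (rule power2_le_imp_le)
  then have xab: "x \<le> ab * cd / 2" and xbc: "x \<le> bc * da / 2" using pt opp by simp_all
  have le2: "cmod (y - w) \<le> 2" if "cmod y = 1" "cmod w = 1" for y w
    using norm_triangle_ineq4[of y w] that by simp
  have two: "x \<le> y" if "x \<le> y * w / 2" "w \<le> 2" "y > 0" for y w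
  proof -
    have "y * w \<le> y * 2" using that by (intro mult_left_mono) auto
    then show ?thesis using that(1) by simp
  qed
  have "x \<le> ab" "x \<le> bc" "x \<le> cd" "x \<le> da"
    using two[of ab cd] two[of bc da] two[of cd ab] two[of da bc] xab xbc pos le2 u
    by (simp_all add: ab_def bc_def cd_def da_def mult.commute)
  then have scale: "x \<le> min_scale Q"
    unfolding abcd min_scale_def by (simp add: ab_def bc_def cd_def da_def norm_minus_commute)
  have kf: "kfac \<eta> = 2 / N" unfolding kfac_def using x N(1) by (simp add: x_def real_sqrt_divide)
  \<comment> \<open>A weighted mean over two points of the circle dominates the envelope at their barycentre.\<close>
  have low: "N * cvx_env g \<eta> \<le> i * g y + j * g w"
    if g: "continuous_on (sphere 0 1) g" and ij: "i > 0" "j > 0" "N = i + j" and yw: "cmod y = 1" "cmod w = 1"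
      "of_real N * \<eta> = of_real i * y + of_real j * w" for g i j y w
  proof -
    have "cvx_env g \<eta> \<le> (i * g y + j * g w) / N"
    proof (rule cvx_env_le[OF g less_imp_le[OF \<eta>1]])
      fix h assume h: "affine_fun h" "\<And>w. cmod w = 1 \<Longrightarrow> h w \<le> g w"
      obtain L e where L: "linear L" "h = (\<lambda>z. L z + e)" using h(1) by (auto simp: affine_fun_def)
      have "N *\<^sub>R \<eta> = i *\<^sub>R y + j *\<^sub>R w" using yw(3) by (simp add: scaleR_conv_of_real)
      from arg_cong[OF this, of L] have "N * L \<eta> = i * L y + j * L w"
        by (simp add: linear_add[OF L(1)] linear_cmul[OF L(1)])
      then have "N * h \<eta> = i * h y + j * h w" by (simp add: L(2) ij(3) algebra_simps)
      also have "\<dots> \<le> i * g y + j * g w" using h(2) yw ij by (intro add_mono mult_left_mono) auto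
      finally show "h \<eta> \<le> (i * g y + j * g w) / N" using N(1) by (simp add: field_simps)
    qed
    then show ?thesis using N(1) by (simp add: field_simps)
  qed
  have f': "continuous_on (sphere 0 1) (\<lambda>z. - f z)" by (intro continuous_intros f)
  have "\<bar>k1 * f b - k2 * f c + k3 * f d - k4 * f a\<bar> \<le> N * (- cvx_env (\<lambda>z. - f z) \<eta> - cvx_env f \<eta>)"
    using low[OF f k(1,3) N(2) u(2,4) \<eta>(1)] low[OF f k(2,4) N(3) u(3,1) \<eta>(2)]
      low[OF f' k(1,3) N(2) u(2,4) \<eta>(1)] low[OF f' k(2,4) N(3) u(3,1) \<eta>(2)]
    by (simp add: algebra_simps abs_le_iff)
  also have "\<dots> = 2 * width_of f \<eta>" unfolding width_of_def kf using N(1) by (simp add: field_simps)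
  finally have "cmod (field_at X Q) \<le> 2 * width_of f \<eta>" unfolding val norm_of_real .
  then show ?thesis using that[OF \<eta>1] scale by (simp add: x_def)
qed

section \<open>Quadruples centred at a point\<close>

lemma cmod_cis_diff: "(cmod (cis x - cis y))\<^sup>2 = 2 - 2 * cos (x - y)"
proof -
  have "(cmod (cis x - cis y))\<^sup>2 = ((cos x)\<^sup>2 + (sin x)\<^sup>2) + ((cos y)\<^sup>2 + (sin y)\<^sup>2) - 2 * (cos x * cos y + sin x * sin y)"
    unfolding cmod_power2 by (simp only: minus_complex.sel cis.sel) (simp only: power2_eq_square algebra_simps)
  then show ?thesis by (simp add: cos_diff)
qed

lemma cis_quarter_turns:
  "cis (\<alpha> + pi/2) = \<i> * cis \<alpha>" "cis (\<alpha> + pi) = - cis \<alpha>" "cis (\<alpha> + 3*pi/2) = - (\<i> * cis \<alpha>)"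
proof -
  have e: "3 * pi / 2 = pi + pi / 2" by simp
  have "cis (3 * pi / 2) = cis pi * cis (pi/2)" unfolding cis_mult e ..
  then show "cis (\<alpha> + pi/2) = \<i> * cis \<alpha>" "cis (\<alpha> + pi) = - cis \<alpha>" "cis (\<alpha> + 3*pi/2) = - (\<i> * cis \<alpha>)"
    unfolding cis_mult[symmetric] by simp_all
qed

lemma integral_quarter_periods:
  fixes g :: "real \<Rightarrow> real"
  assumes g: "continuous_on UNIV g"
  shows "integral {0..2*pi} g = integral {0..pi/2} (\<lambda>\<alpha>. g \<alpha> + g (\<alpha> + pi/2) + g (\<alpha> + pi) + g (\<alpha> + 3*pi/2))"
proof -
  have int: "g integrable_on {u..v}" for u v
    by (intro integrable_continuous_interval continuous_on_subset[OF g]) auto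
  have int': "(\<lambda>\<alpha>. g (\<alpha> + c)) integrable_on {u..v}" for u v c
    by (intro integrable_continuous_interval continuous_on_compose2[OF g]) (auto intro!: continuous_intros)
  have sh: "integral {c..pi/2 + c} g = integral {0..pi/2} (\<lambda>\<alpha>. g (\<alpha> + c))" for c
    using integral_shift[of 0 c "pi/2" g] continuous_on_subset[OF g] by (simp add: o_def)
  have e: "pi/2 + pi/2 = pi" "pi/2 + pi = 3*pi/2" "pi/2 + 3*pi/2 = 2*pi" by (simp_all add: field_simps)
  have "integral {0..2*pi} g = integral {0..pi/2} g + integral {pi/2..pi} g + integral {pi..3*pi/2} g + integral {3*pi/2..2*pi} g"
    using Henstock_Kurzweil_Integration.integral_combine[OF _ _ int, of 0 "pi/2" pi]
      Henstock_Kurzweil_Integration.integral_combine[OF _ _ int, of 0 "pi" "3*pi/2"]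
      Henstock_Kurzweil_Integration.integral_combine[OF _ _ int, of 0 "3*pi/2" "2*pi"] by simp
  also have "\<dots> = integral {0..pi/2} g + integral {0..pi/2} (\<lambda>\<alpha>. g (\<alpha> + pi/2))
      + integral {0..pi/2} (\<lambda>\<alpha>. g (\<alpha> + pi)) + integral {0..pi/2} (\<lambda>\<alpha>. g (\<alpha> + 3*pi/2))"
    using sh[of "pi/2"] sh[of pi] sh[of "3*pi/2"] unfolding e by simp
  also have "\<dots> = integral {0..pi/2} (\<lambda>\<alpha>. g \<alpha> + g (\<alpha> + pi/2) + g (\<alpha> + pi) + g (\<alpha> + 3*pi/2))"
    by (simp only: integral_add[OF integrable_add[OF integrable_add[OF int int'] int'] int']
        integral_add[OF integrable_add[OF int int'] int'] integral_add[OF int int'])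
  finally show ?thesis .
qed

lemma cis_vis_add_2pi: "cis (vis t b (\<alpha> + 2 * pi)) = cis (vis t b \<alpha>)"
  unfolding vis_add_2pi by (simp add: cis.ctr)

context
  fixes t :: real
  assumes t: "0 \<le> t" "t < 1"
begin

lemma chord_vis:
  "cis (vis t b \<alpha>) - cis (vis t b \<beta>)
    = cis b * of_real (1 - t\<^sup>2) * (cis \<alpha> - cis \<beta>) / ((1 + of_real t * cis \<alpha>) * (1 + of_real t * cis \<beta>))"
proof -
  have n: "1 + of_real t * cis \<gamma> \<noteq> 0" for \<gamma>
    using one_plus_t_cos_pos[OF t, of \<gamma>] by (auto simp: complex_eq_iff)
  have "(cis \<alpha> + of_real t) / (1 + of_real t * cis \<alpha>) - (cis \<beta> + of_real t) / (1 + of_real t * cis \<beta>)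
      = ((cis \<alpha> + of_real t) * (1 + of_real t * cis \<beta>) - (cis \<beta> + of_real t) * (1 + of_real t * cis \<alpha>))
        / ((1 + of_real t * cis \<alpha>) * (1 + of_real t * cis \<beta>))"
    by (rule diff_frac_eq[OF n n])
  also have "(cis \<alpha> + of_real t) * (1 + of_real t * cis \<beta>) - (cis \<beta> + of_real t) * (1 + of_real t * cis \<alpha>)
      = of_real (1 - t\<^sup>2) * (cis \<alpha> - cis \<beta>)"
    by (simp add: power2_eq_square algebra_simps)
  finally have F: "(cis \<alpha> + of_real t) / (1 + of_real t * cis \<alpha>) - (cis \<beta> + of_real t) / (1 + of_real t * cis \<beta>)
      = of_real (1 - t\<^sup>2) * (cis \<alpha> - cis \<beta>) / ((1 + of_real t * cis \<alpha>) * (1 + of_real t * cis \<beta>))" .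
  have "cis (vis t b \<alpha>) - cis (vis t b \<beta>) = cis b * ((cis \<alpha> + of_real t) / (1 + of_real t * cis \<alpha>)
      - (cis \<beta> + of_real t) / (1 + of_real t * cis \<beta>))"
    unfolding cis_vis[OF t] by (simp only: right_diff_distrib)
  then show ?thesis unfolding F by (simp only: times_divide_eq_right mult.assoc)
qed

text \<open>The Moebius map \<open>cis \<alpha> \<mapsto> cis (vis t b \<alpha>)\<close> distorts chords by the square roots of its derivatives at the
  endpoints.\<close>

lemma cmod_chord_vis:
  "(cmod (cis (vis t b \<alpha>) - cis (vis t b \<beta>)))\<^sup>2 = (cmod (cis \<alpha> - cis \<beta>))\<^sup>2 / (lam t \<alpha> * lam t \<beta>)"
proof -
  have c: "(cmod (1 + of_real t * cis \<gamma>))\<^sup>2 = (1 - t\<^sup>2) * lam t \<gamma>" for \<gamma>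
  proof -
    have "(cmod (1 + of_real t * cis \<gamma>))\<^sup>2 = (1 + t * cos \<gamma>)\<^sup>2 + t\<^sup>2 * (sin \<gamma>)\<^sup>2"
      unfolding cmod_power2 by (simp add: power_mult_distrib)
    also have "\<dots> = 1 + 2 * t * cos \<gamma> + t\<^sup>2"
      unfolding sin_squared_eq by (simp add: power2_eq_square algebra_simps)
    finally show ?thesis using one_minus_t_pos[OF t] by (simp add: lam_def)
  qed
  have "(cmod (cis (vis t b \<alpha>) - cis (vis t b \<beta>)))\<^sup>2
      = (1 - t\<^sup>2)\<^sup>2 * (cmod (cis \<alpha> - cis \<beta>))\<^sup>2 / (((1 - t\<^sup>2) * lam t \<alpha>) * ((1 - t\<^sup>2) * lam t \<beta>))"
    unfolding chord_vis norm_divide norm_mult norm_cis norm_of_real c[symmetric]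
    by (simp add: power_divide power_mult_distrib)
  then show ?thesis using one_minus_t_pos[OF t] by (simp add: power2_eq_square)
qed

text \<open>The coefficient is positive by \<open>coef_cis\<close>, so its square, a quotient of squared chord lengths, determines it.\<close>

lemma coef_vis:
  "coef (cis (vis t b (\<alpha> - pi/2))) (cis (vis t b \<alpha>)) (cis (vis t b (\<alpha> + pi/2))) = of_real (lam t \<alpha>)"
proof -
  define la lb lc where "la = lam t (\<alpha> - pi/2)" and "lb = lam t \<alpha>" and "lc = lam t (\<alpha> + pi/2)"
  have l: "la > 0" "lb > 0" "lc > 0" by (simp_all add: la_def lb_def lc_def lam_pos[OF t])
  define a b' c where "a = cis (vis t b (\<alpha> - pi/2))" and "b' = cis (vis t b \<alpha>)" and "c = cis (vis t b (\<alpha> + pi/2))"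
  have "vis t b (\<alpha> - pi/2) < vis t b \<alpha>" "vis t b \<alpha> < vis t b (\<alpha> + pi/2)"
    "vis t b (\<alpha> + pi/2) < vis t b (\<alpha> - pi/2 + 2 * pi)"
    by (intro vis_strict_mono[OF t]; simp)+
  then obtain k where k: "k > 0" "coef a b' c = of_real k"
    unfolding a_def b'_def c_def vis_add_2pi by (rule coef_cis)
  have "k = cmod (coef a b' c)" using k by simp
  also have "\<dots> = cmod (c - a) / (cmod (b' - a) * cmod (c - b'))"
    by (rule cmod_coef) (simp add: b'_def)
  finally have "k\<^sup>2 = (cmod (c - a))\<^sup>2 / ((cmod (b' - a))\<^sup>2 * (cmod (c - b'))\<^sup>2)"
    by (simp add: power_divide power_mult_distrib)
  also have "(cmod (c - a))\<^sup>2 = 4 / (lc * la)"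
    unfolding a_def c_def cmod_chord_vis unfolding cmod_cis_diff by (simp add: lc_def la_def)
  also have "(cmod (b' - a))\<^sup>2 = 2 / (lb * la)"
    unfolding a_def b'_def cmod_chord_vis unfolding cmod_cis_diff by (simp add: lb_def la_def)
  also have "(cmod (c - b'))\<^sup>2 = 2 / (lc * lb)"
    unfolding b'_def c_def cmod_chord_vis unfolding cmod_cis_diff by (simp add: lc_def lb_def)
  also have "4 / (lc * la) / (2 / (lb * la) * (2 / (lc * lb))) = lb\<^sup>2"
    using l by (simp add: power2_eq_square)
  finally have "k = lb" using k(1) l(2) by (simp add: power2_eq_iff)
  then show ?thesis using k(2) by (simp add: a_def b'_def c_def lb_def)
qed

text \<open>The four ideal points seen from \<open>hpt t b\<close> in perpendicular directions.\<close>

definition visq :: "real \<Rightarrow> real \<Rightarrow> quadruple" where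
  "visq b \<alpha> = (cis (vis t b \<alpha>), cis (vis t b (\<alpha> + pi/2)), cis (vis t b (\<alpha> + pi)), cis (vis t b (\<alpha> + 3*pi/2)))"

lemma ccw_visq: "ccw_quadruple (visq b \<alpha>)"
proof -
  have "vis t b (\<alpha> + 3*pi/2) < vis t b (\<alpha> + 2*pi)" by (intro vis_strict_mono[OF t]) simp
  then have "vis t b (\<alpha> + 3*pi/2) < vis t b \<alpha> + 2*pi" by (simp add: vis_add_2pi)
  then show ?thesis
    unfolding visq_def ccw_quadruple_def prod.case
    by (intro exI[of _ "vis t b \<alpha>"] exI[of _ "vis t b (\<alpha> + pi/2)"] exI[of _ "vis t b (\<alpha> + pi)"]
        exI[of _ "vis t b (\<alpha> + 3*pi/2)"]) (simp add: vis_strict_mono[OF t])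
qed

lemma cross_ratio_visq: "cross_ratio (visq b \<alpha>) = 1"
proof -
  define x where "x = cis \<alpha>"
  obtain p q r s where pqrs: "visq b \<alpha> = (p, q, r, s)" by (cases "visq b \<alpha>") auto
  have ne: "p \<noteq> q" "q \<noteq> r" "r \<noteq> s" "s \<noteq> p"
    using ccw_quadruple_coefs[OF ccw_visq[of b \<alpha>, unfolded pqrs]] by blast+
  have n: "(\<i> * x - x) * (- (\<i> * x) - (- x)) = (- x - \<i> * x) * (- (\<i> * x) - x)"
    by (simp add: algebra_simps)
  have m: "(D * u / (d1 * d2)) * (D * v / (d3 * d4)) = (D * w / (d4 * d1)) * (D * y / (d3 * d2))"
    if "u * v = w * y" for D u v w y d1 d2 d3 d4 :: complex
  proof -
    have "D * u * (D * v) = D * w * (D * y)" using that by (simp add: mult_ac)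
    then show ?thesis by (simp add: mult_ac)
  qed
  have "(q - p) * (s - r) = (r - q) * (s - p)"
    using pqrs unfolding visq_def by (auto simp only: prod.inject chord_vis cis_quarter_turns intro!: m[OF n[unfolded x_def]])
  then show ?thesis using ne unfolding pqrs cross_ratio_def by simp
qed

lemma field_at_visq:
  assumes X: "\<And>z. cmod z = 1 \<Longrightarrow> X z = \<i> * z * of_real (f z)"
  shows "field_at X (visq b \<alpha>)
    = of_real (Phi f t b (\<alpha> + pi/2) - Phi f t b (\<alpha> + pi) + Phi f t b (\<alpha> + 3*pi/2) - Phi f t b \<alpha>)"
proof -
  define a q c d where "a = cis (vis t b \<alpha>)" and "q = cis (vis t b (\<alpha> + pi/2))" and "c = cis (vis t b (\<alpha> + pi))"
    and "d = cis (vis t b (\<alpha> + 3*pi/2))"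
  have Q: "visq b \<alpha> = (a, q, c, d)" by (simp add: visq_def a_def q_def c_def d_def)
  have ne: "a \<noteq> q" "q \<noteq> c" "c \<noteq> d" "d \<noteq> a"
    using ccw_quadruple_coefs[OF ccw_visq[of b \<alpha>, unfolded Q]] by blast+
  have u: "cmod a = 1" "cmod q = 1" "cmod c = 1" "cmod d = 1" by (simp_all add: a_def q_def c_def d_def)
  have h: "\<alpha> + pi/2 + pi/2 = \<alpha> + pi" "\<alpha> + pi - pi/2 = \<alpha> + pi/2" "\<alpha> + pi + pi/2 = \<alpha> + 3*pi/2"
    "\<alpha> + 3*pi/2 - pi/2 = \<alpha> + pi" "\<alpha> + 3*pi/2 + pi/2 = \<alpha> + 2*pi" "\<alpha> + pi/2 - pi/2 = \<alpha>"
    by (simp_all add: field_simps)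
  have d': "d = cis (vis t b (\<alpha> - pi/2))"
  proof -
    have "\<alpha> - pi/2 + 2*pi = \<alpha> + 3*pi/2" by (simp add: field_simps)
    from cis_vis_add_2pi[of t b "\<alpha> - pi/2", unfolded this] show ?thesis unfolding d_def .
  qed
  have co: "coef a q c = of_real (lam t (\<alpha> + pi/2))" "coef q c d = of_real (lam t (\<alpha> + pi))"
    "coef c d a = of_real (lam t (\<alpha> + 3*pi/2))" "coef d a q = of_real (lam t \<alpha>)"
    using coef_vis[of b "\<alpha> + pi/2"] coef_vis[of b "\<alpha> + pi"] coef_vis[of b "\<alpha> + 3*pi/2"] coef_vis[of b \<alpha>]
    unfolding h cis_vis_add_2pi d'[symmetric] by (simp_all add: a_def q_def c_def d_def)
  show ?thesis
    unfolding Q Phi_def a_def[symmetric] q_def[symmetric] c_def[symmetric] d_def[symmetric]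
    using field_at_coef[OF ne, of X "\<lambda>z. of_real (f z)"] X u by (simp add: co)
qed

text \<open>Two neighbouring points of the quadruple have visual angles with nonnegative cosine; there \<open>lam\<close> is at least
  \<open>1 / (1 - t\<^sup>2)\<close>, so the chord between them is short.\<close>

lemma min_scale_visq: "min_scale (visq b \<alpha>) \<le> 2 * (1 - t\<^sup>2)"
proof -
  have side: "cmod (cis (vis t b x) - cis (vis t b y)) \<le> 2 * (1 - t\<^sup>2)"
    if "cos x \<ge> 0" "cos y \<ge> 0" "cos (x - y) = 0" for x y
  proof -
    have t2: "1 - t\<^sup>2 > 0" by (rule one_minus_t_pos[OF t])
    have l: "1 \<le> (1 - t\<^sup>2) * lam t z" if "cos z \<ge> 0" for z
      using that t t2 by (simp add: lam_def)
    have "1 * 1 \<le> ((1 - t\<^sup>2) * lam t x) * ((1 - t\<^sup>2) * lam t y)"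
      using l[OF that(1)] l[OF that(2)] by (intro mult_mono) auto
    then have "1 / (lam t x * lam t y) \<le> (1 - t\<^sup>2)\<^sup>2"
      using lam_pos[OF t, of x] lam_pos[OF t, of y] by (simp add: pos_divide_le_eq power2_eq_square mult_ac)
    moreover have "(cmod (cis (vis t b x) - cis (vis t b y)))\<^sup>2 = 2 * (1 / (lam t x * lam t y))"
      unfolding cmod_chord_vis unfolding cmod_cis_diff by (simp add: that)
    ultimately have "(cmod (cis (vis t b x) - cis (vis t b y)))\<^sup>2 \<le> 4 * (1 - t\<^sup>2)\<^sup>2"
      using zero_le_power2[of "1 - t\<^sup>2"] by linarith
    also have "\<dots> = (2 * (1 - t\<^sup>2))\<^sup>2" unfolding power_mult_distrib by simp
    finally have "(cmod (cis (vis t b x) - cis (vis t b y)))\<^sup>2 \<le> (2 * (1 - t\<^sup>2))\<^sup>2" .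
    then show ?thesis by (rule power2_le_imp_le) (use t2 in simp)
  qed
  have c: "cos (\<alpha> + pi/2) = - sin \<alpha>" "cos (\<alpha> + pi) = - cos \<alpha>" "cos (\<alpha> + 3*pi/2) = sin \<alpha>"
    using arg_cong[OF cis_quarter_turns(1)[of \<alpha>], of Re] arg_cong[OF cis_quarter_turns(2)[of \<alpha>], of Re]
      arg_cong[OF cis_quarter_turns(3)[of \<alpha>], of Re] by simp_all
  have r: "cos (\<alpha> - (\<alpha> + pi/2)) = 0" "cos (\<alpha> + pi/2 - (\<alpha> + pi)) = 0" "cos (\<alpha> + pi - (\<alpha> + 3*pi/2)) = 0"
    "cos (\<alpha> + 3*pi/2 - \<alpha>) = 0"
  proof -
    have e: "\<alpha> - (\<alpha> + pi/2) = - (pi/2)" "\<alpha> + pi/2 - (\<alpha> + pi) = - (pi/2)" "\<alpha> + pi - (\<alpha> + 3*pi/2) = - (pi/2)"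
      "\<alpha> + 3*pi/2 - \<alpha> = pi + pi/2" by (simp_all add: field_simps)
    show "cos (\<alpha> - (\<alpha> + pi/2)) = 0" "cos (\<alpha> + pi/2 - (\<alpha> + pi)) = 0" "cos (\<alpha> + pi - (\<alpha> + 3*pi/2)) = 0"
      "cos (\<alpha> + 3*pi/2 - \<alpha>) = 0" unfolding e by (simp_all only: cos_add cos_minus cos_pi_half sin_pi)
  qed
  define a q u d where "a = cis (vis t b \<alpha>)" and "q = cis (vis t b (\<alpha> + pi/2))" and "u = cis (vis t b (\<alpha> + pi))"
    and "d = cis (vis t b (\<alpha> + 3*pi/2))"
  have "cmod (a - q) \<le> 2 * (1 - t\<^sup>2) \<or> cmod (q - u) \<le> 2 * (1 - t\<^sup>2)
      \<or> cmod (u - d) \<le> 2 * (1 - t\<^sup>2) \<or> cmod (d - a) \<le> 2 * (1 - t\<^sup>2)"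
    using side[OF _ _ r(1)] side[OF _ _ r(2)] side[OF _ _ r(3)] side[OF _ _ r(4)]
    unfolding c a_def q_def u_def d_def by linarith
  then show ?thesis
    unfolding visq_def min_scale_def a_def[symmetric] q_def[symmetric] u_def[symmetric] d_def[symmetric]
    by (auto simp: min_le_iff_disj)
qed

text \<open>As \<open>k\<close> changes sign under a quarter turn, folding the integral onto a quarter period turns \<open>Phi\<close> into its
  alternating sum over the four directions, which is \<open>- X[Q]\<close>.\<close>

lemma Phi_trig_le_field_at:
  assumes f: "continuous_on (sphere 0 1) f" and X: "\<And>z. cmod z = 1 \<Longrightarrow> X z = \<i> * z * of_real (f z)"
    and k: "continuous_on UNIV k" "\<And>\<alpha>. \<bar>k \<alpha>\<bar> \<le> 1" "\<And>\<alpha>. k (\<alpha> + pi/2) = - k \<alpha>"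
    and e: "\<And>\<alpha>. cmod (field_at X (visq b \<alpha>)) \<le> e"
  shows "\<bar>integral {0..2*pi} (\<lambda>\<alpha>. Phi f t b \<alpha> * k \<alpha>)\<bar> \<le> pi / 2 * e"
proof -
  have k': "k (\<alpha> + pi) = k \<alpha>" "k (\<alpha> + 3*pi/2) = - k \<alpha>" for \<alpha>
  proof -
    have e: "\<alpha> + pi/2 + pi/2 = \<alpha> + pi" "\<alpha> + pi + pi/2 = \<alpha> + 3*pi/2" by (simp_all add: field_simps)
    show "k (\<alpha> + pi) = k \<alpha>" "k (\<alpha> + 3*pi/2) = - k \<alpha>"
      using k(3)[of \<alpha>] k(3)[of "\<alpha> + pi/2"] k(3)[of "\<alpha> + pi"] unfolding e by simp_all
  qed
  have c: "continuous_on UNIV (\<lambda>\<alpha>. Phi f t b \<alpha> * k \<alpha>)"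
    by (intro continuous_on_mult continuous_on_Phi t f k continuous_on_id)
  define R where "R \<alpha> = Phi f t b (\<alpha> + pi/2) - Phi f t b (\<alpha> + pi) + Phi f t b (\<alpha> + 3*pi/2) - Phi f t b \<alpha>" for \<alpha>
  have R: "\<bar>R \<alpha>\<bar> \<le> e" for \<alpha>
  proof -
    have "field_at X (visq b \<alpha>) = of_real (R \<alpha>)" unfolding R_def by (rule field_at_visq[OF X])
    then show ?thesis using e[of \<alpha>] by (simp only: norm_of_real)
  qed
  have Rc: "continuous_on S (\<lambda>\<alpha>. - (R \<alpha> * k \<alpha>))" for S
    unfolding R_def
    by (intro continuous_intros continuous_on_Phi t f continuous_on_subset[OF k(1)]) auto
  have "integral {0..2*pi} (\<lambda>\<alpha>. Phi f t b \<alpha> * k \<alpha>) = integral {0..pi/2} (\<lambda>\<alpha>. - (R \<alpha> * k \<alpha>))"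
    unfolding integral_quarter_periods[OF c] k(3) k' by (rule integral_cong) (simp add: R_def algebra_simps)
  moreover have "norm (integral {0..pi/2} (\<lambda>\<alpha>. - (R \<alpha> * k \<alpha>))) \<le> e * (pi/2 - 0)"
  proof (rule integral_bound[OF _ Rc])
    fix \<alpha>
    have "\<bar>R \<alpha>\<bar> * \<bar>k \<alpha>\<bar> \<le> e * 1" using R[of \<alpha>] k(2)[of \<alpha>] by (intro mult_mono) auto
    then show "norm (- (R \<alpha> * k \<alpha>)) \<le> e" by (simp add: abs_mult)
  qed simp
  ultimately show ?thesis by (simp add: mult.commute)
qed

lemma tracefree_le_field_at:
  assumes f: "continuous_on (sphere 0 1) f" and X: "\<And>z. cmod z = 1 \<Longrightarrow> X z = \<i> * z * of_real (f z)"
    and e: "\<And>\<alpha>. cmod (field_at X (visq b \<alpha>)) \<le> e"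
  shows "tracefree f (hpt t b) \<le> 3 / 2 * e"
proof -
  define A B where "A = integral {0..2*pi} (\<lambda>\<alpha>. Phi f t b \<alpha> * cos (2 * \<alpha>))"
    and "B = integral {0..2*pi} (\<lambda>\<alpha>. Phi f t b \<alpha> * sin (2 * \<alpha>))"
  have h: "2 * (\<alpha> + pi/2) = 2 * \<alpha> + pi" for \<alpha> by simp
  have "\<bar>A\<bar> \<le> pi / 2 * e"
    unfolding A_def by (rule Phi_trig_le_field_at[OF f X _ _ _ e]) (auto intro!: continuous_intros simp: h simp del: distrib_left_numeral)
  moreover have "\<bar>B\<bar> \<le> pi / 2 * e"
    unfolding B_def by (rule Phi_trig_le_field_at[OF f X _ _ _ e]) (auto intro!: continuous_intros simp: h simp del: distrib_left_numeral)
  moreover have "sqrt (A\<^sup>2 + B\<^sup>2) \<le> \<bar>A\<bar> + \<bar>B\<bar>" by (rule sqrt_sum_squares_le_sum_abs)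
  ultimately have "sqrt (A\<^sup>2 + B\<^sup>2) \<le> pi * e" by simp
  then have "3 / (2 * pi) * sqrt (A\<^sup>2 + B\<^sup>2) \<le> 3 / (2 * pi) * (pi * e)"
    by (rule mult_left_mono) simp
  also have "\<dots> = 3 / 2 * e" by simp
  finally show ?thesis unfolding tracefree_def tangent_onorm_poisson[OF t f] A_def B_def .
qed

end

section \<open>Little Zygmund fields\<close>

lemma min_scale_nonneg: "min_scale Q \<ge> 0"
  by (cases Q) (simp add: min_scale_def)

lemma little_zygmund_uniform:
  assumes X: "little_zygmund X" and e: "e > 0"
  obtains \<delta> where "\<delta> > 0"
    "\<And>Q. ccw_quadruple Q \<Longrightarrow> cross_ratio Q = 1 \<Longrightarrow> min_scale Q < \<delta> \<Longrightarrow> cmod (field_at X Q) < e"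
proof (rule ccontr)
  assume *: "\<not> thesis"
  have "\<exists>Q. ccw_quadruple Q \<and> cross_ratio Q = 1 \<and> min_scale Q < inverse (real (Suc n)) \<and> cmod (field_at X Q) \<ge> e" for n
  proof (rule ccontr)
    assume "\<nexists>Q. ccw_quadruple Q \<and> cross_ratio Q = 1 \<and> min_scale Q < inverse (real (Suc n)) \<and> cmod (field_at X Q) \<ge> e"
    then have lt: "cmod (field_at X Q) < e" if "ccw_quadruple Q" "cross_ratio Q = 1" "min_scale Q < inverse (real (Suc n))" for Q
      using that by (meson not_le)
    have thesis by (rule that[of "inverse (real (Suc n))"]) (use lt in simp_all)
    then show False using * by simp
  qed
  then obtain Q where Q: "\<And>n. ccw_quadruple (Q n)" "\<And>n. cross_ratio (Q n) = 1"
    "\<And>n. min_scale (Q n) < inverse (real (Suc n))" "\<And>n. cmod (field_at X (Q n)) \<ge> e" by metis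
  have "\<forall>\<^sub>F n in sequentially. min_scale (Q n) \<le> inverse (real (Suc n))"
    by (intro always_eventually allI less_imp_le Q(3))
  then have "(\<lambda>n. min_scale (Q n)) \<longlonglongrightarrow> 0"
    by (rule tendsto_sandwich[OF always_eventually _ tendsto_const LIMSEQ_inverse_real_of_nat, rotated])
      (simp add: min_scale_nonneg)
  then have deg: "degenerating Q" using Q by (simp add: degenerating_def)
  have "ereal e \<le> limsup (\<lambda>n. ereal (cmod (field_at X (Q n))))"
    by (rule le_Limsup) (simp_all add: Q)
  also have "\<dots> \<le> (SUP Q\<in>{Q. degenerating Q}. limsup (\<lambda>n. ereal (cmod (field_at X (Q n)))))"
    by (rule SUP_upper) (simp add: deg)
  also have "\<dots> = 0" using X by (simp add: little_zygmund_def)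
  finally show False using e by simp
qed

text \<open>The supremum in \<open>little_zygmund\<close> is \<open>0\<close>, and not \<open>- \<infinity>\<close>, for a field with vanishing limits only because
  its index set is nonempty.\<close>

lemma degenerating_exists: "\<exists>Q. degenerating Q"
proof
  define \<tau> where "\<tau> n = 1 - inverse (real (Suc n))" for n
  have \<tau>: "0 \<le> \<tau> n" "\<tau> n < 1" for n by (simp_all add: \<tau>_def inverse_le_1_iff)
  have "min_scale (visq (\<tau> n) 0 0) \<le> 4 * inverse (real (Suc n))" for n
  proof -
    have "1 - (\<tau> n)\<^sup>2 = (1 - \<tau> n) * (1 + \<tau> n)" by (simp add: power2_eq_square algebra_simps)
    also have "\<dots> \<le> (1 - \<tau> n) * 2" using \<tau>[of n] by (intro mult_left_mono) auto
    finally show ?thesis using min_scale_visq[OF \<tau>, of n 0 0] by (simp add: \<tau>_def)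
  qed
  then have up: "\<forall>\<^sub>F n in sequentially. min_scale (visq (\<tau> n) 0 0) \<le> 4 * inverse (real (Suc n))" by simp
  have low: "\<forall>\<^sub>F n in sequentially. 0 \<le> min_scale (visq (\<tau> n) 0 0)" by (simp add: min_scale_nonneg)
  have "(\<lambda>n. 4 * inverse (real (Suc n))) \<longlonglongrightarrow> 4 * 0"
    by (intro tendsto_mult tendsto_const LIMSEQ_inverse_real_of_nat)
  from tendsto_sandwich[OF low up tendsto_const] this have "(\<lambda>n. min_scale (visq (\<tau> n) 0 0)) \<longlonglongrightarrow> 0"
    by simp
  then show "degenerating (\<lambda>n. visq (\<tau> n) 0 0)"
    by (simp add: degenerating_def ccw_visq[OF \<tau>] cross_ratio_visq[OF \<tau>])
qed

lemma little_zygmund_imp_tracefree_vanishes: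
  assumes f: "continuous_on (sphere 0 1) f" and X: "\<And>z. cmod z = 1 \<Longrightarrow> X z = \<i> * z * of_real (f z)"
    and lz: "little_zygmund X"
  shows "(tracefree f \<longlongrightarrow> 0) boundary_H2"
  unfolding tendsto_iff
proof (intro allI impI)
  fix e :: real assume e: "e > 0"
  obtain \<delta> where \<delta>: "\<delta> > 0"
    "\<And>Q. ccw_quadruple Q \<Longrightarrow> cross_ratio Q = 1 \<Longrightarrow> min_scale Q < \<delta> \<Longrightarrow> cmod (field_at X Q) < e / 2"
    using little_zygmund_uniform[OF lz, of "e / 2"] e by auto
  obtain \<rho> where \<rho>: "0 \<le> \<rho>" "\<rho> < 1" "\<And>\<eta>. \<rho> < cmod \<eta> \<Longrightarrow> cmod \<eta> < 1 \<Longrightarrow> kfac \<eta> < \<delta> / 4"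
    using kfac_small_near_circle[of "\<delta> / 4"] \<delta>(1) by auto
  have "dist (tracefree f p) 0 < e" if p: "p \<in> H2" "\<rho> < cmod (Klein p)" for p
  proof -
    obtain t b where t: "0 \<le> t" "t < 1" and pt: "p = hpt t b" using hpt_exists[OF p(1)] .
    have t2: "1 - t\<^sup>2 > 0" by (rule one_minus_t_pos[OF t])
    have "kfac (Klein p) = (1 - t\<^sup>2) / (1 + t\<^sup>2)"
      unfolding H2_props(3)[OF p(1)] by (simp add: pt hpt_def)
    then have "(1 - t\<^sup>2) = kfac (Klein p) * (1 + t\<^sup>2)"
      by (simp add: add_pos_nonneg less_imp_neq[symmetric])
    also have "\<dots> \<le> kfac (Klein p) * 2"
      using t2 kfac_pos[OF H2_props(2)[OF p(1)]] by (intro mult_left_mono) auto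
    finally have "2 * (1 - t\<^sup>2) < \<delta>" using \<rho>(3)[OF p(2) H2_props(2)[OF p(1)]] by simp
    then have "min_scale (visq t b \<alpha>) < \<delta>" for \<alpha>
      by (rule le_less_trans[OF min_scale_visq[OF t]])
    then have le: "cmod (field_at X (visq t b \<alpha>)) \<le> e / 2" for \<alpha>
      using \<delta>(2)[OF ccw_visq[OF t] cross_ratio_visq[OF t]] by (simp add: less_imp_le)
    have "tracefree f p \<le> 3 / 2 * (e / 2)"
      unfolding pt by (rule tracefree_le_field_at[OF t f X le])
    then show ?thesis using e tracefree_nonneg[OF f p(1)] by simp
  qed
  then show "\<forall>\<^sub>F p in boundary_H2. dist (tracefree f p) 0 < e"
    unfolding eventually_boundary_H2 using \<rho> by blast
qed

lemma width_vanishes_imp_little_zygmund: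
  assumes f: "continuous_on (sphere 0 1) f" and X: "\<And>z. cmod z = 1 \<Longrightarrow> X z = \<i> * z * of_real (f z)"
    and Xc: "continuous_circle_field X" and lim: "(width_of f \<longlongrightarrow> 0) (filtercomap cmod (at_left 1))"
  shows "little_zygmund X"
proof -
  have ev: "\<exists>\<rho>. 0 \<le> \<rho> \<and> \<rho> < 1 \<and> (\<forall>\<eta>. \<rho> < cmod \<eta> \<and> cmod \<eta> < 1 \<longrightarrow> dist (width_of f \<eta>) 0 < e)" if "e > 0" for e
    unfolding eventually_disk_boundary[symmetric] by (rule tendstoD[OF lim that])
  have small: "\<exists>\<delta>>0. \<forall>Q. ccw_quadruple Q \<and> cross_ratio Q = 1 \<and> min_scale Q < \<delta> \<longrightarrow> cmod (field_at X Q) < e"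
    if e: "e > 0" for e
  proof -
    obtain \<rho> where \<rho>: "0 \<le> \<rho>" "\<rho> < 1" "\<And>\<eta>. \<rho> < cmod \<eta> \<Longrightarrow> cmod \<eta> < 1 \<Longrightarrow> dist (width_of f \<eta>) 0 < e / 2"
      using ev[of "e / 2"] e by auto
    have "cmod (field_at X Q) < e" if Q: "ccw_quadruple Q" "cross_ratio Q = 1" "min_scale Q < 1 - \<rho>\<^sup>2" for Q
    proof -
      obtain \<eta> where \<eta>: "cmod \<eta> < 1" "1 - (cmod \<eta>)\<^sup>2 \<le> min_scale Q" "cmod (field_at X Q) \<le> 2 * width_of f \<eta>"
        using harmonic_quadruple_estimate[of f X Q, OF f X Q(1,2)] by blast
      have "\<rho>\<^sup>2 < (cmod \<eta>)\<^sup>2" using \<eta>(2) Q(3) by simp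
      then have "\<rho> < cmod \<eta>" by (rule power_less_imp_less_base) simp
      from \<rho>(3)[OF this \<eta>(1)] show ?thesis using \<eta>(3) by simp
    qed
    moreover have "1 - \<rho>\<^sup>2 > 0" using \<rho> by (simp add: abs_square_less_1)
    ultimately show ?thesis by blast
  qed
  have "bdd_above {cmod (field_at X Q) | Q. ccw_quadruple Q \<and> cross_ratio Q = 1}"
  proof -
    obtain \<rho> where \<rho>: "0 \<le> \<rho>" "\<rho> < 1" "\<And>\<eta>. \<rho> < cmod \<eta> \<Longrightarrow> cmod \<eta> < 1 \<Longrightarrow> dist (width_of f \<eta>) 0 < 1"
      using ev[of 1] by auto
    obtain M where "\<forall>z. cmod z = 1 \<longrightarrow> \<bar>f z\<bar> \<le> M" using circle_bounded[OF f] by metis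
    then have M: "\<bar>f z\<bar> \<le> M" if "cmod z = 1" for z using that by simp
    define K where "K = max 1 (2 * M / sqrt (1 - \<rho>\<^sup>2))"
    have K: "width_of f \<eta> \<le> K" if "cmod \<eta> < 1" for \<eta>
      using \<rho>(3)[of \<eta>] width_of_le_inner[OF f M _ \<rho>(2), of \<eta>] that by (cases "\<rho> < cmod \<eta>") (auto simp: K_def)
    show ?thesis
    proof (rule bdd_aboveI[of _ "2 * K"])
      fix x assume "x \<in> {cmod (field_at X Q) | Q. ccw_quadruple Q \<and> cross_ratio Q = 1}"
      then obtain Q where Q: "ccw_quadruple Q" "cross_ratio Q = 1" and x: "x = cmod (field_at X Q)" by auto
      obtain \<eta> where \<eta>: "cmod \<eta> < 1" "cmod (field_at X Q) \<le> 2 * width_of f \<eta>"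
        using harmonic_quadruple_estimate[of f X Q, OF f X Q] by blast
      show "x \<le> 2 * K" using \<eta>(2) K[OF \<eta>(1)] by (simp add: x)
    qed
  qed
  then have zyg: "zygmund X" using Xc by (simp add: zygmund_def)
  have ls: "limsup (\<lambda>n. ereal (cmod (field_at X (Q n)))) = 0" if Q: "degenerating Q" for Q
  proof -
    have "(\<lambda>n. cmod (field_at X (Q n))) \<longlonglongrightarrow> 0"
      unfolding tendsto_iff
    proof (intro allI impI)
      fix e :: real assume "e > 0"
      then obtain \<delta> where \<delta>: "\<delta> > 0" "\<And>Q. ccw_quadruple Q \<Longrightarrow> cross_ratio Q = 1 \<Longrightarrow> min_scale Q < \<delta> \<Longrightarrow> cmod (field_at X Q) < e"
        using small by blast
      have "\<forall>\<^sub>F n in sequentially. min_scale (Q n) < \<delta>"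
        using Q \<delta>(1) by (auto simp: degenerating_def intro: order_tendstoD(2))
      then show "\<forall>\<^sub>F n in sequentially. dist (cmod (field_at X (Q n))) 0 < e"
        by eventually_elim (use Q \<delta>(2) in \<open>simp add: degenerating_def\<close>)
    qed
    then have "(\<lambda>n. ereal (cmod (field_at X (Q n)))) \<longlonglongrightarrow> ereal 0" by (intro tendsto_ereal)
    from lim_imp_Limsup[OF _ this] show ?thesis by (simp add: zero_ereal_def)
  qed
  have "(SUP Q\<in>{Q. degenerating Q}. limsup (\<lambda>n. ereal (cmod (field_at X (Q n))))) = 0"
    using ls degenerating_exists by (simp cong: SUP_cong_simp)
  then show ?thesis using zyg by (simp add: little_zygmund_def)
qed

theorem theorem1p7:
  fixes X :: "complex \<Rightarrow> complex"
  assumes "continuous_circle_field X"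
  shows "(little_zygmund X \<longleftrightarrow>
            ((\<lambda>p. tangent_onorm p (dbar (HL X) p)) \<longlongrightarrow> 0) boundary_H2) \<and>
         (((\<lambda>p. tangent_onorm p (dbar (HL X) p)) \<longlongrightarrow> 0) boundary_H2 \<longleftrightarrow>
            (width X \<longlongrightarrow> 0) (filtercomap cmod (at_left 1)))"
proof -
  define f where "f = supp_fun X"
  have f: "continuous_on (sphere 0 1) f" and X: "\<And>z. cmod z = 1 \<Longrightarrow> X z = \<i> * z * of_real (f z)"
    unfolding f_def using supp_fun_props[OF assms] by auto
  have "HL X = (\<lambda>q. hJ q (grad (poisson f) q))"
    by (simp add: fun_eq_iff HL_def u_of_eq[OF assms] f_def)
  then have HL: "(\<lambda>p. tangent_onorm p (dbar (HL X) p)) = tracefree f"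
    by (simp add: tracefree_def[abs_def])
  have width: "width X = width_of f" by (simp add: width_eq f_def)
  show ?thesis
    unfolding HL width
    using tracefree_vanishes_iff_width_vanishes[OF f] little_zygmund_imp_tracefree_vanishes[OF f X]
      width_vanishes_imp_little_zygmund[OF f X assms] by blast
qed

end
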